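(* Let $k\ge 1$ be an integer and $c>1$ a real number, and for each positive integer $n$ let $N=c2^k n$ (rounded to an integer). Then for every real $\gamma>0$, \[ \lim_{n\to \infty} \Pr\big(G(N,p)\to B_n^{(k)}\big)= \begin{cases} 0 & \text{if } p\le\frac{1}{c^{1/k}}(1-\gamma),\\[2pt] 1 & \text{if } p\ge\frac{1}{c^{1/k}}(1+\gamma). \end{cases} \]
   Context: $G(N,p)$ denotes the Erdős–Rényi random graph on $N$ labeled vertices in which each pair of vertices is an edge independently with probability $p$. For graphs $G$ and $H$, $G\to H$ means that every coloring of the edges of $G$ with two colors (red/blue) contains a monochromatic copy of $H$. The book graph $B_n^{(k)}$ consists of $n$ copies of the complete graph $K_{k+1}$ all sharing a common $K_k$ (so it has $k+n$ vertices). Rounding of $N$ to an integer is immaterial for the asymptotic statement. *)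

theory Defs
  imports "HOL-Probability.Probability" "HOL-Library.Ramsey"
begin

text \<open>
  A graph is a pair of a vertex set and an edge set, an edge being a two-element set of
  vertices, i.e. an element of \<open>nsets V 2\<close>.
\<close>
type_synonym 'a graph = "'a set \<times> 'a set set"

abbreviation verts :: "'a graph \<Rightarrow> 'a set" where
  "verts \<equiv> fst"

abbreviation edges :: "'a graph \<Rightarrow> 'a set set" where
  "edges \<equiv> snd"

text \<open>A copy of \<open>H\<close> in \<open>G\<close> is a subgraph, not necessarily induced.\<close>
definition contains_copy :: "'a graph \<Rightarrow> 'b graph \<Rightarrow> bool" where
  "contains_copy G H \<longleftrightarrow>
     (\<exists>f. inj_on f (verts H) \<and> f ` verts H \<subseteq> verts G \<and> (\<forall>e\<in>edges H. f ` e \<in> edges G))"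

text \<open>Colours outside \<open>edges G\<close> are irrelevant, so colourings are total functions.\<close>
definition arrows :: "'a graph \<Rightarrow> 'b graph \<Rightarrow> bool" where
  "arrows G H \<longleftrightarrow>
     (\<forall>col :: 'a set \<Rightarrow> bool. \<exists>red. contains_copy (verts G, {e \<in> edges G. col e = red}) H)"

text \<open>The spine is \<open>{..<k}\<close>; the \<open>i\<close>-th clique on \<open>k + 1\<close> vertices adds the vertex \<open>k + i\<close>.\<close>
definition book :: "nat \<Rightarrow> nat \<Rightarrow> nat graph" where
  "book k n = ({..<k + n}, \<Union>i<n. nsets (insert (k + i) {..<k}) 2)"

definition random_graph :: "nat \<Rightarrow> real \<Rightarrow> nat graph pmf" where
  "random_graph N p =
     map_pmf (\<lambda>f. ({..<N}, {e \<in> nsets {..<N} 2. f e}))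
       (Pi_pmf (nsets {..<N} 2) False (\<lambda>_. bernoulli_pmf p))"

end

theory Submission
  imports Defs
begin

text \<open>
  For the 0-statement, colour the edges by independent fair coins: each colour class is then a
  \<open>G(N, p/2)\<close>, whose \<open>k\<close>-sets have about \<open>N (p/2)^k = c p^k n < n\<close> common neighbours.

  For the 1-statement only the quasirandomness of \<open>G(N, p)\<close> is used. Vertex subsets are replaced by
  probability weights on the vertices, so that regularity passes to every dominated weight; a
  density increment makes pairs of weights regular, and Ramsey's theorem yields weights that are
  regular with themselves. Call such a weight red if red has density at least \<open>p/2\<close> in it. If there
  is no red book, fewer than about \<open>N/2^k\<close> vertices are joined to it almost entirely in red, so the
  next weight can be chosen among vertices with positive blue degree to it. As
  \<open>(2k - 2)/2^k < 1\<close>, this can be repeated until there are \<open>2k - 1\<close> weights, hence \<open>k\<close> of one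
  colour, say red, whose pairs have positive blue density. A vertex with relative red and blue
  degrees \<open>x\<^sub>i\<close>, \<open>y\<^sub>i\<close> to them (\<open>x\<^sub>i + y\<^sub>i = p\<close> up to a small error) is a page of a
  proportion \<open>x\<^sub>i^k\<close> of the red cliques inside the \<open>i\<close>-th weight, and of a proportion \<open>\<Prod>y\<^sub>i\<close> of
  the blue cliques across the weights. Since \<open>\<Prod>y\<^sub>i + (1/k) \<Sum>x\<^sub>i^k \<ge> 2 (p/2)^k\<close>, averaging
  gives a monochromatic book with nearly \<open>N (p/2)^k > n\<close> pages.
\<close>

section \<open>Regular pairs of weights\<close>

text \<open>Quasirandomness of the graph is an error \<open>\<eta> * (card V)\<^sup>2\<close>, which
  for weights bounded by \<open>C / card V\<close> becomes \<open>C\<^sup>2 * \<eta>\<close>. So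
  every construction passes only to weights dominated by a multiple of the uniform one, with a
  constant that does not depend on the graph, and \<open>\<eta>\<close> is chosen after all these
  constants. Regularity is set up to survive such passages: the error is multiplied by constants
  while the density \<open>d\<close> stays, so that each construction can ask the previous one for a
  smaller error. The obstacle is that cliques of a colour can be counted only where that colour has
  density bounded below, since the counting error is divided by a power of the density. A
  self-regular weight has a dense colour for free. Density of the other colour between two weights
  has to be forced, and this is what the absence of books provides. At the end the average over the
  cliques across the weights and the mean of the \<open>k\<close> averages inside the weights add up
  to at most about \<open>2 * n\<close>, against \<open>2 * (p / 2) ^ k * card V\<close> from the
  product inequality. The gap \<open>\<zeta>\<close> absorbs all errors.\<close>

definition prob_weight :: "'a set \<Rightarrow> ('a \<Rightarrow> real) \<Rightarrow> bool" where
  "prob_weight V \<mu> \<longleftrightarrow> (\<forall>x\<in>V. 0 \<le> \<mu> x) \<and> sum \<mu> V = 1"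

definition unit_kernel :: "'a set \<Rightarrow> ('a \<Rightarrow> 'a \<Rightarrow> real) \<Rightarrow> bool" where
  "unit_kernel V E \<longleftrightarrow> (\<forall>x\<in>V. \<forall>y\<in>V. 0 \<le> E x y \<and> E x y \<le> 1)"

text \<open>With \<open>d = 0\<close> this is the weighted number of edges between \<open>a\<close>
  and \<open>b\<close>, hence the edge density of two probability weights. In general it is the
  signed error of predicting that number by a density \<open>d\<close>, as in the cut norm.\<close>

definition cutdev :: "'a set \<Rightarrow> ('a \<Rightarrow> 'a \<Rightarrow> real) \<Rightarrow> real \<Rightarrow> ('a \<Rightarrow> real) \<Rightarrow> ('a \<Rightarrow> real) \<Rightarrow> real" where
  "cutdev V E d a b = (\<Sum>x\<in>V. \<Sum>y\<in>V. a x * b y * (E x y - d))"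

definition subweight :: "'a set \<Rightarrow> ('a \<Rightarrow> real) \<Rightarrow> ('a \<Rightarrow> real) \<Rightarrow> bool" where
  "subweight V a \<mu> \<longleftrightarrow> (\<forall>x\<in>V. 0 \<le> a x \<and> a x \<le> \<mu> x)"

text \<open>The error is absolute rather than relative to the masses of \<open>a\<close> and
  \<open>b\<close>, and \<open>d\<close> is a parameter that may differ from the density of the
  pair. These two conventions let a dominated pair inherit regularity with the same
  \<open>d\<close>.\<close>

definition regular ::
  "'a set \<Rightarrow> real \<Rightarrow> real \<Rightarrow> ('a \<Rightarrow> 'a \<Rightarrow> real) \<Rightarrow> ('a \<Rightarrow> real) \<Rightarrow> ('a \<Rightarrow> real) \<Rightarrow> bool" where
  "regular V \<epsilon> d E \<mu> \<nu> \<longleftrightarrow>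
     (\<forall>a b. subweight V a \<mu> \<longrightarrow> subweight V b \<nu> \<longrightarrow> \<bar>cutdev V E d a b\<bar> \<le> \<epsilon>)"

lemma regularD:
  "regular V \<epsilon> d E \<mu> \<nu> \<Longrightarrow> subweight V a \<mu> \<Longrightarrow> subweight V b \<nu> \<Longrightarrow> \<bar>cutdev V E d a b\<bar> \<le> \<epsilon>"
  by (simp add: regular_def)

lemma regular_mono: "regular V \<epsilon> d E \<mu> \<nu> \<Longrightarrow> \<epsilon> \<le> \<epsilon>' \<Longrightarrow> regular V \<epsilon>' d E \<mu> \<nu>"
  unfolding regular_def by (meson order_trans)

lemma cutdev_add_left: "cutdev V E d (\<lambda>x. a x + a' x) b = cutdev V E d a b + cutdev V E d a' b"
  by (simp add: cutdev_def distrib_right sum.distrib)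

lemma cutdev_add_right: "cutdev V E d a (\<lambda>y. b y + b' y) = cutdev V E d a b + cutdev V E d a b'"
  by (simp add: cutdev_def distrib_left distrib_right sum.distrib)

lemma cutdev_scale: "cutdev V E d (\<lambda>x. s * a x) (\<lambda>y. t * b y) = s * t * cutdev V E d a b"
  by (simp add: cutdev_def sum_distrib_left mult_ac)

lemma cutdev_sum_left:
  "finite I \<Longrightarrow> cutdev V E d (\<lambda>x. \<Sum>i\<in>I. a i x) b = (\<Sum>i\<in>I. cutdev V E d (a i) b)"
  by (induction I rule: finite_induct) (simp_all add: cutdev_add_left, simp add: cutdev_def)

lemma cutdev_sum_right:
  "finite I \<Longrightarrow> cutdev V E d a (\<lambda>x. \<Sum>i\<in>I. b i x) = (\<Sum>i\<in>I. cutdev V E d a (b i))"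
  by (induction I rule: finite_induct) (simp_all add: cutdev_add_right, simp add: cutdev_def)

lemma cutdev_eq: "cutdev V E d a b = cutdev V E 0 a b - d * sum a V * sum b V"
proof -
  have "cutdev V E d a b = (\<Sum>x\<in>V. \<Sum>y\<in>V. a x * b y * E x y) - (\<Sum>x\<in>V. \<Sum>y\<in>V. d * (a x * b y))"
    by (simp add: cutdev_def right_diff_distrib sum_subtractf mult_ac)
  also have "(\<Sum>x\<in>V. \<Sum>y\<in>V. d * (a x * b y)) = d * sum a V * sum b V"
    by (simp add: sum_product sum_distrib_left mult_ac)
  finally show ?thesis by (simp add: cutdev_def)
qed

lemma cutdev_swap:
  assumes "\<And>x y. x \<in> V \<Longrightarrow> y \<in> V \<Longrightarrow> E x y = E y x"
  shows "cutdev V E d a b = cutdev V E d b a"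
  unfolding cutdev_def by (subst sum.swap) (auto intro!: sum.cong simp: assms mult_ac)

lemma cutdev_0_bounds:
  assumes "unit_kernel V E" "\<forall>x\<in>V. 0 \<le> a x" "\<forall>x\<in>V. 0 \<le> b x"
  shows "0 \<le> cutdev V E 0 a b" "cutdev V E 0 a b \<le> sum a V * sum b V"
proof -
  show "0 \<le> cutdev V E 0 a b"
    using assms by (auto simp: cutdev_def unit_kernel_def intro!: sum_nonneg)
  have "cutdev V E 0 a b \<le> (\<Sum>x\<in>V. \<Sum>y\<in>V. a x * b y)"
    unfolding cutdev_def using assms
    by (intro sum_mono) (auto simp: unit_kernel_def intro!: mult_left_le)
  thus "cutdev V E 0 a b \<le> sum a V * sum b V" by (simp add: sum_product)
qed

lemma subweight_refl: "prob_weight V \<mu> \<Longrightarrow> subweight V \<mu> \<mu>"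
  by (simp add: subweight_def prob_weight_def)

lemma subweight_diff: "subweight V a \<mu> \<Longrightarrow> subweight V (\<lambda>x. \<mu> x - a x) \<mu>"
  by (simp add: subweight_def)

lemma subweight_sum:
  assumes "subweight V a \<mu>" "prob_weight V \<mu>"
  shows "0 \<le> sum a V" "sum a V \<le> 1"
proof -
  have "sum a V \<le> sum \<mu> V" using assms by (intro sum_mono) (auto simp: subweight_def)
  thus "sum a V \<le> 1" using assms by (simp add: prob_weight_def)
  show "0 \<le> sum a V" using assms by (auto simp: subweight_def intro!: sum_nonneg)
qed

lemma abs_cutdev_le_1:
  assumes "unit_kernel V E" "prob_weight V \<mu>" "prob_weight V \<nu>" "subweight V a \<mu>" "subweight V b \<nu>"
    and d: "0 \<le> d" "d \<le> 1"
  shows "\<bar>cutdev V E d a b\<bar> \<le> 1"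
proof -
  define s where "s = sum a V * sum b V"
  have s: "0 \<le> s" "s \<le> 1"
    using subweight_sum[OF assms(4,2)] subweight_sum[OF assms(5,3)]
    by (auto simp: s_def mult_le_one)
  have "0 \<le> cutdev V E 0 a b" "cutdev V E 0 a b \<le> s"
    using cutdev_0_bounds[OF assms(1), of a b] assms(4,5) by (auto simp: s_def subweight_def)
  moreover have "0 \<le> d * s" "d * s \<le> 1"
    using s d by (auto simp: mult_le_one)
  moreover have "cutdev V E d a b = cutdev V E 0 a b - d * s"
    by (subst cutdev_eq) (simp add: s_def)
  ultimately show ?thesis using s by linarith
qed

text \<open>Scaling by \<open>1 / C\<close> and \<open>1 / D\<close> turns subweights of the new
  weights into subweights of the old ones, and \<open>cutdev\<close> is bilinear. The loss depends
  on the domination constants only, so it can be paid in advance by a smaller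
  \<open>\<epsilon>\<close>.\<close>

lemma regular_subweight:
  assumes reg: "regular V \<epsilon> d E \<mu> \<nu>" and C: "C > 0" "D > 0"
    and le: "\<And>x. x \<in> V \<Longrightarrow> \<mu>' x \<le> C * \<mu> x" "\<And>x. x \<in> V \<Longrightarrow> \<nu>' x \<le> D * \<nu> x"
  shows "regular V (C * D * \<epsilon>) d E \<mu>' \<nu>'"
  unfolding regular_def
proof (intro allI impI)
  fix a b assume ab: "subweight V a \<mu>'" "subweight V b \<nu>'"
  have "subweight V (\<lambda>x. (1/C) * a x) \<mu>" "subweight V (\<lambda>x. (1/D) * b x) \<nu>"
  proof -
    show "subweight V (\<lambda>x. (1/C) * a x) \<mu>"
      using ab(1) le(1) C unfolding subweight_def
      by (force simp: pos_divide_le_eq mult.commute)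
    show "subweight V (\<lambda>x. (1/D) * b x) \<nu>"
      using ab(2) le(2) C unfolding subweight_def
      by (force simp: pos_divide_le_eq mult.commute)
  qed
  from regularD[OF reg this] have "\<bar>cutdev V E d a b\<bar> / (C * D) \<le> \<epsilon>"
    unfolding cutdev_scale using C by (simp add: abs_mult)
  thus "\<bar>cutdev V E d a b\<bar> \<le> C * D * \<epsilon>"
    using C by (simp add: field_simps)
qed

lemma regular_swap:
  assumes "regular V \<epsilon> d E \<mu> \<nu>" "\<And>x y. x \<in> V \<Longrightarrow> y \<in> V \<Longrightarrow> E x y = E y x"
  shows "regular V \<epsilon> d E \<nu> \<mu>"
  unfolding regular_def
proof (intro allI impI)
  fix a b assume ab: "subweight V a \<nu>" "subweight V b \<mu>"
  have "cutdev V E d a b = cutdev V E d b a" by (rule cutdev_swap) (rule assms(2))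
  thus "\<bar>cutdev V E d a b\<bar> \<le> \<epsilon>" using regularD[OF assms(1) ab(2,1)] by simp
qed

lemma regular_change_density:
  assumes "regular V \<epsilon> d E \<mu> \<nu>" "prob_weight V \<mu>" "prob_weight V \<nu>" "\<bar>d - d'\<bar> \<le> \<delta>"
  shows "regular V (\<epsilon> + \<delta>) d' E \<mu> \<nu>"
  unfolding regular_def
proof (intro allI impI)
  fix a b assume ab: "subweight V a \<mu>" "subweight V b \<nu>"
  define s where "s = sum a V * sum b V"
  have s: "0 \<le> s" "s \<le> 1"
    using subweight_sum[OF ab(1) assms(2)] subweight_sum[OF ab(2) assms(3)]
    by (auto simp: s_def mult_le_one)
  have "cutdev V E d' a b = cutdev V E d a b + (d - d') * s"
    using cutdev_eq[of V E d a b] cutdev_eq[of V E d' a b] by (simp add: s_def algebra_simps)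
  moreover have "\<bar>(d - d') * s\<bar> \<le> \<delta> * 1"
    unfolding abs_mult using s assms(4) by (intro mult_mono) auto
  ultimately show "\<bar>cutdev V E d' a b\<bar> \<le> \<epsilon> + \<delta>"
    using regularD[OF assms(1) ab] by linarith
qed

lemma regular_complement:
  assumes "regular V \<epsilon> d E \<mu> \<nu>" "regular V \<delta> p G \<mu> \<nu>"
    and "\<And>x y. x \<in> V \<Longrightarrow> y \<in> V \<Longrightarrow> E x y + E' x y = G x y"
  shows "regular V (\<epsilon> + \<delta>) (p - d) E' \<mu> \<nu>"
  unfolding regular_def
proof (intro allI impI)
  fix a b assume ab: "subweight V a \<mu>" "subweight V b \<nu>"
  have "cutdev V E' (p - d) a b = cutdev V G p a b - cutdev V E d a b"
    unfolding cutdev_def sum_subtractf[symmetric]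
    by (intro sum.cong refl) (simp flip: assms(3) add: algebra_simps)
  thus "\<bar>cutdev V E' (p - d) a b\<bar> \<le> \<epsilon> + \<delta>"
    using regularD[OF assms(1) ab] regularD[OF assms(2) ab] by linarith
qed

text \<open>
  If \<open>(a, b)\<close> witnesses irregularity from below, the four deviations of the boxes spanned by \<open>a\<close>,
  \<open>b\<close> and their complements add up to \<open>0\<close>, so one of the others has a large positive deviation.
\<close>
lemma irregular_imp_denser:
  assumes "\<not> regular V \<epsilon> (cutdev V E 0 \<mu> \<nu>) E \<mu> \<nu>" and E: "unit_kernel V E"
    and pw: "prob_weight V \<mu>" "prob_weight V \<nu>" and "\<epsilon> > 0"
  shows "\<exists>\<mu>' \<nu>'. prob_weight V \<mu>' \<and> prob_weight V \<nu>' \<and>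
           (\<forall>x\<in>V. \<mu>' x \<le> 3 / \<epsilon> * \<mu> x) \<and> (\<forall>x\<in>V. \<nu>' x \<le> 3 / \<epsilon> * \<nu> x) \<and>
           cutdev V E 0 \<mu>' \<nu>' > cutdev V E 0 \<mu> \<nu> + \<epsilon> / 3"
proof -
  define d where "d = cutdev V E 0 \<mu> \<nu>"
  obtain a0 b0 where ab0: "subweight V a0 \<mu>" "subweight V b0 \<nu>" "\<bar>cutdev V E d a0 b0\<bar> > \<epsilon>"
    using assms(1) unfolding regular_def d_def by (auto simp: not_le)
  define a1 b1 where "a1 = (\<lambda>x. \<mu> x - a0 x)" and "b1 = (\<lambda>x. \<nu> x - b0 x)"
  have ab1: "subweight V a1 \<mu>" "subweight V b1 \<nu>"
    using ab0 by (auto simp: a1_def b1_def subweight_diff)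
  have "cutdev V E d \<mu> \<nu> = 0"
    by (subst cutdev_eq) (use pw in \<open>simp add: d_def prob_weight_def\<close>)
  moreover have "cutdev V E d (\<lambda>x. a0 x + a1 x) (\<lambda>x. b0 x + b1 x) = cutdev V E d \<mu> \<nu>"
    by (simp add: a1_def b1_def)
  ultimately have sum0: "cutdev V E d a0 b0 + cutdev V E d a0 b1 + cutdev V E d a1 b0 + cutdev V E d a1 b1 = 0"
    by (simp add: cutdev_add_left cutdev_add_right)
  have "\<exists>a b. subweight V a \<mu> \<and> subweight V b \<nu> \<and> cutdev V E d a b > \<epsilon> / 3"
  proof (rule ccontr)
    assume "\<not> ?thesis"
    hence *: "cutdev V E d a b \<le> \<epsilon> / 3" if "subweight V a \<mu>" "subweight V b \<nu>" for a b
      using that by (meson not_le)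
    show False
      using *[OF ab0(1,2)] *[OF ab0(1) ab1(2)] *[OF ab1(1) ab0(2)] *[OF ab1] sum0 ab0(3) \<open>\<epsilon> > 0\<close>
      by linarith
  qed
  then obtain a b where ab: "subweight V a \<mu>" "subweight V b \<nu>" "cutdev V E d a b > \<epsilon> / 3" by blast
  define s t where "s = sum a V" and "t = sum b V"
  have st: "0 \<le> s" "s \<le> 1" "0 \<le> t" "t \<le> 1"
    using subweight_sum[OF ab(1) pw(1)] subweight_sum[OF ab(2) pw(2)] by (auto simp: s_def t_def)
  have d0: "0 \<le> d"
    unfolding d_def using pw by (intro cutdev_0_bounds E) (auto simp: prob_weight_def)
  have "cutdev V E d a b \<le> s * t"
  proof -
    have "cutdev V E 0 a b \<le> s * t"
      using cutdev_0_bounds(2)[OF E, of a b] ab by (auto simp: s_def t_def subweight_def)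
    moreover have "0 \<le> d * s * t" using d0 st by simp
    ultimately show ?thesis by (subst cutdev_eq) (simp add: s_def t_def)
  qed
  \<comment> \<open>A deviation is at most the mass \<open>s * t\<close> of its box, so neither mass
    is tiny and normalizing costs at most a factor \<open>3 / \<epsilon>\<close>.\<close>
  hence "s * t > \<epsilon> / 3" using ab(3) by linarith
  moreover have "s * t \<le> s" "s * t \<le> t"
    using st by (auto simp: mult_left_le mult_left_le_one_le)
  ultimately have st': "s > \<epsilon> / 3" "t > \<epsilon> / 3" by linarith+
  with \<open>\<epsilon> > 0\<close> have pos: "s > 0" "t > 0" by linarith+
  have inv: "1 / s \<le> 3 / \<epsilon>" "1 / t \<le> 3 / \<epsilon>"
    using st' pos \<open>\<epsilon> > 0\<close> by (auto simp: field_simps)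
  define \<mu>' \<nu>' where "\<mu>' = (\<lambda>x. (1 / s) * a x)" and "\<nu>' = (\<lambda>x. (1 / t) * b x)"
  have pw': "prob_weight V \<mu>'" "prob_weight V \<nu>'"
    using ab pos by (auto simp: prob_weight_def \<mu>'_def \<nu>'_def subweight_def s_def t_def
        simp flip: sum_divide_distrib)
  have "\<mu>' x \<le> 3 / \<epsilon> * \<mu> x" if "x \<in> V" for x
    unfolding \<mu>'_def using ab(1) inv that \<open>\<epsilon> > 0\<close> pos by (intro mult_mono) (auto simp: subweight_def)
  moreover have "\<nu>' x \<le> 3 / \<epsilon> * \<nu> x" if "x \<in> V" for x
    unfolding \<nu>'_def using ab(2) inv that \<open>\<epsilon> > 0\<close> pos by (intro mult_mono) (auto simp: subweight_def)
  moreover have "cutdev V E 0 \<mu>' \<nu>' > d + \<epsilon> / 3"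
  proof -
    have "cutdev V E d \<mu>' \<nu>' = cutdev V E d a b / (s * t)"
      by (simp add: \<mu>'_def \<nu>'_def cutdev_scale[of V E d "1/s" a "1/t" b, simplified])
    also have "\<dots> \<ge> cutdev V E d a b"
      using pos st ab(3) \<open>\<epsilon> > 0\<close>
      by (simp add: le_divide_eq mult_left_le mult_le_one)
    finally have "cutdev V E d \<mu>' \<nu>' > \<epsilon> / 3" using ab(3) by linarith
    thus ?thesis using pw' by (subst (asm) cutdev_eq) (simp add: prob_weight_def)
  qed
  ultimately show ?thesis using pw' unfolding d_def by blast
qed

section \<open>Regularizing pairs, stars and families of weights\<close>

lemma exists_regular_pair_aux:
  fixes V :: "'a set"
  assumes "\<epsilon> > 0" "\<epsilon> \<le> 3"  "unit_kernel V E" "prob_weight V \<mu>" "prob_weight V \<nu>"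
    and "cutdev V E 0 \<mu> \<nu> > 1 - real m * (\<epsilon> / 3)"
  shows "\<exists>\<mu>' \<nu>' d. prob_weight V \<mu>' \<and> prob_weight V \<nu>' \<and>
           (\<forall>x\<in>V. \<mu>' x \<le> (3 / \<epsilon>) ^ m * \<mu> x) \<and> (\<forall>x\<in>V. \<nu>' x \<le> (3 / \<epsilon>) ^ m * \<nu> x) \<and>
           cutdev V E 0 \<mu> \<nu> \<le> d \<and> d \<le> 1 \<and> regular V \<epsilon> d E \<mu>' \<nu>'"
  using assms(4-)
proof (induction m arbitrary: \<mu> \<nu>)
  \<comment> \<open>A density above 1 is impossible: \<open>m\<close> bounds the number of
    increments by \<open>\<epsilon> / 3\<close> that are still available.\<close>
  case 0
  thus ?case
    using cutdev_0_bounds(2)[OF assms(3), of \<mu> \<nu>] by (auto simp: prob_weight_def)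
next
  case (Suc m)
  have ge1: "3 / \<epsilon> \<ge> 1" using assms by simp
  show ?case
  proof (cases "regular V \<epsilon> (cutdev V E 0 \<mu> \<nu>) E \<mu> \<nu>")
    case True
    have "1 \<le> (3 / \<epsilon>) ^ Suc m" using ge1 by (intro one_le_power)
    hence "\<mu> x \<le> (3 / \<epsilon>) ^ Suc m * \<mu> x" "\<nu> x \<le> (3 / \<epsilon>) ^ Suc m * \<nu> x" if "x \<in> V" for x
      using Suc.prems that
      by (auto simp: prob_weight_def intro!: mult_right_mono[of 1 "(3 / \<epsilon>) ^ Suc m", simplified])
    moreover have "cutdev V E 0 \<mu> \<nu> \<le> 1"
      using cutdev_0_bounds(2)[OF assms(3), of \<mu> \<nu>] Suc.prems by (auto simp: prob_weight_def)
    ultimately show ?thesis using True Suc.prems by blast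
  next
    case False
    obtain \<mu>1 \<nu>1 where 1: "prob_weight V \<mu>1" "prob_weight V \<nu>1"
      "\<forall>x\<in>V. \<mu>1 x \<le> 3 / \<epsilon> * \<mu> x" "\<forall>x\<in>V. \<nu>1 x \<le> 3 / \<epsilon> * \<nu> x"
      "cutdev V E 0 \<mu>1 \<nu>1 > cutdev V E 0 \<mu> \<nu> + \<epsilon> / 3"
      using irregular_imp_denser[OF False assms(3) Suc.prems(1,2) assms(1)] by blast
    have "1 - real m * (\<epsilon> / 3) < cutdev V E 0 \<mu>1 \<nu>1"
      using 1(5) Suc.prems(3) by (simp add: algebra_simps add_divide_distrib)
    from Suc.IH[OF 1(1,2) this] obtain \<mu>2 \<nu>2 d where 2: "prob_weight V \<mu>2" "prob_weight V \<nu>2"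
       "\<forall>x\<in>V. \<mu>2 x \<le> (3 / \<epsilon>) ^ m * \<mu>1 x" "\<forall>x\<in>V. \<nu>2 x \<le> (3 / \<epsilon>) ^ m * \<nu>1 x"
       "cutdev V E 0 \<mu>1 \<nu>1 \<le> d" "d \<le> 1" "regular V \<epsilon> d E \<mu>2 \<nu>2" by blast
    have "\<mu>2 x \<le> (3 / \<epsilon>) ^ Suc m * \<mu> x" "\<nu>2 x \<le> (3 / \<epsilon>) ^ Suc m * \<nu> x" if "x \<in> V" for x
    proof -
      have "(3 / \<epsilon>) ^ m * \<mu>1 x \<le> (3 / \<epsilon>) ^ m * (3 / \<epsilon> * \<mu> x)"
           "(3 / \<epsilon>) ^ m * \<nu>1 x \<le> (3 / \<epsilon>) ^ m * (3 / \<epsilon> * \<nu> x)"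
        using 1 that assms(1) by (intro mult_left_mono; simp)+
      thus "\<mu>2 x \<le> (3 / \<epsilon>) ^ Suc m * \<mu> x" "\<nu>2 x \<le> (3 / \<epsilon>) ^ Suc m * \<nu> x"
        using 2(3,4) that by (simp_all add: mult.left_commute mult.assoc) (force+)
    qed
    thus ?thesis using 1 2 assms(1)
      by (intro exI[of _ \<mu>2] exI[of _ \<nu>2] exI[of _ d]) auto
  qed
qed

text \<open>\<open>C\<close> is uniform over all kernels and weights. The clause
  \<open>cutdev V E 0 \<mu> \<nu> \<le> d\<close> records that increments only raise the density, so
  a lower bound on it survives the regularization.\<close>

lemma exists_regular_pair:
  fixes \<epsilon> :: real
  assumes "\<epsilon> > 0"
  shows "\<exists>C\<ge>1. \<forall>(V :: 'a set) E \<mu> \<nu>. unit_kernel V E \<longrightarrow> prob_weight V \<mu> \<longrightarrow> prob_weight V \<nu> \<longrightarrow>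
     (\<exists>\<mu>' \<nu>' d. prob_weight V \<mu>' \<and> prob_weight V \<nu>' \<and>
           (\<forall>x\<in>V. \<mu>' x \<le> C * \<mu> x) \<and> (\<forall>x\<in>V. \<nu>' x \<le> C * \<nu> x) \<and>
           cutdev V E 0 \<mu> \<nu> \<le> d \<and> d \<le> 1 \<and> regular V \<epsilon> d E \<mu>' \<nu>')"
proof -
  define \<epsilon>' where "\<epsilon>' = min \<epsilon> 3"
  have e: "\<epsilon>' > 0" "\<epsilon>' \<le> 3" "\<epsilon>' \<le> \<epsilon>" using assms by (auto simp: \<epsilon>'_def)
  obtain m :: nat where "real m > 3 / \<epsilon>'" using reals_Archimedean2 by blast
  hence m: "1 - real m * (\<epsilon>' / 3) < 0" using e by (simp add: field_simps)
  have "(3 / \<epsilon>') ^ m \<ge> 1" using e by (intro one_le_power) simp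
  moreover have "\<exists>\<mu>' \<nu>' d. prob_weight V \<mu>' \<and> prob_weight V \<nu>' \<and>
           (\<forall>x\<in>V. \<mu>' x \<le> (3 / \<epsilon>') ^ m * \<mu> x) \<and> (\<forall>x\<in>V. \<nu>' x \<le> (3 / \<epsilon>') ^ m * \<nu> x) \<and>
           cutdev V E 0 \<mu> \<nu> \<le> d \<and> d \<le> 1 \<and> regular V \<epsilon> d E \<mu>' \<nu>'"
    if *: "unit_kernel V E" "prob_weight V \<mu>" "prob_weight V \<nu>" for V :: "'a set" and E \<mu> \<nu>
  proof -
    have "cutdev V E 0 \<mu> \<nu> \<ge> 0" using * by (intro cutdev_0_bounds) (auto simp: prob_weight_def)
    hence "cutdev V E 0 \<mu> \<nu> > 1 - real m * (\<epsilon>' / 3)" using m by linarith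
    from exists_regular_pair_aux[OF e(1,2) * this] show ?thesis
      using regular_mono e(3) by blast
  qed
  ultimately show ?thesis by blast
qed

lemma cutdev_0_ge_min_degree:
  assumes "prob_weight V \<nu>" "\<And>y. y \<in> V \<Longrightarrow> \<nu> y > 0 \<Longrightarrow> (\<Sum>x\<in>V. \<mu> x * E x y) \<ge> \<delta>"
  shows "cutdev V E 0 \<mu> \<nu> \<ge> \<delta>"
proof -
  have "cutdev V E 0 \<mu> \<nu> = (\<Sum>y\<in>V. \<nu> y * (\<Sum>x\<in>V. \<mu> x * E x y))"
    unfolding cutdev_def by (subst sum.swap) (simp add: sum_distrib_left mult_ac)
  also have "\<dots> \<ge> (\<Sum>y\<in>V. \<nu> y * \<delta>)"
  proof (intro sum_mono)
    fix y assume "y \<in> V"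
    thus "\<nu> y * \<delta> \<le> \<nu> y * (\<Sum>x\<in>V. \<mu> x * E x y)"
      using assms by (cases "\<nu> y = 0") (auto simp: prob_weight_def intro!: mult_left_mono simp: order_less_le)
  qed
  also have "(\<Sum>y\<in>V. \<nu> y * \<delta>) = \<delta>"
    using assms(1) by (simp add: prob_weight_def flip: sum_distrib_right)
  finally show ?thesis .
qed

text \<open>The centre \<open>\<nu>\<close> shrinks with every pair that is made regular. Therefore
  the lower bound is imposed at every vertex of its support and not on average: only a pointwise
  degree bound is inherited by the smaller support. The kernel varies with \<open>i\<close> because
  the relevant colour will depend on the weight.\<close>

lemma exists_regular_star:
  fixes \<epsilon> :: real and t :: nat
  assumes "\<epsilon> > 0"
  shows "\<exists>C\<ge>1. \<forall>(V :: 'a set) E \<mu> \<nu> \<delta>.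
     (\<forall>i<t. unit_kernel V (E i) \<and> prob_weight V (\<mu> i) \<and>
        (\<forall>y\<in>V. \<nu> y > 0 \<longrightarrow> (\<Sum>x\<in>V. \<mu> i x * E i x y) \<ge> \<delta> i)) \<longrightarrow> prob_weight V \<nu> \<longrightarrow>
     (\<exists>\<mu>' \<nu>' d. prob_weight V \<nu>' \<and> (\<forall>x\<in>V. \<nu>' x \<le> C * \<nu> x) \<and>
        (\<forall>i<t. prob_weight V (\<mu>' i) \<and> (\<forall>x\<in>V. \<mu>' i x \<le> C * \<mu> i x) \<and>
           \<delta> i \<le> d i \<and> d i \<le> (1::real) \<and> regular V \<epsilon> (d i) (E i) (\<mu>' i) \<nu>'))"
  using assms
proof (induction t arbitrary: \<epsilon>)
  case 0
  show ?case by (intro exI[of _ 1]) auto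
next
  case (Suc t)
  obtain C1 where C1: "C1 \<ge> 1" and pair: "\<forall>(V :: 'a set) E \<mu> \<nu>. unit_kernel V E \<longrightarrow> prob_weight V \<mu> \<longrightarrow> prob_weight V \<nu> \<longrightarrow>
     (\<exists>\<mu>' \<nu>' d. prob_weight V \<mu>' \<and> prob_weight V \<nu>' \<and>
           (\<forall>x\<in>V. \<mu>' x \<le> C1 * \<mu> x) \<and> (\<forall>x\<in>V. \<nu>' x \<le> C1 * \<nu> x) \<and>
           cutdev V E 0 \<mu> \<nu> \<le> d \<and> d \<le> 1 \<and> regular V \<epsilon> d E \<mu>' \<nu>')"
    using exists_regular_pair[OF \<open>\<epsilon> > 0\<close>, where 'a='a] by (elim exE conjE) (rule that)
  \<comment> \<open>The last pair shrinks the centre once more by \<open>C1\<close>, while the other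
    ends of the earlier pairs stay; this is the loss prepaid here.\<close>
  have "\<epsilon> / C1 > 0" using C1 Suc.prems by simp
  from Suc.IH[OF this] obtain C2 where C2: "C2 \<ge> 1" and IH: "\<forall>(V :: 'a set) E \<mu> \<nu> \<delta>.
     (\<forall>i<t. unit_kernel V (E i) \<and> prob_weight V (\<mu> i) \<and>
        (\<forall>y\<in>V. \<nu> y > 0 \<longrightarrow> (\<Sum>x\<in>V. \<mu> i x * E i x y) \<ge> \<delta> i)) \<longrightarrow> prob_weight V \<nu> \<longrightarrow>
     (\<exists>\<mu>' \<nu>' d. prob_weight V \<nu>' \<and> (\<forall>x\<in>V. \<nu>' x \<le> C2 * \<nu> x) \<and>
        (\<forall>i<t. prob_weight V (\<mu>' i) \<and> (\<forall>x\<in>V. \<mu>' i x \<le> C2 * \<mu> i x) \<and>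
           \<delta> i \<le> d i \<and> d i \<le> (1::real) \<and> regular V (\<epsilon> / C1) (d i) (E i) (\<mu>' i) \<nu>'))"
    by (elim exE conjE) (rule that)
  have "\<exists>\<mu>' \<nu>' d. prob_weight V \<nu>' \<and> (\<forall>x\<in>V. \<nu>' x \<le> C1 * C2 * \<nu> x) \<and>
        (\<forall>i<Suc t. prob_weight V (\<mu>' i) \<and> (\<forall>x\<in>V. \<mu>' i x \<le> C1 * C2 * \<mu> i x) \<and>
           \<delta> i \<le> d i \<and> d i \<le> (1::real) \<and> regular V \<epsilon> (d i) (E i) (\<mu>' i) \<nu>')"
    if *: "\<forall>i<Suc t. unit_kernel V (E i) \<and> prob_weight V (\<mu> i) \<and>
        (\<forall>y\<in>V. \<nu> y > 0 \<longrightarrow> (\<Sum>x\<in>V. \<mu> i x * E i x y) \<ge> \<delta> i)" "prob_weight V \<nu>"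
    for V :: "'a set" and E \<mu> \<nu> \<delta>
  proof -
    have "\<forall>i<t. unit_kernel V (E i) \<and> prob_weight V (\<mu> i) \<and>
        (\<forall>y\<in>V. \<nu> y > 0 \<longrightarrow> (\<Sum>x\<in>V. \<mu> i x * E i x y) \<ge> \<delta> i)"
      using * by simp
    from IH[THEN spec[of _ V], THEN spec[of _ E], THEN spec[of _ \<mu>], THEN spec[of _ \<nu>],
        THEN spec[of _ \<delta>], THEN mp, OF this, THEN mp, OF *(2)]
    obtain \<mu>2 \<nu>2 d2 where 2: "prob_weight V \<nu>2" "\<forall>x\<in>V. \<nu>2 x \<le> C2 * \<nu> x"
      "\<forall>i<t. prob_weight V (\<mu>2 i) \<and> (\<forall>x\<in>V. \<mu>2 i x \<le> C2 * \<mu> i x) \<and>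
           \<delta> i \<le> d2 i \<and> d2 i \<le> 1 \<and> regular V (\<epsilon> / C1) (d2 i) (E i) (\<mu>2 i) \<nu>2" by blast
    from * have t: "unit_kernel V (E t)" "prob_weight V (\<mu> t)" by auto
    obtain \<mu>1 \<nu>1 d1 where 1: "prob_weight V \<mu>1" "prob_weight V \<nu>1"
      "\<forall>x\<in>V. \<mu>1 x \<le> C1 * \<mu> t x" "\<forall>x\<in>V. \<nu>1 x \<le> C1 * \<nu>2 x" "cutdev V (E t) 0 (\<mu> t) \<nu>2 \<le> d1" "d1 \<le> 1"
      "regular V \<epsilon> d1 (E t) \<mu>1 \<nu>1"
      using pair[rule_format, OF t 2(1)] by blast
    have "cutdev V (E t) 0 (\<mu> t) \<nu>2 \<ge> \<delta> t"
    proof (rule cutdev_0_ge_min_degree[OF 2(1)])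
      fix y assume y: "y \<in> V" "\<nu>2 y > 0"
      hence "C2 * \<nu> y > 0" using 2(2) by force
      hence "\<nu> y > 0" using C2 by (simp add: zero_less_mult_iff)
      thus "\<delta> t \<le> (\<Sum>x\<in>V. \<mu> t x * E t x y)" using * y by auto
    qed
    hence d1: "\<delta> t \<le> d1" using 1 by linarith
    have le_trans: "g x \<le> C1 * C2 * f x" if "f x \<ge> 0" "g x \<le> C1 * f x \<or> g x \<le> C2 * f x"
      for f g :: "'a \<Rightarrow> real" and x
    proof -
      have "C1 * f x \<le> C1 * C2 * f x" "C2 * f x \<le> C1 * C2 * f x"
        using that C1 C2 by (auto intro!: mult_right_mono simp: mult_le_cancel_left1 mult_le_cancel_right1)
      thus ?thesis using that by linarith
    qed
    have "\<nu>1 x \<le> C1 * C2 * \<nu> x" if "x \<in> V" for x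
    proof -
      have "C1 * \<nu>2 x \<le> C1 * (C2 * \<nu> x)" using 2 that C1 by (intro mult_left_mono) auto
      thus ?thesis using 1(4) that by (force simp: mult.assoc)
    qed
    moreover have "regular V \<epsilon> (d2 i) (E i) (\<mu>2 i) \<nu>1" if "i < t" for i
    proof -
      have "regular V (1 * C1 * (\<epsilon> / C1)) (d2 i) (E i) (\<mu>2 i) \<nu>1"
        using 1 2 that C1 by (intro regular_subweight[where \<mu> = "\<mu>2 i" and \<nu> = \<nu>2]) auto
      thus ?thesis using C1 by simp
    qed
    ultimately show ?thesis
      using 1 2 d1 *
      by (intro exI[of _ "\<mu>2(t := \<mu>1)"] exI[of _ \<nu>1] exI[of _ "d2(t := d1)"])
         (auto simp: less_Suc_eq prob_weight_def intro!: le_trans)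
  qed
  moreover have "C1 * C2 \<ge> 1" using C1 C2 by (metis mult_mono' mult_1 zero_le_one)
  ultimately show ?case by blast
qed

text \<open>All weights are carved out of the same \<open>\<nu>\<close>, so that an average of some
  of them is again dominated by \<open>C\<close> times \<open>\<nu>\<close>.\<close>

lemma exists_regular_family:
  fixes \<epsilon> :: real and m :: nat
  assumes "\<epsilon> > 0"
  shows "\<exists>C\<ge>1. \<forall>(V :: 'a set) E \<nu>. unit_kernel V E \<longrightarrow> prob_weight V \<nu> \<longrightarrow>
     (\<exists>\<mu> d. (\<forall>i<m. prob_weight V (\<mu> i) \<and> (\<forall>x\<in>V. \<mu> i x \<le> C * \<nu> x)) \<and>
        (\<forall>j<m. \<forall>i<j. 0 \<le> d i j \<and> d i j \<le> (1::real) \<and> regular V \<epsilon> (d i j) E (\<mu> i) (\<mu> j)))"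
  using assms
proof (induction m arbitrary: \<epsilon>)
  case 0
  show ?case by (intro exI[of _ 1]) auto
next
  case (Suc m)
  obtain C1 where C1: "C1 \<ge> 1" and star: "\<forall>(V :: 'a set) E \<mu> \<nu> \<delta>.
     (\<forall>i<m. unit_kernel V (E i) \<and> prob_weight V (\<mu> i) \<and>
        (\<forall>y\<in>V. \<nu> y > 0 \<longrightarrow> (\<Sum>x\<in>V. \<mu> i x * E i x y) \<ge> \<delta> i)) \<longrightarrow> prob_weight V \<nu> \<longrightarrow>
     (\<exists>\<mu>' \<nu>' d. prob_weight V \<nu>' \<and> (\<forall>x\<in>V. \<nu>' x \<le> C1 * \<nu> x) \<and>
        (\<forall>i<m. prob_weight V (\<mu>' i) \<and> (\<forall>x\<in>V. \<mu>' i x \<le> C1 * \<mu> i x) \<and>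
           \<delta> i \<le> d i \<and> d i \<le> (1::real) \<and> regular V \<epsilon> (d i) (E i) (\<mu>' i) \<nu>'))"
    using exists_regular_star[OF Suc.prems, where 'a='a and t=m] by (elim exE conjE) (rule that)
  \<comment> \<open>Adding a weight as the centre of a star shrinks both ends of every old pair by
    \<open>C1\<close>, hence the square.\<close>
  have "\<epsilon> / C1\<^sup>2 > 0" using C1 Suc.prems by simp
  from Suc.IH[OF this] obtain C2 where C2: "C2 \<ge> 1" and IH: "\<forall>(V :: 'a set) E \<nu>.
     unit_kernel V E \<longrightarrow> prob_weight V \<nu> \<longrightarrow>
     (\<exists>\<mu> d. (\<forall>i<m. prob_weight V (\<mu> i) \<and> (\<forall>x\<in>V. \<mu> i x \<le> C2 * \<nu> x)) \<and>
        (\<forall>j<m. \<forall>i<j. 0 \<le> d i j \<and> d i j \<le> (1::real) \<and> regular V (\<epsilon> / C1\<^sup>2) (d i j) E (\<mu> i) (\<mu> j)))"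
    by (elim exE conjE) (rule that)
  have "\<exists>\<mu> d. (\<forall>i<Suc m. prob_weight V (\<mu> i) \<and> (\<forall>x\<in>V. \<mu> i x \<le> C1 * C2 * \<nu> x)) \<and>
        (\<forall>j<Suc m. \<forall>i<j. 0 \<le> d i j \<and> d i j \<le> (1::real) \<and> regular V \<epsilon> (d i j) E (\<mu> i) (\<mu> j))"
    if *: "unit_kernel V E" "prob_weight V \<nu>" for V :: "'a set" and E \<nu>
  proof -
    from IH[rule_format, OF *] obtain \<mu>2 d2 where 2:
      "\<forall>i<m. prob_weight V (\<mu>2 i) \<and> (\<forall>x\<in>V. \<mu>2 i x \<le> C2 * \<nu> x)"
      "\<forall>j<m. \<forall>i<j. 0 \<le> d2 i j \<and> d2 i j \<le> 1 \<and> regular V (\<epsilon> / C1\<^sup>2) (d2 i j) E (\<mu>2 i) (\<mu>2 j)"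
      by blast
    have "\<forall>i<m. unit_kernel V E \<and> prob_weight V (\<mu>2 i) \<and>
        (\<forall>y\<in>V. \<nu> y > 0 \<longrightarrow> (\<Sum>x\<in>V. \<mu>2 i x * E x y) \<ge> 0)"
      using * 2(1) by (auto intro!: sum_nonneg simp: prob_weight_def unit_kernel_def)
    from star[THEN spec[of _ V], THEN spec[of _ "\<lambda>_. E"], THEN spec[of _ \<mu>2], THEN spec[of _ \<nu>],
        THEN spec[of _ "\<lambda>_. 0"], THEN mp, OF this, THEN mp, OF *(2)]
    obtain \<mu>1 \<nu>1 d1 where 1: "prob_weight V \<nu>1" "\<forall>x\<in>V. \<nu>1 x \<le> C1 * \<nu> x"
       "\<forall>i<m. prob_weight V (\<mu>1 i) \<and> (\<forall>x\<in>V. \<mu>1 i x \<le> C1 * \<mu>2 i x) \<and>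
           0 \<le> d1 i \<and> d1 i \<le> (1::real) \<and> regular V \<epsilon> (d1 i) E (\<mu>1 i) \<nu>1" by blast
    have "\<mu>1 i x \<le> C1 * C2 * \<nu> x" if "i < m" "x \<in> V" for i x
    proof -
      have "C1 * \<mu>2 i x \<le> C1 * (C2 * \<nu> x)" using 2 that C1 by (intro mult_left_mono) auto
      thus ?thesis using 1(3) that by (force simp: mult.assoc)
    qed
    moreover have "\<nu>1 x \<le> C1 * C2 * \<nu> x" if "x \<in> V" for x
    proof -
      have "C1 * (1 * \<nu> x) \<le> C1 * (C2 * \<nu> x)"
        using * that C1 C2 by (intro mult_left_mono mult_right_mono) (auto simp: prob_weight_def)
      thus ?thesis using 1(2) that by (force simp: mult.assoc)
    qed
    moreover have "regular V \<epsilon> (d2 i j) E (\<mu>1 i) (\<mu>1 j)" if "j < m" "i < j" for i j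
    proof -
      have "regular V (C1 * C1 * (\<epsilon> / C1\<^sup>2)) (d2 i j) E (\<mu>1 i) (\<mu>1 j)"
        using 1 2 that C1 by (intro regular_subweight[where \<mu> = "\<mu>2 i" and \<nu> = "\<mu>2 j"]) auto
      thus ?thesis using C1 by (simp add: power2_eq_square)
    qed
    ultimately show ?thesis
      using 1 2
      by (intro exI[of _ "\<mu>1(m := \<nu>1)"] exI[of _ "\<lambda>i j. if j = m then d1 i else d2 i j"])
         (auto simp: less_Suc_eq)
  qed
  moreover have "C1 * C2 \<ge> 1" using C1 C2 by (metis mult_mono' mult_1 zero_le_one)
  ultimately show ?case by blast
qed

section \<open>Self-regular weights and counting cliques\<close>

lemma cutdev_cong:
  assumes "\<And>x. x \<in> V \<Longrightarrow> a x = a' x" "\<And>x. x \<in> V \<Longrightarrow> b x = b' x"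
  shows "cutdev V E d a b = cutdev V E d a' b'"
  unfolding cutdev_def using assms by (intro sum.cong) auto

text \<open>Split \<open>a\<close> among the components in proportion to \<open>\<mu> h x\<close>.
  Where the mixture vanishes \<open>a\<close> vanishes too, and the quotient
  \<open>a x / m x\<close> has the value 0 there.\<close>

lemma subweight_mixture_decompose:
  assumes "finite H" and s: "(s::real) > 0"
    and nn: "\<And>h x. h \<in> H \<Longrightarrow> x \<in> V \<Longrightarrow> 0 \<le> \<mu> h x"
    and a: "subweight V a (\<lambda>x. \<Sum>h\<in>H. 1 / s * \<mu> h x)"
  shows "\<exists>a'. (\<forall>h\<in>H. subweight V (a' h) (\<mu> h)) \<and> (\<forall>x\<in>V. a x = (\<Sum>h\<in>H. 1 / s * a' h x))"
proof -
  define m where "m = (\<lambda>x. \<Sum>h\<in>H. 1 / s * \<mu> h x)"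
  have m: "0 \<le> a x" "a x \<le> m x" if "x \<in> V" for x
    using a that by (auto simp: subweight_def m_def)
  define a' where "a' = (\<lambda>h x. a x / m x * \<mu> h x)"
  have "subweight V (a' h) (\<mu> h)" if "h \<in> H" for h
    unfolding subweight_def
  proof
    fix x assume x: "x \<in> V"
    have "0 \<le> a x / m x" "a x / m x \<le> 1"
      using m[OF x] by (auto simp: divide_le_eq_1)
    thus "0 \<le> a' h x \<and> a' h x \<le> \<mu> h x"
      using nn[OF that x] unfolding a'_def
      by (auto intro: mult_nonneg_nonneg mult_left_le_one_le simp del: times_divide_eq_left)
  qed
  moreover have "a x = (\<Sum>h\<in>H. 1 / s * a' h x)" if "x \<in> V" for x
  proof -
    have "(\<Sum>h\<in>H. 1 / s * a' h x) = a x / m x * m x"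
      unfolding a'_def m_def sum_distrib_left by (simp add: mult_ac)
    also have "\<dots> = a x" using m[OF that] by (cases "m x = 0") auto
    finally show ?thesis by simp
  qed
  ultimately show ?thesis by blast
qed

text \<open>After a bilinear expansion the off-diagonal terms are small by regularity. Nothing is
  known about the diagonal, but its \<open>s\<close> terms have coefficient
  \<open>1 / s\<^sup>2\<close> and are at most 1 by the trivial bound, which gives the extra
  \<open>1 / s\<close>.\<close>

lemma regular_mixture:
  assumes "finite H" and s: "s = real (card H)" "s > 0"
    and E: "unit_kernel V E" and d: "0 \<le> d" "d \<le> 1"
    and pw: "\<And>h. h \<in> H \<Longrightarrow> prob_weight V (\<mu> h)"
    and reg: "\<And>h g. h \<in> H \<Longrightarrow> g \<in> H \<Longrightarrow> h \<noteq> g \<Longrightarrow> regular V \<epsilon> d E (\<mu> h) (\<mu> g)"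
    and \<epsilon>: "\<epsilon> \<ge> 0"
  shows "regular V (\<epsilon> + 1 / s) d E (\<lambda>x. \<Sum>h\<in>H. 1 / s * \<mu> h x) (\<lambda>x. \<Sum>h\<in>H. 1 / s * \<mu> h x)"
  unfolding regular_def
proof (intro allI impI)
  let ?m = "\<lambda>x. \<Sum>h\<in>H. 1 / s * \<mu> h x"
  fix a b assume ab: "subweight V a ?m" "subweight V b ?m"
  have nn: "\<And>h x. h \<in> H \<Longrightarrow> x \<in> V \<Longrightarrow> 0 \<le> \<mu> h x" using pw by (auto simp: prob_weight_def)
  obtain a' where a': "\<And>h. h \<in> H \<Longrightarrow> subweight V (a' h) (\<mu> h)" "\<And>x. x \<in> V \<Longrightarrow> a x = (\<Sum>h\<in>H. 1 / s * a' h x)"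
    using subweight_mixture_decompose[OF \<open>finite H\<close> s(2) nn ab(1)] by blast
  obtain b' where b': "\<And>h. h \<in> H \<Longrightarrow> subweight V (b' h) (\<mu> h)" "\<And>x. x \<in> V \<Longrightarrow> b x = (\<Sum>h\<in>H. 1 / s * b' h x)"
    using subweight_mixture_decompose[OF \<open>finite H\<close> s(2) nn ab(2)] by blast
  have "cutdev V E d a b = cutdev V E d (\<lambda>x. \<Sum>h\<in>H. 1 / s * a' h x) (\<lambda>x. \<Sum>h\<in>H. 1 / s * b' h x)"
    using a'(2) b'(2) by (rule cutdev_cong)
  also have "\<dots> = (\<Sum>h\<in>H. \<Sum>g\<in>H. 1 / s * (1 / s) * cutdev V E d (a' h) (b' g))"
    by (simp only: cutdev_sum_left[OF \<open>finite H\<close>] cutdev_sum_right[OF \<open>finite H\<close>] cutdev_scale)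
  finally have "\<bar>cutdev V E d a b\<bar> \<le> (\<Sum>h\<in>H. \<Sum>g\<in>H. \<bar>1 / s * (1 / s) * cutdev V E d (a' h) (b' g)\<bar>)"
    by (simp only:) (intro order_trans[OF sum_abs] sum_mono order.refl)
  also have "\<dots> \<le> (\<Sum>h\<in>H. \<Sum>g\<in>H. 1 / s\<^sup>2 * (\<epsilon> + (if h = g then 1 else 0)))"
  proof (intro sum_mono)
    fix h g assume hg: "h \<in> H" "g \<in> H"
    have "\<bar>cutdev V E d (a' h) (b' g)\<bar> \<le> \<epsilon> + (if h = g then 1 else 0)"
    proof (cases "h = g")
      case True
      have "\<bar>cutdev V E d (a' h) (b' g)\<bar> \<le> 1"
        using hg a' b' pw d by (intro abs_cutdev_le_1[OF E]) auto
      thus ?thesis using True \<epsilon> by simp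
    next
      case False
      thus ?thesis using regularD[OF reg[OF hg False]] a'(1) b'(1) hg by simp
    qed
    hence "1 / s\<^sup>2 * \<bar>cutdev V E d (a' h) (b' g)\<bar> \<le> 1 / s\<^sup>2 * (\<epsilon> + (if h = g then 1 else 0))"
      by (intro mult_left_mono) auto
    thus "\<bar>1 / s * (1 / s) * cutdev V E d (a' h) (b' g)\<bar> \<le> 1 / s\<^sup>2 * (\<epsilon> + (if h = g then 1 else 0))"
      by (simp add: abs_mult power2_eq_square)
  qed
  also have "\<dots> = (\<Sum>h\<in>H. 1 / s\<^sup>2 * (s * \<epsilon> + 1))"
  proof (intro sum.cong refl)
    fix h assume "h \<in> H"
    thus "(\<Sum>g\<in>H. 1 / s\<^sup>2 * (\<epsilon> + (if h = g then 1 else 0))) = 1 / s\<^sup>2 * (s * \<epsilon> + 1)"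
      unfolding sum_distrib_left[symmetric] sum.distrib using \<open>finite H\<close> by (simp add: s)
  qed
  also have "\<dots> = s * (1 / s\<^sup>2 * (s * \<epsilon> + 1))" by (simp add: s)
  also have "\<dots> = \<epsilon> + 1 / s" using s by (simp add: power2_eq_square field_simps)
  finally show "\<bar>cutdev V E d a b\<bar> \<le> \<epsilon> + 1 / s" .
qed

text \<open>The density increment applied to a weight and itself would shrink the two copies
  differently. Averaging many pairwise regular weights avoids this, provided that all pairs have
  nearly the same density; Ramsey's theorem for the rounded densities arranges that.\<close>

lemma exists_self_regular:
  fixes \<epsilon> :: real
  assumes "\<epsilon> > 0"
  shows "\<exists>C\<ge>1. \<forall>(V :: 'a set) E \<nu>. unit_kernel V E \<longrightarrow> (\<forall>x\<in>V. \<forall>y\<in>V. E x y = E y x) \<longrightarrow>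
     prob_weight V \<nu> \<longrightarrow>
     (\<exists>\<mu> d. prob_weight V \<mu> \<and> (\<forall>x\<in>V. \<mu> x \<le> C * \<nu> x) \<and>
        0 \<le> d \<and> d \<le> (1::real) \<and> regular V \<epsilon> d E \<mu> \<mu>)"
proof -
  \<comment> \<open>One third each for the regularity of the pairs, the rounding of their densities
    and the diagonal of the mixture.\<close>
  define e where "e = \<epsilon> / 3"
  have e: "e > 0" using assms by (simp add: e_def)
  obtain s :: nat where s: "real s > 1 / e" using reals_Archimedean2 by blast
  have s0: "s > 0" using s e by (intro gr0I) (auto simp: field_simps)
  have se: "1 / real s \<le> e" using s e s0 by (simp add: field_simps)
  \<comment> \<open>The same \<open>s\<close> has two tasks: since \<open>1 / e < s\<close>, the
    rounded densities take at most \<open>s + 1\<close> values, and a homogeneous set of size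
    \<open>s\<close> makes the diagonal cost \<open>1 / s \<le> e\<close>.\<close>
  obtain l :: nat where l: "partn_lst {..<l} (replicate (Suc s) s) 2"
    using ramsey_full by blast
  obtain C where C: "C \<ge> 1" and fam: "\<forall>(V :: 'a set) E \<nu>. unit_kernel V E \<longrightarrow> prob_weight V \<nu> \<longrightarrow>
     (\<exists>\<mu> d. (\<forall>i<l. prob_weight V (\<mu> i) \<and> (\<forall>x\<in>V. \<mu> i x \<le> C * \<nu> x)) \<and>
        (\<forall>j<l. \<forall>i<j. 0 \<le> d i j \<and> d i j \<le> (1::real) \<and> regular V e (d i j) E (\<mu> i) (\<mu> j)))"
    using exists_regular_family[OF e, where 'a='a and m=l] by (elim exE conjE) (rule that)
  have "\<exists>\<mu> d. prob_weight V \<mu> \<and> (\<forall>x\<in>V. \<mu> x \<le> C * \<nu> x) \<and>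
        0 \<le> d \<and> d \<le> (1::real) \<and> regular V \<epsilon> d E \<mu> \<mu>"
    if *: "unit_kernel V E" "\<forall>x\<in>V. \<forall>y\<in>V. E x y = E y x" "prob_weight V \<nu>"
    for V :: "'a set" and E \<nu>
  proof -
    from fam[rule_format, OF *(1,3)] obtain \<mu> d where
      \<mu>: "\<And>i. i < l \<Longrightarrow> prob_weight V (\<mu> i)" "\<And>i x. i < l \<Longrightarrow> x \<in> V \<Longrightarrow> \<mu> i x \<le> C * \<nu> x" and
      d: "\<And>i j. i < j \<Longrightarrow> j < l \<Longrightarrow> 0 \<le> d i j" "\<And>i j. i < j \<Longrightarrow> j < l \<Longrightarrow> d i j \<le> 1"
         "\<And>i j. i < j \<Longrightarrow> j < l \<Longrightarrow> regular V e (d i j) E (\<mu> i) (\<mu> j)"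
      by blast
    define f where "f = (\<lambda>A. nat \<lfloor>d (Min A) (Max A) / e\<rfloor>)"
    have f_pair: "f {i, j} = nat \<lfloor>d i j / e\<rfloor>" if "i < j" for i j
      using that by (simp add: f_def)
    have f_le: "f A < Suc s" if "A \<in> nsets {..<l} 2" for A
    proof -
      obtain i j where ij: "A = {i, j}" "i < j" "j < l"
        using \<open>A \<in> nsets {..<l} 2\<close> by (auto elim!: nsets2_E) (metis insert_commute linorder_neqE_nat)
      have "d i j / e \<le> 1 / e" using d(2)[OF ij(2,3)] e by (simp add: divide_right_mono)
      hence "d i j / e < real (Suc s)" using s by simp
      hence "\<lfloor>d i j / e\<rfloor> < int (Suc s)" by (simp only: floor_less_iff of_int_of_nat_eq)
      thus ?thesis unfolding ij(1) f_pair[OF ij(2)] by linarith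
    qed
    obtain c H where cH: "c < Suc s" "H \<in> nsets {..<l} s" "f ` nsets H 2 \<subseteq> {c}"
    proof -
      have "f \<in> nsets {..<l} 2 \<rightarrow> {..<Suc s}" using f_le by auto
      from partn_lstE[OF l this] show ?thesis using that by (auto simp: nth_replicate simp del: replicate_Suc)
    qed
    have H: "finite H" "H \<subseteq> {..<l}" "card H = s" using cH(2) by (auto simp: nsets_def)
    \<comment> \<open>The cap matters only if \<open>H\<close> has a single element: then there are
      no pairs to bound the colour \<open>c\<close>, and \<open>c * e\<close> could exceed
      1.\<close>
    define D where "D = min 1 (real c * e)"
    have D: "0 \<le> D" "D \<le> 1" using e by (auto simp: D_def)
    have dD: "\<bar>d i j - D\<bar> \<le> e" if ij: "i \<in> H" "j \<in> H" "i < j" for i j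
    proof -
      have jl: "j < l" using H ij by auto
      have "{i, j} \<in> nsets H 2" using ij by auto
      hence "f {i, j} = c" using cH(3) by blast
      hence "nat \<lfloor>d i j / e\<rfloor> = c" using f_pair ij by simp
      moreover have "d i j / e \<ge> 0" using d(1)[OF ij(3) jl] e by simp
      ultimately have "real c \<le> d i j / e" "d i j / e < real c + 1" by linarith+
      hence "real c * e \<le> d i j" "d i j < real c * e + e" using e by (simp_all add: field_simps)
      thus ?thesis using d(2)[OF ij(3) jl] by (auto simp: D_def min_def)
    qed
    have reg': "regular V (e + e) D E (\<mu> i) (\<mu> j)" if ij: "i \<in> H" "j \<in> H" "i \<noteq> j" for i j
    proof -
      have lt: "regular V (e + e) D E (\<mu> i) (\<mu> j)" if "i \<in> H" "j \<in> H" "i < j" for i j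
        using H that by (intro regular_change_density[OF d(3)] \<mu>(1) dD) auto
      show ?thesis
      proof (cases "i < j")
        case True
        thus ?thesis using lt ij by blast
      next
        case False
        hence "regular V (e + e) D E (\<mu> j) (\<mu> i)" using lt ij by simp
        thus ?thesis by (rule regular_swap) (use *(2) in blast)
      qed
    qed
    define m where "m = (\<lambda>x. \<Sum>h\<in>H. 1 / real s * \<mu> h x)"
    have pwH: "prob_weight V (\<mu> h)" if "h \<in> H" for h using \<mu>(1) H that by auto
    have "regular V (e + e + 1 / real s) D E m m"
      unfolding m_def using H s0 *(1) D pwH reg' e by (intro regular_mixture) auto
    hence "regular V \<epsilon> D E m m" by (rule regular_mono) (use se in \<open>simp add: e_def\<close>)
    moreover have "prob_weight V m"
      unfolding prob_weight_def
    proof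
      show "\<forall>x\<in>V. 0 \<le> m x" using pwH by (auto simp: m_def prob_weight_def intro!: sum_nonneg)
      have "sum m V = (\<Sum>h\<in>H. 1 / real s * sum (\<mu> h) V)"
        unfolding m_def sum_distrib_left by (rule sum.swap)
      also have "\<dots> = 1" using pwH s0 H by (simp add: prob_weight_def)
      finally show "sum m V = 1" .
    qed
    moreover have "m x \<le> C * \<nu> x" if "x \<in> V" for x
    proof -
      have "m x \<le> (\<Sum>h\<in>H. 1 / real s * (C * \<nu> x))"
        unfolding m_def using \<mu>(2) H that by (intro sum_mono mult_left_mono) auto
      also have "\<dots> = C * \<nu> x" using H s0 by simp
      finally show ?thesis .
    qed
    ultimately show ?thesis using D by blast
  qed
  thus ?thesis using C by blast
qed

section \<open>Counting cliques in regular tuples of weights\<close>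

lemma sum_PiE_remove:
  fixes h :: "('i \<Rightarrow> 'a) \<Rightarrow> 'b::comm_monoid_add"
  assumes "p \<in> I"
  shows "(\<Sum>v\<in>PiE I (\<lambda>_. V). h v) = (\<Sum>w\<in>PiE (I - {p}) (\<lambda>_. V). \<Sum>x\<in>V. h (w(p := x)))"
proof -
  have "PiE I (\<lambda>_. V) = PiE (insert p (I - {p})) (\<lambda>_. V)" using assms by (simp add: insert_absorb)
  also have "\<dots> = (\<lambda>(y, g). g(p := y)) ` (V \<times> PiE (I - {p}) (\<lambda>_. V))"
    by (rule PiE_insert_eq)
  finally have "(\<Sum>v\<in>PiE I (\<lambda>_. V). h v) =
      (\<Sum>(y, g)\<in>V \<times> PiE (I - {p}) (\<lambda>_. V). h (g(p := y)))"
    using inj_combinator[of p "I - {p}" "\<lambda>_. V"]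
    by (simp add: sum.reindex case_prod_unfold comp_def)
  also have "\<dots> = (\<Sum>x\<in>V. \<Sum>w\<in>PiE (I - {p}) (\<lambda>_. V). h (w(p := x)))"
    by (simp add: sum.cartesian_product)
  finally show ?thesis by (subst sum.swap)
qed

text \<open>
  The edges of a clique pattern are replaced by their densities one at a time: with all vertices
  but \<open>p\<close> and \<open>q\<close> fixed, the remaining factors split into one depending on \<open>v p\<close> and one
  depending on \<open>v q\<close>.
\<close>
lemma counting_one_edge:
  fixes V :: "'a set" and I :: "nat set"
  assumes fin: "finite V" "finite I" and E: "unit_kernel V E" and pq: "p \<in> I" "q \<in> I" "p \<noteq> q"
    and reg: "regular V \<epsilon> d E (\<mu> p) (\<mu> q)" and \<epsilon>: "\<epsilon> \<ge> 0"
    and pw: "\<And>i. i \<in> I \<Longrightarrow> prob_weight V (\<mu> i)"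
    and sub: "\<And>i. i \<in> I \<Longrightarrow> subweight V (a i) (\<mu> i)"
    and F: "finite F" "F \<subseteq> I \<times> I" "(p, q) \<notin> F" "(q, p) \<notin> F" "\<And>i. (i, i) \<notin> F"
  shows "\<bar>\<Sum>v\<in>PiE I (\<lambda>_. V). (\<Prod>i\<in>I. a i (v i)) * ((E (v p) (v q) - d) *
            (\<Prod>e\<in>F. E (v (fst e)) (v (snd e))))\<bar> \<le> \<epsilon>"
proof -
  define J where "J = I - {p} - {q}"
  \<comment> \<open>No edge of \<open>Fp\<close> meets \<open>q\<close>, since neither orientation
    of the edge between \<open>p\<close> and \<open>q\<close> lies in \<open>F\<close>. Edges
    meeting neither of them are put into \<open>B\<close>.\<close>
  define Fp where "Fp = {e \<in> F. fst e = p \<or> snd e = p}"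
  define A where "A = (\<lambda>w x. a p x * (\<Prod>e\<in>Fp. E ((w(p := x)) (fst e)) ((w(p := x)) (snd e))))"
  define B where "B = (\<lambda>w y. a q y * (\<Prod>e\<in>F - Fp. E ((w(q := y)) (fst e)) ((w(q := y)) (snd e))))"
  define r where "r = (\<lambda>w. \<Prod>i\<in>J. a i (w i))"
  have tm: "(\<Prod>i\<in>I. a i (v i)) * ((E (v p) (v q) - d) * (\<Prod>e\<in>F. E (v (fst e)) (v (snd e))))
      = r w * (A w x * B w y * (E x y - d))"
    if v: "v = w(q := y, p := x)" for v w x y
  proof -
    have "(\<Prod>i\<in>I. a i (v i)) = a p (v p) * (a q (v q) * (\<Prod>i\<in>J. a i (v i)))"
      using fin(2) pq unfolding J_def by (simp add: prod.remove[of I p] prod.remove[of "I - {p}" q])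
    also have "(\<Prod>i\<in>J. a i (v i)) = r w"
      unfolding r_def by (intro prod.cong) (auto simp: v J_def)
    finally have 1: "(\<Prod>i\<in>I. a i (v i)) = a p x * (a q y * r w)"
      using pq by (simp add: v)
    have "(\<Prod>e\<in>F. E (v (fst e)) (v (snd e))) =
        (\<Prod>e\<in>F - Fp. E (v (fst e)) (v (snd e))) * (\<Prod>e\<in>Fp. E (v (fst e)) (v (snd e)))"
      using F(1) by (intro prod.subset_diff) (auto simp: Fp_def)
    also have "(\<Prod>e\<in>Fp. E (v (fst e)) (v (snd e))) =
        (\<Prod>e\<in>Fp. E ((w(p := x)) (fst e)) ((w(p := x)) (snd e)))"
      using F(3,4) pq by (intro prod.cong refl) (auto simp: Fp_def v)
    also have "(\<Prod>e\<in>F - Fp. E (v (fst e)) (v (snd e))) =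
        (\<Prod>e\<in>F - Fp. E ((w(q := y)) (fst e)) ((w(q := y)) (snd e)))"
      by (intro prod.cong refl) (auto simp: Fp_def v)
    finally have 2: "(\<Prod>e\<in>F. E (v (fst e)) (v (snd e))) =
        (\<Prod>e\<in>F - Fp. E ((w(q := y)) (fst e)) ((w(q := y)) (snd e))) *
        (\<Prod>e\<in>Fp. E ((w(p := x)) (fst e)) ((w(p := x)) (snd e)))" .
    have "v p = x" "v q = y" using pq by (auto simp: v)
    thus ?thesis unfolding 1 2 A_def B_def by (simp only: mult_ac)
  qed
  have "(\<Sum>v\<in>PiE I (\<lambda>_. V). (\<Prod>i\<in>I. a i (v i)) * ((E (v p) (v q) - d) *
            (\<Prod>e\<in>F. E (v (fst e)) (v (snd e))))) =
        (\<Sum>w\<in>PiE J (\<lambda>_. V). \<Sum>y\<in>V. \<Sum>x\<in>V. r w * (A w x * B w y * (E x y - d)))"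
  proof -
    have q: "q \<in> I - {p}" using pq by simp
    show ?thesis
      unfolding sum_PiE_remove[OF pq(1)] sum_PiE_remove[OF q] J_def[symmetric]
      by (intro sum.cong refl tm)
  qed
  also have "\<dots> = (\<Sum>w\<in>PiE J (\<lambda>_. V). r w * cutdev V E d (A w) (B w))"
    unfolding cutdev_def sum_distrib_left by (intro sum.cong refl sum.swap)
  also have "\<bar>\<dots>\<bar> \<le> (\<Sum>w\<in>PiE J (\<lambda>_. V). r w * \<epsilon>)"
  proof (intro order_trans[OF sum_abs] sum_mono)
    fix w assume w: "w \<in> PiE J (\<lambda>_. V)"
    have wV: "w i \<in> V" if "i \<in> J" for i using w that by auto
    have r0: "r w \<ge> 0"
      unfolding r_def using sub wV by (intro prod_nonneg) (auto simp: subweight_def J_def)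
    have E01: "0 \<le> E x y" "E x y \<le> 1" if "x \<in> V" "y \<in> V" for x y
      using E that by (auto simp: unit_kernel_def)
    have Fmem: "fst e \<in> I" "snd e \<in> I" if "e \<in> F" for e using F(2) that by auto
    have "subweight V (A w) (\<mu> p)"
      unfolding subweight_def
    proof
      fix x assume x: "x \<in> V"
      have *: "(w(p := x)) (fst e) \<in> V \<and> (w(p := x)) (snd e) \<in> V" if "e \<in> Fp" for e
        using that x F(3,4,5) wV Fmem[of e] unfolding Fp_def J_def
        by (cases e) auto
      have "0 \<le> (\<Prod>e\<in>Fp. E ((w(p := x)) (fst e)) ((w(p := x)) (snd e)))"
           "(\<Prod>e\<in>Fp. E ((w(p := x)) (fst e)) ((w(p := x)) (snd e))) \<le> 1"
        using * E01 by (auto intro!: prod_nonneg prod_le_1 simp del: fun_upd_apply)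
      moreover have "0 \<le> a p x" "a p x \<le> \<mu> p x" using sub[OF pq(1)] x by (auto simp: subweight_def)
      ultimately show "0 \<le> A w x \<and> A w x \<le> \<mu> p x"
        unfolding A_def by (meson mult_left_le mult_nonneg_nonneg order_trans)
    qed
    moreover have "subweight V (B w) (\<mu> q)"
      unfolding subweight_def
    proof
      fix x assume x: "x \<in> V"
      have *: "(w(q := x)) (fst e) \<in> V \<and> (w(q := x)) (snd e) \<in> V" if "e \<in> F - Fp" for e
        using that x wV Fmem[of e] unfolding Fp_def J_def
        by (cases e) auto
      have "0 \<le> (\<Prod>e\<in>F-Fp. E ((w(q := x)) (fst e)) ((w(q := x)) (snd e)))"
           "(\<Prod>e\<in>F-Fp. E ((w(q := x)) (fst e)) ((w(q := x)) (snd e))) \<le> 1"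
        using * E01 by (auto intro!: prod_nonneg prod_le_1 simp del: fun_upd_apply)
      moreover have "0 \<le> a q x" "a q x \<le> \<mu> q x" using sub[OF pq(2)] x by (auto simp: subweight_def)
      ultimately show "0 \<le> B w x \<and> B w x \<le> \<mu> q x"
        unfolding B_def by (meson mult_left_le mult_nonneg_nonneg order_trans)
    qed
    ultimately have "\<bar>cutdev V E d (A w) (B w)\<bar> \<le> \<epsilon>" by (rule regularD[OF reg])
    thus "\<bar>r w * cutdev V E d (A w) (B w)\<bar> \<le> r w * \<epsilon>"
      using r0 by (simp add: abs_mult mult_left_mono)
  qed
  also have "\<dots> = (\<Prod>i\<in>J. sum (a i) V) * \<epsilon>"
    using fin by (simp add: r_def prod_sum_PiE J_def flip: sum_distrib_right)
  also have "\<dots> \<le> 1 * \<epsilon>"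
  proof (intro mult_right_mono \<epsilon> prod_le_1)
    fix i assume "i \<in> J"
    hence "i \<in> I" by (simp add: J_def)
    thus "0 \<le> sum (a i) V \<and> sum (a i) V \<le> 1"
      using subweight_sum[OF sub pw] by blast
  qed
  finally show ?thesis by simp
qed

text \<open>Stated for arbitrary subweights \<open>a i\<close>, because the application restricts
  \<open>\<mu> i\<close> to the neighbourhood of a vertex. Exchanging one edge factor for its
  density costs \<open>\<epsilon>\<close>, and the error made before is only multiplied by a
  density, which is at most 1.\<close>

lemma counting_lemma:
  fixes V :: "'a set" and I :: "nat set"
  assumes fin: "finite V" "finite I" and E: "unit_kernel V E" and \<epsilon>: "\<epsilon> \<ge> 0"
    and pw: "\<And>i. i \<in> I \<Longrightarrow> prob_weight V (\<mu> i)"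
    and sub: "\<And>i. i \<in> I \<Longrightarrow> subweight V (a i) (\<mu> i)"
    and F: "finite F" "F \<subseteq> {(i, j) \<in> I \<times> I. i < j}"
    and reg: "\<And>i j. (i, j) \<in> F \<Longrightarrow> regular V \<epsilon> (d i j) E (\<mu> i) (\<mu> j)"
    and d: "\<And>i j. (i, j) \<in> F \<Longrightarrow> 0 \<le> d i j \<and> d i j \<le> 1"
  shows "\<bar>(\<Sum>v\<in>PiE I (\<lambda>_. V). (\<Prod>i\<in>I. a i (v i)) * (\<Prod>e\<in>F. E (v (fst e)) (v (snd e)))) -
            (\<Prod>e\<in>F. d (fst e) (snd e)) * (\<Prod>i\<in>I. sum (a i) V)\<bar> \<le> real (card F) * \<epsilon>"
  using F reg d
proof (induction F rule: finite_induct)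
  case empty
  show ?case using fin by (simp add: prod_sum_PiE)
next
  case (insert e F)
  obtain p q where e: "e = (p, q)" by (cases e)
  have pq: "p \<in> I" "q \<in> I" "p < q" using insert.prems(1) e by auto
  let ?w = "\<lambda>v. \<Prod>i\<in>I. a i (v i)" and ?H = "\<lambda>v. \<Prod>e\<in>F. E (v (fst e)) (v (snd e))"
  let ?S = "\<Sum>v\<in>PiE I (\<lambda>_. V). ?w v * ?H v"
  let ?P = "(\<Prod>e\<in>F. d (fst e) (snd e)) * (\<Prod>i\<in>I. sum (a i) V)"
  have IH: "\<bar>?S - ?P\<bar> \<le> real (card F) * \<epsilon>"
    using insert.prems by (intro insert.IH) auto
  have one: "\<bar>\<Sum>v\<in>PiE I (\<lambda>_. V). ?w v * ((E (v p) (v q) - d p q) * ?H v)\<bar> \<le> \<epsilon>"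
    using insert.prems insert.hyps e pq
    by (intro counting_one_edge[where \<mu> = \<mu>] fin E \<epsilon> pw sub) auto
  have dpq: "0 \<le> d p q" "d p q \<le> 1" using insert.prems(3) e by auto
  have "(\<Sum>v\<in>PiE I (\<lambda>_. V). ?w v * (\<Prod>e\<in>insert e F. E (v (fst e)) (v (snd e)))) =
        (\<Sum>v\<in>PiE I (\<lambda>_. V). ?w v * ((E (v p) (v q) - d p q) * ?H v)) + d p q * ?S"
    unfolding sum_distrib_left sum.distrib[symmetric]
    using insert.hyps e by (intro sum.cong) (auto simp: algebra_simps)
  moreover have "(\<Prod>e\<in>insert e F. d (fst e) (snd e)) * (\<Prod>i\<in>I. sum (a i) V) = d p q * ?P"
    using insert.hyps e by simp
  ultimately have eq: "(\<Sum>v\<in>PiE I (\<lambda>_. V). ?w v * (\<Prod>e\<in>insert e F. E (v (fst e)) (v (snd e)))) -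
      (\<Prod>e\<in>insert e F. d (fst e) (snd e)) * (\<Prod>i\<in>I. sum (a i) V) =
      (\<Sum>v\<in>PiE I (\<lambda>_. V). ?w v * ((E (v p) (v q) - d p q) * ?H v)) + d p q * (?S - ?P)"
    by (simp only: right_diff_distrib)
  have "\<bar>d p q * (?S - ?P)\<bar> \<le> 1 * (real (card F) * \<epsilon>)"
    unfolding abs_mult using dpq IH by (intro mult_mono) auto
  moreover have "real (card (insert e F)) * \<epsilon> = \<epsilon> + real (card F) * \<epsilon>"
    using insert.hyps by (simp add: distrib_right)
  ultimately show ?case unfolding eq using one by linarith
qed

text \<open>Double counting of cliques together with a vertex joined to all of it. For a fixed
  vertex \<open>u\<close>, the counting lemma inside its neighbourhoods gives about \<open>D\<close>
  times the product of the degrees. For a fixed clique there are at most \<open>n\<close> such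
  vertices, and all cliques together weigh about \<open>D\<close>. The division by \<open>D\<close>
  is where the densities must be bounded below.\<close>

lemma sum_degree_products_le:
  fixes V :: "'a set" and k n :: nat and \<epsilon> \<delta> :: real
  assumes fin: "finite V" and E: "\<And>x y. E x y = 0 \<or> E x y = (1::real)" and \<epsilon>: "\<epsilon> \<ge> 0"
    and pw: "\<And>i. i < k \<Longrightarrow> prob_weight V (\<mu> i)"
    and reg: "\<And>i j. i < j \<Longrightarrow> j < k \<Longrightarrow> regular V \<epsilon> (d i j) E (\<mu> i) (\<mu> j)"
    and d: "\<And>i j. i < j \<Longrightarrow> j < k \<Longrightarrow> \<delta> \<le> d i j \<and> d i j \<le> 1" and \<delta>: "0 < \<delta>" "\<delta> \<le> 1"
    and few: "\<And>v. (\<And>i. i < k \<Longrightarrow> v i \<in> V) \<Longrightarrow> (\<And>i j. i < j \<Longrightarrow> j < k \<Longrightarrow> E (v i) (v j) = 1) \<Longrightarrow>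
       card {u \<in> V. \<forall>i<k. E (v i) u = 1} \<le> n"
    and n: "n \<le> card V"
  shows "(\<Sum>u\<in>V. \<Prod>i<k. \<Sum>x\<in>V. \<mu> i x * E x u) \<le> n + 2 * k\<^sup>2 * \<epsilon> / \<delta> ^ k\<^sup>2 * card V"
proof -
  define F where "F = {(i, j) \<in> {..<k} \<times> {..<k}. i < j}"
  define D where "D = (\<Prod>e\<in>F. d (fst e) (snd e))"
  define K where "K = real (k\<^sup>2) * \<epsilon>"
  define Hm where "Hm = (\<lambda>v. \<Prod>e\<in>F. E (v (fst e)) (v (snd e)))"
  define cnt where "cnt = (\<lambda>a. \<Sum>v\<in>PiE {..<k} (\<lambda>_. V). (\<Prod>i<k. a i (v i)) * Hm v)"
  have uk: "unit_kernel V E" unfolding unit_kernel_def using E by (metis order.refl zero_le_one)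
  have finF: "finite F" by (rule finite_subset[of _ "{..<k} \<times> {..<k}"]) (auto simp: F_def)
  have "card F \<le> card ({..<k} \<times> {..<k})" by (intro card_mono) (auto simp: F_def)
  hence cardF: "card F \<le> k\<^sup>2" by (simp add: power2_eq_square)
  have cnt: "\<bar>cnt a - D * (\<Prod>i<k. sum (a i) V)\<bar> \<le> K"
    if "\<And>i. i < k \<Longrightarrow> subweight V (a i) (\<mu> i)" for a
  proof -
    have "0 \<le> d i j" if "i < j" "j < k" for i j using d[OF that] \<delta> by linarith
    hence "\<bar>cnt a - D * (\<Prod>i<k. sum (a i) V)\<bar> \<le> real (card F) * \<epsilon>"
      unfolding cnt_def D_def Hm_def
      using d by (intro counting_lemma[where \<mu> = \<mu>] fin finF uk \<epsilon>) (auto simp: F_def pw that reg)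
    also have "\<dots> \<le> K" unfolding K_def using cardF \<epsilon> by (intro mult_right_mono) auto
    finally show ?thesis .
  qed
  have D: "\<delta> ^ k\<^sup>2 \<le> D"
  proof -
    have "\<delta> ^ k\<^sup>2 \<le> \<delta> ^ card F" using \<delta> cardF by (intro power_decreasing) auto
    also have "\<dots> = (\<Prod>e\<in>F. \<delta>)" by simp
    also have "\<dots> \<le> D" unfolding D_def using \<delta> d by (intro prod_mono) (auto simp: F_def)
    finally show ?thesis .
  qed
  have \<delta>k: "\<delta> ^ k\<^sup>2 > 0" using \<delta> by simp
  have D0: "D > 0" using D \<delta>k by linarith
  define X where "X = (\<lambda>u. \<Prod>i<k. \<Sum>x\<in>V. \<mu> i x * E x u)"
  have low: "D * X u \<le> cnt (\<lambda>i x. \<mu> i x * E x u) + K" if u: "u \<in> V" for u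
  proof -
    have "\<bar>cnt (\<lambda>i x. \<mu> i x * E x u) - D * X u\<bar> \<le> K"
      unfolding X_def using pw u uk
      by (intro cnt) (auto simp: subweight_def prob_weight_def unit_kernel_def mult_left_le)
    thus ?thesis by linarith
  qed
  have "(\<Sum>u\<in>V. cnt (\<lambda>i x. \<mu> i x * E x u)) =
      (\<Sum>v\<in>PiE {..<k} (\<lambda>_. V). ((\<Prod>i<k. \<mu> i (v i)) * Hm v) * (\<Sum>u\<in>V. \<Prod>i<k. E (v i) u))"
    unfolding cnt_def sum_distrib_left
    by (subst sum.swap) (simp add: prod.distrib mult_ac)
  also have "\<dots> \<le> (\<Sum>v\<in>PiE {..<k} (\<lambda>_. V). ((\<Prod>i<k. \<mu> i (v i)) * Hm v) * n)"
  proof (intro sum_mono)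
    fix v assume v: "v \<in> PiE {..<k} (\<lambda>_. V)"
    have \<mu>0: "0 \<le> (\<Prod>i<k. \<mu> i (v i))" using pw v by (intro prod_nonneg) (auto simp: prob_weight_def)
    show "(\<Prod>i<k. \<mu> i (v i)) * Hm v * (\<Sum>u\<in>V. \<Prod>i<k. E (v i) u) \<le> (\<Prod>i<k. \<mu> i (v i)) * Hm v * n"
    proof (cases "\<forall>i j. i < j \<longrightarrow> j < k \<longrightarrow> E (v i) (v j) = 1")
      case True
      have ind: "(\<Prod>i<k. E (v i) u) = (if \<forall>i<k. E (v i) u = 1 then 1 else 0)" for u
      proof (cases "\<forall>i<k. E (v i) u = 1")
        case False
        then obtain i where "i < k" "E (v i) u = 0" using E by metis
        thus ?thesis using False by (auto intro!: prod_zero)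
      qed simp
      have "(\<Sum>u\<in>V. \<Prod>i<k. E (v i) u) = real (card {u \<in> V. \<forall>i<k. E (v i) u = 1})"
        unfolding ind using fin by (simp add: sum.If_cases Int_def)
      also have "\<dots> \<le> n" using few[of v] v True by auto
      finally show ?thesis
        using \<mu>0 E by (intro mult_left_mono mult_nonneg_nonneg)
          (auto simp: Hm_def intro!: prod_nonneg, metis order.refl zero_le_one)
    next
      case False
      then obtain i j where ij: "i < j" "j < k" "E (v i) (v j) = 0" using E by metis
      hence "(i, j) \<in> F" by (auto simp: F_def)
      hence "Hm v = 0" unfolding Hm_def using ij(3)
        by (intro prod_zero[OF finF] bexI[of _ "(i, j)"]) auto
      thus ?thesis by simp
    qed
  qed
  also have "\<dots> = n * cnt \<mu>" unfolding cnt_def by (simp add: sum_distrib_left mult_ac)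
  finally have up: "(\<Sum>u\<in>V. cnt (\<lambda>i x. \<mu> i x * E x u)) \<le> n * cnt \<mu>" .
  have "\<bar>cnt \<mu> - D * (\<Prod>i<k. sum (\<mu> i) V)\<bar> \<le> K" using pw by (intro cnt subweight_refl) auto
  moreover have "(\<Prod>i<k. sum (\<mu> i) V) = 1" using pw by (intro prod.neutral) (auto simp: prob_weight_def)
  ultimately have "cnt \<mu> \<le> D + K" by simp
  hence "n * cnt \<mu> \<le> n * (D + K)" by (intro mult_left_mono) auto
  moreover have "D * sum X V \<le> (\<Sum>u\<in>V. cnt (\<lambda>i x. \<mu> i x * E x u)) + card V * K"
    using sum_mono[OF low, of V "\<lambda>u. u"] by (simp add: sum_distrib_left sum.distrib)
  \<comment> \<open>One error comes from counting around each \<open>u\<close>, the other from the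
    total weight of the cliques; with \<open>n \<le> card V\<close> they merge, whence the factor
    2.\<close>
  moreover have "n * K \<le> card V * K" using n \<epsilon> by (intro mult_right_mono) (auto simp: K_def)
  ultimately have "D * sum X V \<le> n * D + 2 * card V * K" using up by (simp add: distrib_left)
  hence "sum X V \<le> n + 2 * K * card V / D" using D0 by (simp add: field_simps)
  also have "2 * K * card V / D \<le> 2 * K * card V / \<delta> ^ k\<^sup>2"
    using D \<delta>k \<epsilon> by (intro divide_left_mono) (auto simp: K_def D0)
  finally show ?thesis by (simp add: X_def K_def)
qed

section \<open>The product inequality\<close>

lemma ln_one_plus_ge_quadratic:
  assumes "0 \<le> (s::real)"
  shows "s - s\<^sup>2 / 2 \<le> ln (1 + s)"
proof -
  have "(\<lambda>s::real. ln (1 + s) - s + s\<^sup>2 / 2) 0 \<le> (\<lambda>s. ln (1 + s) - s + s\<^sup>2 / 2) s"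
  proof (rule DERIV_nonneg_imp_nondecreasing[OF assms])
    fix x :: real assume x: "0 \<le> x" "x \<le> s"
    have "((\<lambda>s. ln (1 + s) - s + s\<^sup>2 / 2) has_real_derivative (1 / (1 + x) - 1 + x)) (at x)"
      using x by (auto intro!: derivative_eq_intros)
    moreover have "1 / (1 + x) - 1 + x = x\<^sup>2 / (1 + x)"
      using x by (simp add: field_simps power2_eq_square)
    ultimately show "\<exists>y. ((\<lambda>s. ln (1 + s) - s + s\<^sup>2 / 2) has_real_derivative y) (at x) \<and> 0 \<le> y"
      using x by (intro exI[of _ "x\<^sup>2 / (1 + x)"]) simp
  qed
  thus ?thesis by simp
qed

lemma one_minus_power_ge_quadratic:
  fixes s :: real
  assumes "0 \<le> s" "s \<le> 1" "k \<ge> 1"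
  shows "1 - k * s + (real k - 1) * s\<^sup>2 \<le> (1 - s) ^ k"
proof -
  obtain l where k: "k = Suc l" using assms(3) by (cases k) auto
  have "1 + real l * (- s) \<le> (1 + (- s)) ^ l" using assms by (intro Bernoulli_inequality) auto
  hence "(1 - s) * (1 - real l * s) \<le> (1 - s) * (1 - s) ^ l" using assms by (intro mult_left_mono) auto
  thus ?thesis by (simp add: k algebra_simps power2_eq_square)
qed

lemma one_plus_power_ge_quadratic:
  fixes t :: real
  assumes "0 \<le> t"
  shows "1 + k * t + k * (real k - 1) / 2 * t\<^sup>2 \<le> (1 + t) ^ k"
proof (induction k)
  case (Suc k)
  have "(1 + t) * (1 + k * t + k * (real k - 1) / 2 * t\<^sup>2) \<le> (1 + t) * (1 + t) ^ k"
    using Suc assms by (intro mult_left_mono) auto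
  moreover have "(1 + t) * (1 + k * t + k * (real k - 1) / 2 * t\<^sup>2) =
      1 + Suc k * t + Suc k * (real (Suc k) - 1) / 2 * t\<^sup>2 + k * (real k - 1) / 2 * t ^ 3"
    by (simp add: field_simps power2_eq_square power3_eq_cube)
  moreover have "0 \<le> k * (real k - 1) / 2 * t ^ 3"
    using assms by (cases k) auto
  ultimately show ?case by simp
qed simp

lemma prod_one_plus_ge:
  assumes "finite A" "\<And>i. i \<in> A \<Longrightarrow> 0 \<le> (s i :: real)"
  shows "1 + sum s A \<le> (\<Prod>i\<in>A. 1 + s i)"
  using assms
proof (induction A rule: finite_induct)
  case (insert x A)
  have "1 + sum s A \<le> (\<Prod>i\<in>A. 1 + s i)" using insert by auto
  hence "(1 + s x) * (1 + sum s A) \<le> (1 + s x) * (\<Prod>i\<in>A. 1 + s i)"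
    using insert.prems by (intro mult_left_mono) (auto simp: add_nonneg_nonneg)
  moreover have "0 \<le> s x * sum s A" using insert.prems by (intro mult_nonneg_nonneg sum_nonneg) auto
  ultimately show ?case using insert.hyps by (simp add: algebra_simps)
qed simp

lemma prod_one_minus_ge:
  assumes "finite A" "\<And>i. i \<in> A \<Longrightarrow> 0 \<le> (t i :: real) \<and> t i \<le> 1"
  shows "1 - sum t A \<le> (\<Prod>i\<in>A. 1 - t i)"
  using assms
proof (induction A rule: finite_induct)
  case (insert x A)
  have "1 - sum t A \<le> (\<Prod>i\<in>A. 1 - t i)" using insert by auto
  hence "(1 - t x) * (1 - sum t A) \<le> (1 - t x) * (\<Prod>i\<in>A. 1 - t i)"
    using insert.prems by (intro mult_left_mono) auto
  moreover have "0 \<le> t x * sum t A" using insert.prems by (intro mult_nonneg_nonneg sum_nonneg) auto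
  ultimately show ?case using insert.hyps by (simp add: algebra_simps)
qed simp

text \<open>Equality holds when all \<open>u i = 1\<close>. In terms of \<open>s i = 1 - u i\<close>
  the linear terms of the product and of the powers cancel. What the product loses is at most
  \<open>\<sigma> * \<tau>\<close>, from pairs of deviations of opposite sign, and the quadratic
  terms of the powers have to pay for it.\<close>

lemma mixed_product_bound_small:
  fixes u :: "nat \<Rightarrow> real"
  assumes k: "2 \<le> k" "k \<le> 5" and u: "\<And>i. i < k \<Longrightarrow> 0 \<le> u i \<and> u i \<le> 2"
  shows "2 \<le> (\<Prod>i<k. 2 - u i) + (\<Sum>i<k. u i ^ k) / k"
proof -
  define s where "s = (\<lambda>i. 1 - u i)"
  define P Q where "P = {i. i < k \<and> 0 \<le> s i}" and "Q = {i. i < k \<and> s i < 0}"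
  have PQ: "{..<k} = P \<union> Q" "P \<inter> Q = {}" "finite P" "finite Q" by (auto simp: P_def Q_def)
  define \<sigma> \<tau> where "\<sigma> = (\<Sum>i\<in>P. s i)" and "\<tau> = (\<Sum>i\<in>Q. - s i)"
  define X Y where "X = (\<Sum>i\<in>P. (s i)\<^sup>2)" and "Y = (\<Sum>i\<in>Q. (s i)\<^sup>2)"
  \<comment> \<open>Quadratic coefficients in lower bounds for \<open>u ^ k / k\<close> around 1,
    for \<open>u \<le> 1\<close> and for \<open>u > 1\<close>.\<close>
  define \<alpha> \<beta> where "\<alpha> = (real k - 1) / k" and "\<beta> = (real k - 1) / 2"
  have ab: "\<alpha> \<ge> 0" "\<beta> \<ge> 0" using k by (auto simp: \<alpha>_def \<beta>_def)
  have nn: "\<sigma> \<ge> 0" "\<tau> \<ge> 0" "X \<ge> 0" "Y \<ge> 0"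
    by (auto simp: \<sigma>_def \<tau>_def X_def Y_def P_def Q_def intro!: sum_nonneg)
  have split_sum: "(\<Sum>i<k. f i) = sum f P + sum f Q" for f :: "nat \<Rightarrow> real"
    unfolding PQ(1) using PQ by (intro sum.union_disjoint) auto
  have split_prod: "(\<Prod>i<k. f i) = prod f P * prod f Q" for f :: "nat \<Rightarrow> real"
    unfolding PQ(1) using PQ by (intro prod.union_disjoint) auto

  have "(\<Sum>i<k. u i ^ k) \<ge> (\<Sum>i\<in>P. 1 - k * s i + k * \<alpha> * (s i)\<^sup>2) + (\<Sum>i\<in>Q. 1 - k * s i + k * \<beta> * (s i)\<^sup>2)"
    unfolding split_sum
  proof (intro add_mono sum_mono)
    fix i assume i: "i \<in> P"
    hence "1 - k * s i + (real k - 1) * (s i)\<^sup>2 \<le> (1 - s i) ^ k"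
      using u k by (intro one_minus_power_ge_quadratic) (auto simp: P_def s_def)
    thus "1 - k * s i + k * \<alpha> * (s i)\<^sup>2 \<le> u i ^ k"
      using k by (simp add: s_def \<alpha>_def of_nat_diff)
  next
    fix i assume i: "i \<in> Q"
    hence "1 + k * (- s i) + k * (real k - 1) / 2 * (- s i)\<^sup>2 \<le> (1 + (- s i)) ^ k"
      by (intro one_plus_power_ge_quadratic) (auto simp: Q_def)
    thus "1 - k * s i + k * \<beta> * (s i)\<^sup>2 \<le> u i ^ k"
      by (simp add: s_def \<beta>_def power2_commute[of 1] algebra_simps)
  qed
  also have "(\<Sum>i\<in>P. 1 - k * s i + k * \<alpha> * (s i)\<^sup>2) + (\<Sum>i\<in>Q. 1 - k * s i + k * \<beta> * (s i)\<^sup>2) =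
     (card P + card Q) + k * (\<tau> - \<sigma> + \<alpha> * X + \<beta> * Y)"
    by (simp add: sum.distrib sum_subtractf \<sigma>_def \<tau>_def X_def Y_def sum_negf distrib_left
        right_diff_distrib flip: sum_distrib_left mult.assoc)
  also have "card P + card Q = k"
    using card_Un_disjoint[of P Q] PQ by (metis card_lessThan)
  finally have "(\<Sum>i<k. u i ^ k) \<ge> k * (1 + \<tau> - \<sigma> + \<alpha> * X + \<beta> * Y)" by (simp add: algebra_simps)
  hence pow: "(\<Sum>i<k. u i ^ k) / k \<ge> 1 + \<tau> - \<sigma> + \<alpha> * X + \<beta> * Y"
    using k by (simp add: pos_le_divide_eq mult.commute)

  have A: "1 + \<sigma> \<le> (\<Prod>i\<in>P. 1 + s i)"
    unfolding \<sigma>_def by (intro prod_one_plus_ge) (auto simp: P_def)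
  have B: "1 - \<tau> \<le> (\<Prod>i\<in>Q. 1 + s i)"
    using prod_one_minus_ge[of Q "\<lambda>i. - s i"] u PQ by (auto simp: \<tau>_def Q_def s_def sum_negf)
  have B0: "0 \<le> (\<Prod>i\<in>Q. 1 + s i)" using u by (intro prod_nonneg) (auto simp: Q_def s_def)
  have "(1 + \<sigma>) * (1 - \<tau>) \<le> (1 + \<sigma>) * (\<Prod>i\<in>Q. 1 + s i)"
    using B nn by (intro mult_left_mono) auto
  also have "\<dots> \<le> (\<Prod>i\<in>P. 1 + s i) * (\<Prod>i\<in>Q. 1 + s i)"
    using A B0 by (intro mult_right_mono)
  also have "\<dots> = (\<Prod>i<k. 2 - u i)"
    unfolding split_prod by (simp add: s_def)
  finally have prd: "1 + \<sigma> - \<tau> - \<sigma> * \<tau> \<le> (\<Prod>i<k. 2 - u i)" by (simp add: algebra_simps)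

  have "\<sigma> * \<tau> \<le> \<alpha> * X + \<beta> * Y"
  proof (rule power2_le_imp_le)
    have "\<sigma>\<^sup>2 \<le> X * card P" "\<tau>\<^sup>2 \<le> Y * card Q"
      using sum_squared_le_sum_of_squares[of s P] sum_squared_le_sum_of_squares[of "\<lambda>i. - s i" Q] PQ
      by (auto simp: \<sigma>_def \<tau>_def X_def Y_def)
    hence "(\<sigma> * \<tau>)\<^sup>2 \<le> (X * card P) * (Y * card Q)"
      unfolding power_mult_distrib using nn by (intro mult_mono) auto
    also have "\<dots> = (card P * card Q) * (X * Y)" by simp
    also have "\<dots> \<le> (4 * \<alpha> * \<beta>) * (X * Y)"
    proof (intro mult_right_mono)
      have "4 * (real (card P) * card Q) \<le> (real (card P) + card Q)\<^sup>2"
        using sum_squares_bound[of "real (card P)" "card Q"] by (simp add: power2_eq_square algebra_simps)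
      hence "4 * (real (card P) * card Q) \<le> (real k)\<^sup>2" using \<open>card P + card Q = k\<close> by (simp flip: of_nat_add)
      \<comment> \<open>This is \<open>k ^ 3 \<le> 8 * (k - 1)\<^sup>2\<close>: an equality for
        \<open>k = 2\<close>, true up to 5 and false at 6. It dictates the split into small and
        large \<open>k\<close>.\<close>
      moreover have "(real k)\<^sup>2 \<le> 4 * (4 * \<alpha> * \<beta>)"
      proof -
        have "k = 2 \<or> k = 3 \<or> k = 4 \<or> k = 5" using k by linarith
        thus ?thesis by (auto simp: \<alpha>_def \<beta>_def)
      qed
      ultimately show "real (card P * card Q) \<le> 4 * \<alpha> * \<beta>" by simp
    qed (use nn in auto)
    also have "\<dots> \<le> (\<alpha> * X + \<beta> * Y)\<^sup>2"
      using sum_squares_bound[of "\<alpha> * X" "\<beta> * Y"] by (simp add: power2_eq_square algebra_simps)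
    finally show "(\<sigma> * \<tau>)\<^sup>2 \<le> (\<alpha> * X + \<beta> * Y)\<^sup>2" .
    show "0 \<le> \<alpha> * X + \<beta> * Y" using nn ab by simp
  qed
  thus ?thesis using pow prd by linarith
qed

text \<open>Logarithms decouple the factors. Summed over \<open>k\<close> values of
  \<open>u\<close>, this yields \<open>ln P \<ge> 1 - S / k\<close>, where \<open>P\<close> is the
  product and \<open>S\<close> the sum of the powers, and \<open>ln P \<le> P - 1\<close> finishes.
  Nothing is lost at the extremal point \<open>u = 1\<close>, where both estimates are
  equalities.\<close>

lemma power_ln_bound:
  fixes u :: real
  assumes k: "k \<ge> 6" and u: "0 \<le> u" "u \<le> 8 / 5"
  shows "1 / k \<le> u ^ k / k + ln (2 - u)"
proof (cases "u \<le> 1")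
  case True
  define s where "s = 1 - u"
  have s: "0 \<le> s" "s \<le> 1" using True u by (auto simp: s_def)
  have "1 - k * s + (real k - 1) * s\<^sup>2 \<le> (1 - s) ^ k"
    using s k by (intro one_minus_power_ge_quadratic) auto
  hence "(1 - k * s + (real k - 1) * s\<^sup>2) / k \<le> u ^ k / k"
    by (intro divide_right_mono) (auto simp: s_def)
  moreover have "(1 - k * s + (real k - 1) * s\<^sup>2) / k = 1 / k - s + s\<^sup>2 - s\<^sup>2 / k"
    using k by (simp add: field_simps of_nat_diff)
  moreover have "s\<^sup>2 / k \<le> s\<^sup>2 / 2" using k by (intro divide_left_mono) auto
  moreover have "s - s\<^sup>2 / 2 \<le> ln (2 - u)" using ln_one_plus_ge_quadratic[OF s(1)] by (simp add: s_def)
  ultimately show ?thesis by linarith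
next
  case False
  define t where "t = u - 1"
  have t: "0 < t" "t \<le> 3 / 5" using False u by (auto simp: t_def)
  have "1 + k * t + k * (real k - 1) / 2 * t\<^sup>2 \<le> (1 + t) ^ k"
    using t by (intro one_plus_power_ge_quadratic) auto
  hence "(1 + k * t + k * (real k - 1) / 2 * t\<^sup>2) / k \<le> u ^ k / k"
    by (intro divide_right_mono) (auto simp: t_def)
  moreover have "(1 + k * t + k * (real k - 1) / 2 * t\<^sup>2) / k = 1 / k + t + (real k - 1) / 2 * t\<^sup>2"
    using k by (simp add: field_simps)
  moreover have "5 / 2 * t\<^sup>2 \<le> (real k - 1) / 2 * t\<^sup>2"
    using k by (intro mult_right_mono) auto
  moreover have "ln (1 / (1 - t)) \<le> 1 / (1 - t) - 1"
    using t by (intro ln_le_minus_one) auto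
  hence "1 - 1 / (1 - t) \<le> ln (2 - u)" using t by (simp add: ln_div t_def)
  \<comment> \<open>The coefficient \<open>5 / 2\<close> is \<open>(k - 1) / 2\<close> at
    \<open>k = 6\<close>, and \<open>3 / 2 - 5 / 2 * t\<close> is nonnegative exactly up to
    \<open>t = 3 / 5\<close>. This is the origin of the threshold \<open>8 / 5\<close>.\<close>
  moreover have "1 / (1 - t) \<le> 1 + t + 5 / 2 * t\<^sup>2"
  proof -
    have "0 \<le> t\<^sup>2 * (3 / 2 - 5 / 2 * t)" using t by (intro mult_nonneg_nonneg) auto
    hence "1 \<le> (1 + t + 5 / 2 * t\<^sup>2) * (1 - t)" by (simp add: algebra_simps power2_eq_square)
    thus ?thesis using t by (simp add: pos_divide_le_eq)
  qed
  ultimately show ?thesis by linarith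
qed

lemma mixed_product_bound_large:
  fixes u :: "nat \<Rightarrow> real"
  assumes k: "k \<ge> 6" and u: "\<And>i. i < k \<Longrightarrow> 0 \<le> u i \<and> u i \<le> 2"
  shows "2 \<le> (\<Prod>i<k. 2 - u i) + (\<Sum>i<k. u i ^ k) / k"
proof (cases "\<exists>i<k. u i > 8 / 5")
  case True
  then obtain i where i: "i < k" "u i > 8 / 5" by blast
  \<comment> \<open>A single \<open>u i\<close> above \<open>8 / 5\<close> contributes 2 by itself,
    so the range near 2, where the logarithm tends to minus infinity, never meets the previous
    bound.\<close>
  have "2 * real k \<le> (8 / 5) ^ k"
    using k
  proof (induction k rule: dec_induct)
    case base
    show ?case by (simp add: power_divide)
  next
    case (step m)
    have "2 * real (Suc m) \<le> 8 / 5 * (2 * real m)" using step by simp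
    also have "\<dots> \<le> 8 / 5 * (8 / 5) ^ m" using step by (intro mult_left_mono) auto
    finally show ?case by simp
  qed
  also have "\<dots> \<le> u i ^ k" using i by (intro power_mono) auto
  also have "\<dots> \<le> (\<Sum>i<k. u i ^ k)"
    using i u by (intro member_le_sum) auto
  finally have "2 \<le> (\<Sum>i<k. u i ^ k) / k" using k by (simp add: pos_le_divide_eq)
  moreover have "0 \<le> (\<Prod>i<k. 2 - u i)" using u by (intro prod_nonneg) auto
  ultimately show ?thesis by linarith
next
  case False
  hence le: "u i \<le> 8 / 5" if "i < k" for i using that by force
  have pos: "2 - u i > 0" if "i < k" for i using le[OF that] by linarith
  define P where "P = (\<Prod>i<k. 2 - u i)"
  have P: "P > 0" unfolding P_def using pos by (intro prod_pos) auto
  have "ln P \<le> P - 1" using P by (rule ln_le_minus_one)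
  moreover have "ln P = (\<Sum>i<k. ln (2 - u i))" unfolding P_def by (rule ln_prod) (simp, metis lessThan_iff less_irrefl pos)
  moreover have "(\<Sum>i<k. 1 / real k) \<le> (\<Sum>i<k. u i ^ k / k + ln (2 - u i))"
    using k u le by (intro sum_mono power_ln_bound) auto
  moreover have "(\<Sum>i<k. 1 / real k) = 1" using k by simp
  ultimately show ?thesis
    by (simp add: P_def sum.distrib sum_divide_distrib)
qed

lemma mixed_product_bound:
  fixes x y :: "nat \<Rightarrow> real"
  assumes k: "k \<ge> 1" and q: "q \<ge> 0"
    and xy: "\<And>i. i < k \<Longrightarrow> 0 \<le> x i" "\<And>i. i < k \<Longrightarrow> 0 \<le> y i" "\<And>i. i < k \<Longrightarrow> q \<le> x i + y i"
  shows "2 * (q / 2) ^ k \<le> (\<Prod>i<k. y i) + (\<Sum>i<k. x i ^ k) / k"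
proof (cases "q = 0")
  case True
  have "0 \<le> (\<Prod>i<k. y i)" "0 \<le> (\<Sum>i<k. x i ^ k)"
    using xy by (auto intro!: prod_nonneg sum_nonneg)
  thus ?thesis using True k by (simp add: power_0_left)
next
  case False
  with q have q: "q > 0" by simp
  \<comment> \<open>Cutting \<open>y i\<close> off at \<open>q\<close> and lowering
    \<open>x i\<close> to the complement decreases the right-hand side. The scaling by
    \<open>2 / q\<close> moves the balanced point to \<open>u i = 1\<close>.\<close>
  define u where "u = (\<lambda>i. 2 * (q - min (y i) q) / q)"
  have u: "0 \<le> u i \<and> u i \<le> 2" if "i < k" for i
    using xy(2)[OF that] q by (auto simp: u_def field_simps min_def)
  have main: "2 \<le> (\<Prod>i<k. 2 - u i) + (\<Sum>i<k. u i ^ k) / k"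
  proof -
    consider "k = 1" | "2 \<le> k" "k \<le> 5" | "k \<ge> 6" using k by linarith
    thus ?thesis
    proof cases
      case 1 thus ?thesis by simp
    next
      case 2 thus ?thesis using u by (intro mixed_product_bound_small)
    next
      case 3 thus ?thesis using u by (intro mixed_product_bound_large)
    qed
  qed
  have "(\<Prod>i<k. 2 - u i) * (q / 2) ^ k = (\<Prod>i<k. (2 - u i) * (q / 2))"
    by (simp only: prod.distrib prod_constant card_lessThan)
  also have "\<dots> \<le> (\<Prod>i<k. y i)"
    using u q xy by (intro prod_mono) (auto simp: u_def field_simps min_def)
  finally have 1: "(\<Prod>i<k. 2 - u i) * (q / 2) ^ k \<le> (\<Prod>i<k. y i)" .
  have "(\<Sum>i<k. u i ^ k) * (q / 2) ^ k = (\<Sum>i<k. (u i * (q / 2)) ^ k)"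
    by (simp only: sum_distrib_right power_mult_distrib)
  also have "\<dots> \<le> (\<Sum>i<k. x i ^ k)"
  proof (intro sum_mono power_mono)
    fix i assume "i \<in> {..<k}"
    hence "i < k" by simp
    note i = xy(1)[OF this] xy(3)[OF this] u[OF this]
    show "u i * (q / 2) \<le> x i" using i q by (auto simp: u_def min_def)
    show "0 \<le> u i * (q / 2)" using i q by simp
  qed
  finally have 2: "(\<Sum>i<k. u i ^ k) * (q / 2) ^ k \<le> (\<Sum>i<k. x i ^ k)" .
  have "2 * (q / 2) ^ k \<le> ((\<Prod>i<k. 2 - u i) + (\<Sum>i<k. u i ^ k) / k) * (q / 2) ^ k"
    using main q by (intro mult_right_mono) auto
  also have "\<dots> = (\<Prod>i<k. 2 - u i) * (q / 2) ^ k + (\<Sum>i<k. u i ^ k) * (q / 2) ^ k / k"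
    by (simp add: distrib_right)
  also have "\<dots> \<le> (\<Prod>i<k. y i) + (\<Sum>i<k. x i ^ k) / k"
    using 1 2 k by (intro add_mono divide_right_mono) auto
  finally show ?thesis .
qed

section \<open>Books in two-coloured quasirandom graphs\<close>

text \<open>A bilinear form on weights in \<open>[0, 1]\<close> is maximal at indicators: with
  \<open>b\<close> fixed the best \<open>a\<close> is the indicator of \<open>X\<close>, and then
  the best \<open>b\<close> is the indicator of \<open>Y\<close>. This carries the discrepancy of
  sets over to weights.\<close>

lemma bilinear_le_of_sets:
  fixes M :: "'a \<Rightarrow> 'a \<Rightarrow> real"
  assumes fin: "finite V"
    and M: "\<And>X Y. X \<subseteq> V \<Longrightarrow> Y \<subseteq> V \<Longrightarrow> (\<Sum>x\<in>X. \<Sum>y\<in>Y. M x y) \<le> K"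
    and ab: "\<And>x. x \<in> V \<Longrightarrow> 0 \<le> a x \<and> a x \<le> 1" "\<And>x. x \<in> V \<Longrightarrow> 0 \<le> b x \<and> b x \<le> 1"
  shows "(\<Sum>x\<in>V. \<Sum>y\<in>V. a x * b y * M x y) \<le> K"
proof -
  have extremal: "(\<Sum>x\<in>V. a x * h x) \<le> (\<Sum>x\<in>{x\<in>V. h x > 0}. h x)"
    if "\<And>x. x \<in> V \<Longrightarrow> 0 \<le> a x \<and> a x \<le> 1" for a h :: "'a \<Rightarrow> real"
  proof -
    have "(\<Sum>x\<in>V. a x * h x) \<le> (\<Sum>x\<in>V. if h x > 0 then h x else 0)"
      using that by (intro sum_mono) (auto simp: mult_left_le_one_le mult_nonneg_nonpos)
    also have "\<dots> = (\<Sum>x\<in>{x\<in>V. h x > 0}. h x)" using fin by (simp add: sum.inter_filter)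
    finally show ?thesis .
  qed
  define X where "X = {x \<in> V. (\<Sum>y\<in>V. b y * M x y) > 0}"
  define Y where "Y = {y \<in> V. (\<Sum>x\<in>X. M x y) > 0}"
  have "(\<Sum>x\<in>V. \<Sum>y\<in>V. a x * b y * M x y) = (\<Sum>x\<in>V. a x * (\<Sum>y\<in>V. b y * M x y))"
    by (simp add: sum_distrib_left mult.assoc)
  also have "\<dots> \<le> (\<Sum>x\<in>X. \<Sum>y\<in>V. b y * M x y)" unfolding X_def by (rule extremal[OF ab(1)])
  also have "\<dots> = (\<Sum>y\<in>V. b y * (\<Sum>x\<in>X. M x y))"
    by (subst sum.swap) (simp add: sum_distrib_left)
  also have "\<dots> \<le> (\<Sum>y\<in>Y. \<Sum>x\<in>X. M x y)" unfolding Y_def by (rule extremal[OF ab(2)])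
  also have "\<dots> = (\<Sum>x\<in>X. \<Sum>y\<in>Y. M x y)" by (rule sum.swap)
  also have "\<dots> \<le> K" by (rule M) (auto simp: X_def Y_def)
  finally show ?thesis .
qed

text \<open>The situation to be refuted: \<open>E True\<close> and \<open>E False\<close> are the
  two colour classes, and no monochromatic clique on \<open>k\<close> vertices has more than
  \<open>n\<close> common neighbours in its colour. The bound \<open>p0\<close> is separate from
  \<open>p\<close> so that one \<open>\<eta>\<close> serves all densities
  \<open>p \<ge> p0\<close>.\<close>

locale bookless =
  fixes k :: nat and p0 \<zeta> \<eta> :: real and V :: "'a set" and E :: "bool \<Rightarrow> 'a \<Rightarrow> 'a \<Rightarrow> real"
    and p :: real and n :: nat
  assumes fin: "finite V" and ne: "V \<noteq> {}"
    and k: "k \<ge> 1" and p0: "0 < p0" and \<zeta>: "0 < \<zeta>" "\<zeta> \<le> 1"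
    and p: "p0 \<le> p" "p \<le> 1" and n: "real n \<le> (1 - \<zeta>) * (p / 2) ^ k * card V"
    and E01: "\<And>c x y. E c x y = 0 \<or> E c x y = 1"
    and E_sym: "\<And>c x y. E c x y = E c y x"
    and quasirandom: "\<And>X Y. X \<subseteq> V \<Longrightarrow> Y \<subseteq> V \<Longrightarrow>
        \<bar>\<Sum>x\<in>X. \<Sum>y\<in>Y. E True x y + E False x y - p\<bar> \<le> \<eta> * (card V)\<^sup>2"
    and few: "\<And>c v. (\<And>i. i < k \<Longrightarrow> v i \<in> V) \<Longrightarrow>
        (\<And>i j. i < j \<Longrightarrow> j < k \<Longrightarrow> E c (v i) (v j) = 1) \<Longrightarrow>
        card {u \<in> V. \<forall>i<k. E c (v i) u = 1} \<le> n"
begin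

definition G :: "'a \<Rightarrow> 'a \<Rightarrow> real" where "G x y = E True x y + E False x y"

text \<open>Domination by \<open>C\<close> times the uniform weight, the invariant under which
  quasirandomness still says something.\<close>

definition spread :: "real \<Rightarrow> ('a \<Rightarrow> real) \<Rightarrow> bool" where
  "spread C \<mu> \<longleftrightarrow> prob_weight V \<mu> \<and> (\<forall>x\<in>V. \<mu> x \<le> C / card V)"

definition deg :: "bool \<Rightarrow> ('a \<Rightarrow> real) \<Rightarrow> 'a \<Rightarrow> real" where
  "deg c \<mu> u = (\<Sum>x\<in>V. \<mu> x * E c x u)"

lemma card_pos: "card V > 0"
  using fin ne by (simp add: card_gt_0_iff)

lemma kernel_E: "unit_kernel V (E c)"
  unfolding unit_kernel_def using E01 by (metis order.refl zero_le_one)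

lemma n_le_card: "n \<le> card V"
proof -
  have "(1 - \<zeta>) * (p / 2) ^ k * card V \<le> 1 * 1 * real (card V)"
    using \<zeta> p p0 by (intro mult_mono power_le_one) auto
  thus ?thesis using n by simp
qed

lemma cutdev_G_bound:
  assumes ab: "\<And>x. x \<in> V \<Longrightarrow> 0 \<le> a x \<and> a x \<le> 1" "\<And>x. x \<in> V \<Longrightarrow> 0 \<le> b x \<and> b x \<le> 1"
  shows "\<bar>cutdev V G p a b\<bar> \<le> \<eta> * (card V)\<^sup>2"
proof -
  have "cutdev V G p a b \<le> \<eta> * (card V)\<^sup>2"
    unfolding cutdev_def
  proof (rule bilinear_le_of_sets[OF fin _ ab])
    fix X Y assume "X \<subseteq> V" "Y \<subseteq> V"
    from quasirandom[OF this] show "(\<Sum>x\<in>X. \<Sum>y\<in>Y. G x y - p) \<le> \<eta> * (card V)\<^sup>2"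
      by (simp add: G_def)
  qed
  moreover have "- cutdev V G p a b \<le> \<eta> * (card V)\<^sup>2"
  proof -
    have "- cutdev V G p a b = (\<Sum>x\<in>V. \<Sum>y\<in>V. a x * b y * (- (G x y - p)))"
      by (simp only: cutdev_def sum_negf mult_minus_right)
    also have "\<dots> \<le> \<eta> * (card V)\<^sup>2"
    proof (rule bilinear_le_of_sets[OF fin _ ab])
      fix X Y assume "X \<subseteq> V" "Y \<subseteq> V"
      from quasirandom[OF this] show "(\<Sum>x\<in>X. \<Sum>y\<in>Y. - (G x y - p)) \<le> \<eta> * (card V)\<^sup>2"
        unfolding sum_negf by (simp add: G_def)
    qed
    finally show ?thesis .
  qed
  ultimately show ?thesis by linarith
qed

lemma regular_G:
  assumes \<mu>: "spread C \<mu>" "spread C \<nu>" and C: "C > 0"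
  shows "regular V (C\<^sup>2 * \<eta>) p G \<mu> \<nu>"
proof -
  have N: "real (card V) > 0" using card_pos by simp
  have "regular V (\<eta> * (card V)\<^sup>2) p G (\<lambda>_. 1) (\<lambda>_. 1)"
    unfolding regular_def subweight_def using cutdev_G_bound by blast
  hence "regular V (C / card V * (C / card V) * (\<eta> * (card V)\<^sup>2)) p G \<mu> \<nu>"
    using \<mu> C N by (intro regular_subweight[where \<mu> = "\<lambda>_. 1" and \<nu> = "\<lambda>_. 1"])
      (auto simp: spread_def)
  thus ?thesis using N by (simp add: power2_eq_square mult.assoc)
qed

text \<open>Test quasirandomness with \<open>\<mu>\<close> on one side and the indicator of the
  exceptional set on the other. Only one side has to be rescaled, so the loss is \<open>C\<close>
  and not \<open>C\<^sup>2\<close>.\<close>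

lemma few_low_degree:
  assumes \<mu>: "spread C \<mu>" and C: "C > 0" and \<sigma>: "\<sigma> > 0"
  shows "card {u \<in> V. deg True \<mu> u + deg False \<mu> u < p - \<sigma>} \<le> C * \<eta> / \<sigma> * card V"
proof -
  define Z where "Z = {u \<in> V. deg True \<mu> u + deg False \<mu> u < p - \<sigma>}"
  define N where "N = real (card V)"
  have N: "N > 0" using card_pos by (simp add: N_def)
  define b :: "'a \<Rightarrow> real" where "b = (\<lambda>y. if y \<in> Z then 1 else 0)"
  have pw: "prob_weight V \<mu>" using \<mu> by (simp add: spread_def)
  have "\<bar>cutdev V G p (\<lambda>x. N / C * \<mu> x) (\<lambda>y. 1 * b y)\<bar> \<le> \<eta> * (card V)\<^sup>2"
  proof (rule cutdev_G_bound)
    fix x assume x: "x \<in> V"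
    have "\<mu> x \<ge> 0" "\<mu> x \<le> C / N" using \<mu> x by (auto simp: spread_def prob_weight_def N_def)
    thus "0 \<le> N / C * \<mu> x \<and> N / C * \<mu> x \<le> 1" using N C by (auto simp: field_simps)
  qed (simp add: b_def)
  hence "N / C * \<bar>cutdev V G p \<mu> b\<bar> \<le> \<eta> * N\<^sup>2"
    unfolding cutdev_scale using N C by (simp add: abs_mult N_def)
  hence 1: "\<bar>cutdev V G p \<mu> b\<bar> \<le> C * \<eta> * N"
    using N C by (simp add: field_simps power2_eq_square)
  have "cutdev V G p \<mu> b = (\<Sum>y\<in>V. b y * (\<Sum>x\<in>V. \<mu> x * (G x y - p)))"
    unfolding cutdev_def by (subst sum.swap) (simp add: sum_distrib_left mult_ac)
  also have "\<dots> = (\<Sum>y\<in>V. if y \<in> Z then deg True \<mu> y + deg False \<mu> y - p else 0)"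
  proof (intro sum.cong refl)
    fix y
    have "(\<Sum>x\<in>V. \<mu> x * (G x y - p)) = deg True \<mu> y + deg False \<mu> y - p * sum \<mu> V"
      by (simp add: deg_def G_def right_diff_distrib distrib_left sum.distrib sum_subtractf
          sum_distrib_left mult.commute)
    thus "b y * (\<Sum>x\<in>V. \<mu> x * (G x y - p)) =
        (if y \<in> Z then deg True \<mu> y + deg False \<mu> y - p else 0)"
      using pw by (simp add: b_def prob_weight_def)
  qed
  also have "\<dots> \<le> (\<Sum>y\<in>V. if y \<in> Z then - \<sigma> else 0)"
    by (intro sum_mono) (auto simp: Z_def)
  also have "\<dots> = - \<sigma> * card Z"
    using fin by (simp add: sum.If_cases Int_absorb1 Z_def Int_def)
  finally have "\<sigma> * card Z \<le> C * \<eta> * N" using 1 by linarith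
  thus ?thesis using \<sigma> by (simp add: field_simps Z_def N_def)
qed

lemma sum_power_deg_le:
  fixes \<epsilon> \<delta> :: real
  assumes \<mu>: "prob_weight V \<mu>" and reg: "regular V \<epsilon> d (E c) \<mu> \<mu>" and \<epsilon>: "\<epsilon> \<ge> 0"
    and d: "\<delta> \<le> d" "d \<le> 1" "0 < \<delta>"
  shows "(\<Sum>u\<in>V. deg c \<mu> u ^ k) \<le> n + 2 * k\<^sup>2 * \<epsilon> / \<delta> ^ k\<^sup>2 * card V"
proof -
  have "(\<Sum>u\<in>V. \<Prod>i<k. \<Sum>x\<in>V. \<mu> x * E c x u) \<le> n + 2 * k\<^sup>2 * \<epsilon> / \<delta> ^ k\<^sup>2 * card V"
    by (rule sum_degree_products_le[where d = "\<lambda>_ _. d", OF fin E01 \<epsilon> _ _ _ _ _ few n_le_card])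
      (use assms in auto)
  thus ?thesis by (simp add: deg_def)
qed

lemma sum_prod_deg_le:
  fixes \<epsilon> \<delta> :: real
  assumes \<mu>: "\<And>i. i < k \<Longrightarrow> prob_weight V (\<mu> i)" and \<epsilon>: "\<epsilon> \<ge> 0"
    and reg: "\<And>i j. i < j \<Longrightarrow> j < k \<Longrightarrow> \<exists>d. \<delta> \<le> d \<and> d \<le> 1 \<and> regular V \<epsilon> d (E c) (\<mu> i) (\<mu> j)"
    and \<delta>: "0 < \<delta>" "\<delta> \<le> 1"
  shows "(\<Sum>u\<in>V. \<Prod>i<k. deg c (\<mu> i) u) \<le> n + 2 * k\<^sup>2 * \<epsilon> / \<delta> ^ k\<^sup>2 * card V"
proof -
  obtain d where d: "\<And>i j. i < j \<Longrightarrow> j < k \<Longrightarrow> \<delta> \<le> d i j \<and> d i j \<le> 1 \<and> regular V \<epsilon> (d i j) (E c) (\<mu> i) (\<mu> j)"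
    using reg by metis
  show ?thesis
    unfolding deg_def
    by (rule sum_degree_products_le[where d = d, OF fin E01 \<epsilon> _ _ _ _ _ few n_le_card])
      (use \<mu> d \<delta> in auto)
qed

lemma deg_nonneg: "prob_weight V \<mu> \<Longrightarrow> 0 \<le> deg c \<mu> u"
  unfolding deg_def
proof (intro sum_nonneg mult_nonneg_nonneg)
  fix x show "0 \<le> E c x u" using E01[of c x u] by auto
qed (auto simp: prob_weight_def)

text \<open>
  Otherwise the self-regular weight \<open>\<mu>\<close> would carry a book of colour \<open>c\<close> whose pages are the
  vertices joined to \<open>\<mu>\<close> almost only in colour \<open>c\<close>.
\<close>
lemma few_low_other_degree:
  fixes \<epsilon> \<delta> :: real
  assumes \<mu>: "spread C \<mu>" and C: "C > 0" and reg: "regular V \<epsilon> d (E c) \<mu> \<mu>" and \<epsilon>: "\<epsilon> \<ge> 0"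
    and \<delta>: "\<delta> = \<zeta> * p0 / (4 * k)" and d: "\<delta> \<le> d" "d \<le> 1"
    and small: "2 * k\<^sup>2 * \<epsilon> / \<delta> ^ k\<^sup>2 \<le> \<zeta> / 2 * (p0 / 2) ^ k"
  shows "card {u \<in> V. deg (\<not> c) \<mu> u < \<delta>} \<le> (1 / 2 ^ k + C * \<eta> / \<delta>) * card V"
proof -
  define N where "N = real (card V)"
  have N: "N > 0" using card_pos by (simp add: N_def)
  define L where "L = {u \<in> V. deg (\<not> c) \<mu> u < \<delta>}"
  define Z where "Z = {u \<in> V. deg True \<mu> u + deg False \<mu> u < p - \<delta>}"
  have pw: "prob_weight V \<mu>" using \<mu> by (simp add: spread_def)
  have \<delta>0: "\<delta> > 0" using \<zeta> p0 k by (simp add: \<delta>)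
  have Z: "card Z \<le> C * \<eta> / \<delta> * N"
    using few_low_degree[OF \<mu> C \<delta>0] by (simp add: Z_def N_def)
  have pp: "p > 0" using p p0 by linarith
  \<comment> \<open>The value of \<open>\<delta>\<close> makes \<open>2 * \<delta>\<close> at most
    \<open>p * \<zeta> / (2 * k)\<close>; by Bernoulli's inequality the \<open>k\<close>-th power
    then loses no more than the factor \<open>1 - \<zeta> / 2\<close>.\<close>
  have "p * (1 - \<zeta> / (2 * k)) \<le> p - 2 * \<delta>"
    using p(1) \<zeta> k by (simp add: \<delta> field_simps)
  moreover have z: "\<zeta> / (2 * k) \<le> 1" using \<zeta> k by (simp add: field_simps)
  ultimately have "(p * (1 - \<zeta> / (2 * k))) ^ k \<le> (p - 2 * \<delta>) ^ k"
    using pp by (intro power_mono) auto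
  moreover have "1 + real k * (- (\<zeta> / (2 * k))) \<le> (1 + - (\<zeta> / (2 * k))) ^ k"
    using z by (intro Bernoulli_inequality) linarith
  hence "p ^ k * (1 - \<zeta> / 2) \<le> (p * (1 - \<zeta> / (2 * k))) ^ k"
    unfolding power_mult_distrib using k pp by (intro mult_left_mono) auto
  ultimately have low: "p ^ k * (1 - \<zeta> / 2) \<le> (p - 2 * \<delta>) ^ k" by linarith
  have nonneg: "0 \<le> p - 2 * \<delta>"
  proof -
    have "0 \<le> p * (1 - \<zeta> / (2 * k))" using z pp by (intro mult_nonneg_nonneg) auto
    thus ?thesis using \<open>p * (1 - \<zeta> / (2 * k)) \<le> p - 2 * \<delta>\<close> by linarith
  qed
  have "card (L - Z) * (p ^ k * (1 - \<zeta> / 2)) = (\<Sum>u\<in>L - Z. p ^ k * (1 - \<zeta> / 2))" by simp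
  also have "\<dots> \<le> (\<Sum>u\<in>L - Z. deg c \<mu> u ^ k)"
  proof (intro sum_mono order_trans[OF low] power_mono nonneg)
    fix u assume u: "u \<in> L - Z"
    hence "p - \<delta> \<le> deg c \<mu> u + deg (\<not> c) \<mu> u" by (cases c) (auto simp: L_def Z_def)
    thus "p - 2 * \<delta> \<le> deg c \<mu> u" using u by (auto simp: L_def)
  qed
  also have "\<dots> \<le> (\<Sum>u\<in>V. deg c \<mu> u ^ k)"
    using fin pw by (intro sum_mono2) (auto simp: L_def deg_nonneg)
  also have "\<dots> \<le> n + 2 * k\<^sup>2 * \<epsilon> / \<delta> ^ k\<^sup>2 * N"
    unfolding N_def by (rule sum_power_deg_le[OF pw reg \<epsilon> d \<delta>0])
  also have "\<dots> \<le> (1 - \<zeta>) * (p / 2) ^ k * N + \<zeta> / 2 * (p / 2) ^ k * N"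
  proof (intro add_mono mult_right_mono)
    have "(p0 / 2) ^ k \<le> (p / 2) ^ k" using p p0 by (intro power_mono) auto
    hence "\<zeta> / 2 * (p0 / 2) ^ k \<le> \<zeta> / 2 * (p / 2) ^ k" using \<zeta> by (intro mult_left_mono) auto
    thus "2 * k\<^sup>2 * \<epsilon> / \<delta> ^ k\<^sup>2 \<le> \<zeta> / 2 * (p / 2) ^ k" using small by linarith
  qed (use n N in \<open>auto simp: N_def\<close>)
  \<comment> \<open>The gap \<open>\<zeta>\<close> in \<open>n\<close> minus the counting error
    \<open>\<zeta> / 2\<close> leaves the same factor \<open>1 - \<zeta> / 2\<close> as on the left.
    It cancels, and the proportion is exactly \<open>1 / 2 ^ k\<close>.\<close>
  also have "\<dots> = N / 2 ^ k * (p ^ k * (1 - \<zeta> / 2))" by (simp add: power_divide field_simps)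
  finally have "card (L - Z) \<le> N / 2 ^ k"
    using pp \<zeta> by (subst (asm) mult_le_cancel_right) (auto simp: zero_less_mult_iff not_less)
  moreover have "card L \<le> card (L - Z) + card Z"
  proof -
    have "card L \<le> card ((L - Z) \<union> Z)" using fin by (intro card_mono) (auto simp: L_def Z_def)
    thus ?thesis using card_Un_le[of "L - Z" Z] by linarith
  qed
  ultimately have "card L \<le> N / 2 ^ k + C * \<eta> / \<delta> * N" using Z by linarith
  thus ?thesis by (simp add: L_def N_def distrib_right)
qed

text \<open>Between two weights the colour is the opposite of that of the earlier one. Hence any
  weights that share a colour \<open>\<kappa>\<close> have the opposite colour dense between all
  their pairs.\<close>

definition stage :: "nat \<Rightarrow> real \<Rightarrow> real \<Rightarrow> real \<Rightarrow> (nat \<Rightarrow> 'a \<Rightarrow> real) \<Rightarrow> (nat \<Rightarrow> bool) \<Rightarrow> bool" where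
  "stage t \<epsilon> C \<delta> \<mu> c \<longleftrightarrow>
     (\<forall>i<t. spread C (\<mu> i) \<and> (\<exists>d. \<delta> \<le> d \<and> d \<le> 1 \<and> regular V \<epsilon> d (E (c i)) (\<mu> i) (\<mu> i))) \<and>
     (\<forall>j<t. \<forall>i<j. \<exists>d. \<delta> \<le> d \<and> d \<le> 1 \<and> regular V \<epsilon> d (E (\<not> c i)) (\<mu> i) (\<mu> j))"

end

section \<open>Building the weights one at a time\<close>

lemma bookless_mono:
  assumes "bookless k p0 \<zeta> \<eta> V E p n" "\<eta> \<le> \<eta>'"
  shows "bookless k p0 \<zeta> \<eta>' V E p n"
proof -
  interpret bookless k p0 \<zeta> \<eta> V E p n by fact
  show ?thesis
  proof
    fix X Y assume "X \<subseteq> V" "Y \<subseteq> V"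
    note quasirandom[OF this]
    also have "\<eta> * (card V)\<^sup>2 \<le> \<eta>' * (card V)\<^sup>2" using assms(2) by (intro mult_right_mono) auto
    finally show "\<bar>\<Sum>x\<in>X. \<Sum>y\<in>Y. E True x y + E False x y - p\<bar> \<le> \<eta>' * (card V)\<^sup>2" .
  qed (fact fin ne k p0 \<zeta> p n E01 E_sym few)+
qed

text \<open>The quantitative form of \<open>(2 * k - 2) / 2 ^ k < 1\<close>: up to
  \<open>2 * k - 2\<close> excluded sets of proportion \<open>1 / 2 ^ k\<close> cover at most half
  of the vertices.\<close>

lemma four_mult_le_power2: "4 * (k - 1) \<le> (2::nat) ^ k"
proof (cases "k \<ge> 2")
  case True
  thus ?thesis
  proof (induction k rule: dec_induct)
    case (step m)
    have "(4::nat) \<le> 2 ^ m" using power_increasing[OF step(1), of "2::nat"] by simp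
    thus ?case using step by (simp add: algebra_simps)
  qed simp
qed (cases k; auto)


text \<open>\<open>C\<close> and \<open>\<eta>\<close> do not depend on the graph. A new weight
  forces the old ones to shrink by \<open>C1\<close>, so the induction hypothesis is taken with a
  smaller error; the densities of the old pairs are unaffected, since \<open>regular\<close> keeps
  \<open>d\<close>.\<close>

lemma exists_stage:
  fixes \<epsilon> :: real
  assumes k: "k \<ge> 1" and p0: "0 < p0" and \<zeta>: "0 < \<zeta>" "\<zeta> \<le> 1" and \<epsilon>: "\<epsilon> > 0" and t: "t \<le> 2 * k - 1"
  defines "\<delta> \<equiv> \<zeta> * p0 / (4 * real k)"
  shows "\<exists>C\<ge>1. \<exists>\<eta>>0. \<forall>(V :: 'a set) E p n. bookless k p0 \<zeta> \<eta> V E p n \<longrightarrow>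
           (\<exists>\<mu> c. bookless.stage V E t \<epsilon> C \<delta> \<mu> c)"
  using \<epsilon> t
proof (induction t arbitrary: \<epsilon>)
  case 0
  show ?case
  proof (intro exI conjI allI impI)
    fix V :: "'a set" and E p n assume "bookless k p0 \<zeta> 1 V E p n"
    then interpret bookless k p0 \<zeta> 1 V E p n .
    show "stage 0 \<epsilon> 1 \<delta> (\<lambda>_ _. 0) (\<lambda>_. True)" by (simp add: stage_def)
  qed auto
next
  case (Suc t)
  have \<delta>0: "\<delta> > 0" using k p0 \<zeta> by (simp add: \<delta>_def)
  obtain C1 where C1: "C1 \<ge> 1" and star: "\<forall>(V :: 'a set) E \<mu> \<nu> \<delta>.
     (\<forall>i<t. unit_kernel V (E i) \<and> prob_weight V (\<mu> i) \<and>
        (\<forall>y\<in>V. \<nu> y > 0 \<longrightarrow> (\<Sum>x\<in>V. \<mu> i x * E i x y) \<ge> \<delta> i)) \<longrightarrow> prob_weight V \<nu> \<longrightarrow>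
     (\<exists>\<mu>' \<nu>' d. prob_weight V \<nu>' \<and> (\<forall>x\<in>V. \<nu>' x \<le> C1 * \<nu> x) \<and>
        (\<forall>i<t. prob_weight V (\<mu>' i) \<and> (\<forall>x\<in>V. \<mu>' i x \<le> C1 * \<mu> i x) \<and>
           \<delta> i \<le> d i \<and> d i \<le> (1::real) \<and> regular V \<epsilon> (d i) (E i) (\<mu>' i) \<nu>'))"
    using exists_regular_star[OF Suc.prems(1), where 'a='a and t=t] by (elim exE conjE) (rule that)
  \<comment> \<open>Solves the smallness condition of \<open>few_low_other_degree\<close> with
    equality.\<close>
  define \<epsilon>0 where "\<epsilon>0 = \<zeta> / 2 * (p0 / 2) ^ k * \<delta> ^ k\<^sup>2 / (2 * k\<^sup>2)"
  have \<epsilon>0: "\<epsilon>0 > 0" using \<zeta> p0 \<delta>0 k by (simp add: \<epsilon>0_def)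
  define \<epsilon>' where "\<epsilon>' = min (\<epsilon> / C1\<^sup>2) \<epsilon>0"
  have \<epsilon>': "\<epsilon>' > 0" "\<epsilon>' \<le> \<epsilon>0" "\<epsilon>' \<le> \<epsilon> / C1\<^sup>2"
    using \<epsilon>0 Suc.prems C1 by (auto simp: \<epsilon>'_def)
  have small: "2 * k\<^sup>2 * \<epsilon>' / \<delta> ^ k\<^sup>2 \<le> \<zeta> / 2 * (p0 / 2) ^ k"
  proof -
    have "2 * k\<^sup>2 * \<epsilon>' / \<delta> ^ k\<^sup>2 \<le> 2 * k\<^sup>2 * \<epsilon>0 / \<delta> ^ k\<^sup>2"
      using \<epsilon>' \<delta>0 by (intro divide_right_mono mult_left_mono) auto
    also have "\<dots> = \<zeta> / 2 * (p0 / 2) ^ k" using \<delta>0 k by (simp add: \<epsilon>0_def)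
    finally show ?thesis .
  qed
  have C1\<epsilon>: "C1 * C1 * \<epsilon>' \<le> \<epsilon>"
    using \<epsilon>'(3) C1 by (simp add: pos_le_divide_eq power2_eq_square mult.commute)
  have "t \<le> 2 * k - 1" using Suc.prems by simp
  from Suc.IH[OF \<epsilon>'(1) this] obtain C2 \<eta>2 where C2: "C2 \<ge> 1" and \<eta>2: "\<eta>2 > 0" and
    IH: "\<forall>(V :: 'a set) E p n. bookless k p0 \<zeta> \<eta>2 V E p n \<longrightarrow>
           (\<exists>\<mu> c. bookless.stage V E t \<epsilon>' C2 \<delta> \<mu> c)" by (elim exE conjE) (rule that)
  \<comment> \<open>The other half is kept for passing from red to blue in case red is the sparse
    colour.\<close>
  have "\<epsilon>' / 2 > 0" using \<epsilon>' by simp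
  from exists_self_regular[OF this, where 'a='a]
  obtain C3 where C3: "C3 \<ge> 1" and self: "\<forall>(V :: 'a set) E \<nu>. unit_kernel V E \<longrightarrow>
     (\<forall>x\<in>V. \<forall>y\<in>V. E x y = E y x) \<longrightarrow> prob_weight V \<nu> \<longrightarrow>
     (\<exists>\<mu> d. prob_weight V \<mu> \<and> (\<forall>x\<in>V. \<mu> x \<le> C3 * \<nu> x) \<and>
        0 \<le> d \<and> d \<le> (1::real) \<and> regular V (\<epsilon>' / 2) d E \<mu> \<mu>)"
    by (elim exE conjE) (rule that)
  \<comment> \<open>The three bounds serve the induction hypothesis, a share
    \<open>1 / (8 * k)\<close> for the low-degree vertices of each weight, and the passage from red
    to blue.\<close>
  define \<eta> where "\<eta> = min \<eta>2 (min (\<delta> / (8 * k * C2)) (\<epsilon>' / (2 * (4 * C3)\<^sup>2)))"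
  have \<eta>: "\<eta> > 0" "\<eta> \<le> \<eta>2" "\<eta> \<le> \<delta> / (8 * k * C2)" "\<eta> \<le> \<epsilon>' / (2 * (4 * C3)\<^sup>2)"
    using \<eta>2 \<delta>0 k C2 \<epsilon>' C3 by (auto simp: \<eta>_def)
  define C where "C = C1 * max C2 (4 * C3)"
  have C: "C \<ge> 1" "C1 * C2 \<le> C" "C1 * (4 * C3) \<le> C"
  proof -
    show "C1 * C2 \<le> C" "C1 * (4 * C3) \<le> C"
      unfolding C_def using C1 by (intro mult_left_mono; simp)+
    moreover have "1 * 1 \<le> C1 * C2" using C1 C2 by (intro mult_mono) auto
    ultimately show "C \<ge> 1" by linarith
  qed
  have "\<exists>\<mu> c. bookless.stage V E (Suc t) \<epsilon> C \<delta> \<mu> c"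
    if bl: "bookless k p0 \<zeta> \<eta> V E p n" for V :: "'a set" and E p n
  proof -
    interpret bookless k p0 \<zeta> \<eta> V E p n by fact
    define N where "N = real (card V)"
    have N: "N > 0" using card_pos by (simp add: N_def)
    from IH bookless_mono[OF bl \<eta>(2)] obtain \<mu> c where st: "stage t \<epsilon>' C2 \<delta> \<mu> c" by blast
    define L where "L = (\<lambda>i. {u \<in> V. deg (\<not> c i) (\<mu> i) u < \<delta>})"
    have cardL: "card (L i) \<le> (1 / 2 ^ k + 1 / (8 * k)) * N" if i: "i < t" for i
    proof -
      from st i obtain d where d: "spread C2 (\<mu> i)" "\<delta> \<le> d" "d \<le> 1"
        "regular V \<epsilon>' d (E (c i)) (\<mu> i) (\<mu> i)" unfolding stage_def by blast
      have "card (L i) \<le> (1 / 2 ^ k + C2 * \<eta> / \<delta>) * N"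
        unfolding L_def N_def using d C2 \<epsilon>' small
        by (intro few_low_other_degree[where d = d and \<epsilon> = \<epsilon>']) (auto simp: \<delta>_def)
      also have "\<dots> \<le> (1 / 2 ^ k + 1 / (8 * k)) * N"
      proof (intro mult_right_mono add_left_mono)
        have "C2 * \<eta> \<le> C2 * (\<delta> / (8 * k * C2))" using \<eta> C2 by (intro mult_left_mono) auto
        also have "\<dots> = \<delta> / (8 * k)" using C2 by simp
        finally show "C2 * \<eta> / \<delta> \<le> 1 / (8 * k)" using \<delta>0 k by (simp add: field_simps)
      qed (use N in auto)
      finally show ?thesis .
    qed
    define U where "U = V - (\<Union>i<t. L i)"
    have finU: "finite U" using fin by (simp add: U_def)
    \<comment> \<open>With \<open>t \<le> 2 * k - 2\<close>, the terms \<open>1 / 2 ^ k\<close> sum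
      to at most \<open>1 / 2\<close> and the terms \<open>1 / (8 * k)\<close> to at most
      \<open>1 / 4\<close>.\<close>
    have cardU: "card U \<ge> N / 4"
    proof -
      have "real (card (\<Union>i<t. L i)) \<le> (\<Sum>i<t. real (card (L i)))"
        using card_UN_le[of "{..<t}" L] by (simp flip: of_nat_sum)
      also have "\<dots> \<le> (\<Sum>i<t. (1 / 2 ^ k + 1 / (8 * k)) * N)"
        using cardL by (intro sum_mono) auto
      also have "\<dots> = t * (1 / 2 ^ k + 1 / (8 * k)) * N" by simp
      also have "\<dots> \<le> 3 / 4 * N"
      proof (intro mult_right_mono)
        have t2: "real t \<le> 2 * (real k - 1)" proof -
          have "t + 2 \<le> 2 * k" using Suc.prems(2) k by linarith
          hence "real (t + 2) \<le> real (2 * k)" by (rule of_nat_mono)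
          thus ?thesis by simp
        qed
        have "real (4 * (k - 1)) \<le> real (2 ^ k)" using four_mult_le_power2[of k] by (rule of_nat_mono)
        hence "4 * (real k - 1) \<le> 2 ^ k" using k by (simp add: of_nat_diff)
        hence "real t / 2 ^ k \<le> 1 / 2" using t2 by (simp add: field_simps)
        moreover have "real t / (8 * k) \<le> 1 / 4" using t2 k by (simp add: field_simps)
        moreover have "real t * (1 / 2 ^ k + 1 / (8 * k)) = real t / 2 ^ k + real t / (8 * k)"
          by (simp add: distrib_left)
        ultimately show "real t * (1 / 2 ^ k + 1 / (8 * k)) \<le> 3 / 4" by linarith
      qed (use N in auto)
      finally have "real (card (\<Union>i<t. L i)) \<le> 3 / 4 * N" .
      moreover have "card V \<le> card U + card (\<Union>i<t. L i)"
      proof -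
        have "card V \<le> card (U \<union> (\<Union>i<t. L i))"
          using fin by (intro card_mono) (auto simp: U_def L_def)
        thus ?thesis using card_Un_le[of U "\<Union>i<t. L i"] by linarith
      qed
      ultimately show ?thesis unfolding N_def by linarith
    qed
    hence U0: "real (card U) > 0" using N by linarith
    define \<nu> where "\<nu> = (\<lambda>x. if x \<in> U then 1 / real (card U) else 0)"
    have UV: "U \<subseteq> V" by (auto simp: U_def)
    have "sum \<nu> V = sum \<nu> U" using fin UV by (intro sum.mono_neutral_right) (auto simp: \<nu>_def)
    also have "\<dots> = 1" using U0 by (simp add: \<nu>_def)
    finally have \<nu>: "prob_weight V \<nu>" by (auto simp: prob_weight_def \<nu>_def)
    have \<nu>_le: "\<nu> x \<le> 4 / N" for x
      using cardU U0 N by (auto simp: \<nu>_def field_simps)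
    have symT: "\<forall>x\<in>V. \<forall>y\<in>V. E True x y = E True y x" using E_sym by blast
    from self[rule_format, OF kernel_E symT[rule_format] \<nu>] obtain \<mu>0 d0 where
      \<mu>0: "prob_weight V \<mu>0" "\<forall>x\<in>V. \<mu>0 x \<le> C3 * \<nu> x" and
      d0: "0 \<le> d0" "d0 \<le> 1" "regular V (\<epsilon>' / 2) d0 (E True) \<mu>0 \<mu>0" by blast
    have \<mu>0_spread: "spread (4 * C3) \<mu>0"
      unfolding spread_def
    proof (intro conjI ballI \<mu>0(1))
      fix x assume "x \<in> V"
      hence "\<mu>0 x \<le> C3 * \<nu> x" using \<mu>0 by blast
      also have "\<dots> \<le> C3 * (4 / N)" using C3 \<nu>_le by (intro mult_left_mono) auto
      finally show "\<mu>0 x \<le> 4 * C3 / card V" by (simp add: N_def mult.commute)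
    qed
    have \<delta>_le: "\<delta> \<le> p / 2"
    proof -
      have "\<zeta> * p0 \<le> 1 * p" using \<zeta> p p0 by (intro mult_mono) auto
      moreover have "p * 2 \<le> p * (4 * real k)" using k p p0 by (intro mult_left_mono) auto
      ultimately show ?thesis using k by (simp add: \<delta>_def field_simps)
    qed
    \<comment> \<open>Regularity of red suffices for both colours: blue is the quasirandom graph
      minus red, hence regular with density \<open>p - d0\<close>, and \<open>d0\<close> or
      \<open>p - d0\<close> is at least \<open>p / 2\<close>.\<close>
    obtain c0 d' where d': "\<delta> \<le> d'" "d' \<le> 1" "regular V \<epsilon>' d' (E c0) \<mu>0 \<mu>0"
    proof (cases "d0 \<ge> p / 2")
      case True
      have "regular V \<epsilon>' d0 (E True) \<mu>0 \<mu>0" using d0(3) by (rule regular_mono) (use \<epsilon>' in simp)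
      thus ?thesis using that[of d0 True] True d0 \<delta>_le by simp
    next
      case False
      have "regular V (\<epsilon>' / 2 + (4 * C3)\<^sup>2 * \<eta>) (p - d0) (E False) \<mu>0 \<mu>0"
        using C3 by (intro regular_complement[OF d0(3) regular_G] \<mu>0_spread) (auto simp: G_def)
      moreover have "(4 * C3)\<^sup>2 * \<eta> \<le> \<epsilon>' / 2"
        using \<eta>(4) C3 by (simp add: pos_le_divide_eq field_simps)
      ultimately have "regular V \<epsilon>' (p - d0) (E False) \<mu>0 \<mu>0"
        by (elim regular_mono) simp
      thus ?thesis using that[of "p - d0" False] False d0 \<delta>_le p by simp
    qed
    \<comment> \<open>The new weight is dominated by a multiple of \<open>\<nu>\<close> and so lives
      on \<open>U\<close>, where all degrees in the opposite colours are at least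
      \<open>\<delta>\<close>.\<close>
    have "\<forall>i<t. unit_kernel V (E (\<not> c i)) \<and> prob_weight V (\<mu> i) \<and>
        (\<forall>y\<in>V. \<mu>0 y > 0 \<longrightarrow> (\<Sum>x\<in>V. \<mu> i x * E (\<not> c i) x y) \<ge> \<delta>)"
    proof (intro allI impI conjI ballI kernel_E)
      fix i assume i: "i < t"
      show "prob_weight V (\<mu> i)" using st i by (auto simp: stage_def spread_def)
      fix y assume y: "y \<in> V" "\<mu>0 y > 0"
      have "y \<in> U"
      proof (rule ccontr)
        assume "y \<notin> U"
        thus False using \<mu>0(2) y by (auto simp: \<nu>_def)
      qed
      hence "y \<notin> L i" using i by (auto simp: U_def)
      thus "\<delta> \<le> (\<Sum>x\<in>V. \<mu> i x * E (\<not> c i) x y)" using y by (auto simp: L_def deg_def)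
    qed
    from star[THEN spec[of _ V], THEN spec[of _ "\<lambda>i. E (\<not> c i)"], THEN spec[of _ \<mu>], THEN spec[of _ \<mu>0],
        THEN spec[of _ "\<lambda>_. \<delta>"], THEN mp, OF this, THEN mp, OF \<mu>0(1)]
    obtain \<mu>' \<nu>' d where new: "prob_weight V \<nu>'" "\<forall>x\<in>V. \<nu>' x \<le> C1 * \<mu>0 x"
      "\<forall>i<t. prob_weight V (\<mu>' i) \<and> (\<forall>x\<in>V. \<mu>' i x \<le> C1 * \<mu> i x) \<and>
           \<delta> \<le> d i \<and> d i \<le> 1 \<and> regular V \<epsilon> (d i) (E (\<not> c i)) (\<mu>' i) \<nu>'" by blast
    have her: "regular V \<epsilon> e F \<alpha>' \<beta>'"
      if "regular V \<epsilon>' e F \<alpha> \<beta>" "\<forall>x\<in>V. \<alpha>' x \<le> C1 * \<alpha> x" "\<forall>x\<in>V. \<beta>' x \<le> C1 * \<beta> x" for e F \<alpha> \<beta> \<alpha>' \<beta>'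
    proof -
      have "regular V (C1 * C1 * \<epsilon>') e F \<alpha>' \<beta>'"
        using C1 that by (intro regular_subweight[where \<mu> = \<alpha> and \<nu> = \<beta>]) auto
      thus ?thesis using C1\<epsilon> by (rule regular_mono)
    qed
    have spr: "spread C \<alpha>'"
      if "prob_weight V \<alpha>'" "spread B \<alpha>" "\<forall>x\<in>V. \<alpha>' x \<le> C1 * \<alpha> x" "C1 * B \<le> C" for B \<alpha> \<alpha>'
      unfolding spread_def
    proof (intro conjI ballI that(1))
      fix x assume x: "x \<in> V"
      have "\<alpha>' x \<le> C1 * \<alpha> x" using that x by blast
      also have "\<dots> \<le> C1 * (B / card V)" using that x C1 by (intro mult_left_mono) (auto simp: spread_def)
      also have "\<dots> \<le> C / card V" using that(4) by (simp add: divide_right_mono)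
      finally show "\<alpha>' x \<le> C / card V" .
    qed
    have "stage (Suc t) \<epsilon> C \<delta> (\<mu>'(t := \<nu>')) (c(t := c0))"
      unfolding stage_def
    proof (intro conjI allI impI)
      fix i assume i: "i < Suc t"
      show "spread C ((\<mu>'(t := \<nu>')) i)"
      proof (cases "i = t")
        case True
        thus ?thesis using spr[OF new(1) \<mu>0_spread new(2) C(3)] by simp
      next
        case False
        hence "i < t" using i by simp
        thus ?thesis using spr[of "\<mu>' i" C2 "\<mu> i"] new(3) C(2) st by (simp add: stage_def)
      qed
      show "\<exists>d\<ge>\<delta>. d \<le> 1 \<and> regular V \<epsilon> d (E ((c(t := c0)) i)) ((\<mu>'(t := \<nu>')) i) ((\<mu>'(t := \<nu>')) i)"
      proof (cases "i = t")
        case True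
        thus ?thesis using her[OF d'(3) new(2) new(2)] d' by auto
      next
        case False
        hence it: "i < t" using i by simp
        then obtain e where e: "\<delta> \<le> e" "e \<le> 1" "regular V \<epsilon>' e (E (c i)) (\<mu> i) (\<mu> i)"
          using st unfolding stage_def by blast
        have "\<forall>x\<in>V. \<mu>' i x \<le> C1 * \<mu> i x" using new(3) it by blast
        from her[OF e(3) this this] show ?thesis using e False by auto
      qed
    next
      fix i j assume ij: "j < Suc t" "i < j"
      show "\<exists>d\<ge>\<delta>. d \<le> 1 \<and> regular V \<epsilon> d (E (\<not> (c(t := c0)) i)) ((\<mu>'(t := \<nu>')) i) ((\<mu>'(t := \<nu>')) j)"
      proof (cases "j = t")
        case True
        thus ?thesis using new(3) ij by auto
      next
        case False
        hence it: "j < t" "i < t" using ij by simp_all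
        then obtain e where e: "\<delta> \<le> e" "e \<le> 1" "regular V \<epsilon>' e (E (\<not> c i)) (\<mu> i) (\<mu> j)"
          using st ij(2) unfolding stage_def by blast
        have "\<forall>x\<in>V. \<mu>' i x \<le> C1 * \<mu> i x" "\<forall>x\<in>V. \<mu>' j x \<le> C1 * \<mu> j x" using new(3) it by blast+
        from her[OF e(3) this] show ?thesis using e False it by auto
      qed
    qed
    thus ?thesis by blast
  qed
  thus ?case using C(1) \<eta>(1) by blast
qed

section \<open>The contradiction from \<open>2 * k - 1\<close> weights\<close>

lemma exists_strict_mono_selection:
  assumes "finite (S :: nat set)" "k \<le> card S"
  shows "\<exists>g. (\<forall>i<k. g i \<in> S) \<and> (\<forall>j<k. \<forall>i<j. g i < g j)"
proof -
  obtain T where T: "T \<subseteq> S" "card T = k" using assms(2) by (meson obtain_subset_with_card_n)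
  have fT: "finite T" using T assms finite_subset by blast
  define g where "g = (!) (sorted_list_of_set T)"
  have "g i \<in> S" if "i < k" for i
    using that T fT nth_mem[of i "sorted_list_of_set T"] by (auto simp: g_def)
  moreover have "g i < g j" if "j < k" "i < j" for i j
    using that T fT sorted_wrt_nth_less[OF strict_sorted_list_of_set[of T], of i j]
    by (simp add: g_def)
  ultimately show ?thesis by blast
qed

theorem quasirandom_not_bookless:
  assumes k: "k \<ge> 1" and p0: "0 < p0" and \<zeta>: "0 < \<zeta>" "\<zeta> \<le> (1::real)"
  shows "\<exists>\<eta>>0. \<forall>(V :: 'a set) E p n. \<not> bookless k p0 \<zeta> \<eta> V E p n"
proof -
  define \<delta> where "\<delta> = \<zeta> * p0 / (4 * real k)"
  have \<delta>0: "\<delta> > 0" using k p0 \<zeta> by (simp add: \<delta>_def)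
  \<comment> \<open>Chosen so that the counting error \<open>\<xi>\<close> is
    \<open>\<zeta> / 4 * (p0 / 2) ^ k\<close>.\<close>
  define \<epsilon> where "\<epsilon> = \<zeta> / 4 * (p0 / 2) ^ k * \<delta> ^ k\<^sup>2 / (2 * k\<^sup>2)"
  have \<epsilon>: "\<epsilon> > 0" using \<zeta> p0 \<delta>0 k by (simp add: \<epsilon>_def)
  define \<xi> where "\<xi> = 2 * k\<^sup>2 * \<epsilon> / \<delta> ^ k\<^sup>2"
  have \<xi>: "\<xi> = \<zeta> / 4 * (p0 / 2) ^ k" using \<delta>0 k by (simp add: \<epsilon>_def \<xi>_def)
  from exists_stage[OF k p0 \<zeta> \<epsilon> order.refl, where 'a='a, folded \<delta>_def]
  obtain C \<eta>1 where C: "C \<ge> 1" and \<eta>1: "\<eta>1 > 0" and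
    st: "\<forall>(V :: 'a set) E p n. bookless k p0 \<zeta> \<eta>1 V E p n \<longrightarrow>
           (\<exists>\<mu> c. bookless.stage V E (2 * k - 1) \<epsilon> C \<delta> \<mu> c)"
    by (elim exE conjE) (rule that)
  \<comment> \<open>The second bound keeps the vertices of low total degree to any of the
    \<open>k\<close> selected weights below a proportion \<open>\<zeta> / 4\<close>.\<close>
  define \<eta> where "\<eta> = min \<eta>1 (\<delta> * \<zeta> / (4 * k * C))"
  have \<eta>: "\<eta> > 0" "\<eta> \<le> \<eta>1" "\<eta> \<le> \<delta> * \<zeta> / (4 * k * C)" using \<eta>1 \<delta>0 \<zeta> k C by (auto simp: \<eta>_def)
  have "\<not> bookless k p0 \<zeta> \<eta> V E p n" for V :: "'a set" and E p n
  proof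
    assume bl: "bookless k p0 \<zeta> \<eta> V E p n"
    interpret bookless k p0 \<zeta> \<eta> V E p n by fact
    define N where "N = real (card V)"
    have N: "N > 0" using card_pos by (simp add: N_def)
    from st bookless_mono[OF bl \<eta>(2)] obtain \<mu> c where stage: "stage (2 * k - 1) \<epsilon> C \<delta> \<mu> c" by blast
    define S where "S = (\<lambda>\<kappa>. {i. i < 2 * k - 1 \<and> c i = \<kappa>})"
    have "card (S True \<union> S False) = card (S True) + card (S False)"
      by (intro card_Un_disjoint) (auto simp: S_def)
    moreover have "S True \<union> S False = {..<2 * k - 1}" by (auto simp: S_def)
    ultimately have "card (S True) + card (S False) = 2 * k - 1" by simp
    hence "k \<le> card (S True) \<or> k \<le> card (S False)" by linarith
    then obtain \<kappa> where \<kappa>: "k \<le> card (S \<kappa>)" by blast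
    have "finite (S \<kappa>)" by (auto simp: S_def)
    from exists_strict_mono_selection[OF this \<kappa>] obtain g where
      "\<forall>i<k. g i \<in> S \<kappa>" "\<forall>j<k. \<forall>i<j. g i < g j" by (elim exE conjE) (rule that)
    hence g: "g i \<in> S \<kappa>" "i < j \<Longrightarrow> j < k \<Longrightarrow> g i < g j" if "i < k" for i j
      using that by simp_all
    have gi: "g i < 2 * k - 1" "c (g i) = \<kappa>" if "i < k" for i using g(1)[OF that] by (auto simp: S_def)
    define m where "m = (\<lambda>i. \<mu> (g i))"
    have spread: "spread C (m i)" if "i < k" for i
      using stage gi[OF that] by (auto simp: stage_def m_def)
    hence pw: "prob_weight V (m i)" if "i < k" for i using that by (simp add: spread_def)
    have inner: "(\<Sum>u\<in>V. deg \<kappa> (m i) u ^ k) \<le> n + \<xi> * N" if i: "i < k" for i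
    proof -
      from stage gi[OF i] obtain d where "\<delta> \<le> d" "d \<le> 1" "regular V \<epsilon> d (E \<kappa>) (m i) (m i)"
        unfolding stage_def m_def by blast
      thus ?thesis unfolding \<xi>_def N_def using pw[OF i] \<epsilon> \<delta>0 by (intro sum_power_deg_le) auto
    qed
    have \<delta>_le: "\<delta> \<le> 1"
    proof -
      have "\<zeta> * p0 \<le> 1 * 1" using \<zeta> p p0 by (intro mult_mono) auto
      thus ?thesis using k by (simp add: \<delta>_def field_simps)
    qed
    \<comment> \<open>The selection \<open>g\<close> is increasing because the pair clause of
      \<open>stage\<close> looks at the colour of the earlier index.\<close>
    have outer: "(\<Sum>u\<in>V. \<Prod>i<k. deg (\<not> \<kappa>) (m i) u) \<le> n + \<xi> * N"
      unfolding \<xi>_def N_def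
    proof (intro sum_prod_deg_le pw)
      fix i j assume ij: "i < j" "j < k"
      hence "i < k" by simp
      thus "\<exists>d\<ge>\<delta>. d \<le> 1 \<and> regular V \<epsilon> d (E (\<not> \<kappa>)) (m i) (m j)"
        using stage gi(2)[of i] gi(1)[of j] g(2)[OF _ ij] ij(2) unfolding stage_def m_def by blast
    qed (use \<epsilon> \<delta>0 \<delta>_le in auto)
    define Z where "Z = (\<lambda>i. {u \<in> V. deg True (m i) u + deg False (m i) u < p - \<delta>})"
    define W where "W = V - (\<Union>i<k. Z i)"
    have WV: "W \<subseteq> V" by (auto simp: W_def)
    have cardW: "(1 - \<zeta> / 4) * N \<le> card W"
    proof -
      have "card (Z i) \<le> \<zeta> / (4 * k) * N" if "i < k" for i
      proof -
        have "card (Z i) \<le> C * \<eta> / \<delta> * N"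
          unfolding Z_def N_def using C \<delta>0 spread[OF that] by (intro few_low_degree) auto
        also have "\<dots> \<le> \<zeta> / (4 * k) * N"
        proof (intro mult_right_mono)
          have "C * \<eta> \<le> C * (\<delta> * \<zeta> / (4 * k * C))" using \<eta> C by (intro mult_left_mono) auto
          also have "\<dots> = \<zeta> / (4 * k) * \<delta>" using C by simp
          finally show "C * \<eta> / \<delta> \<le> \<zeta> / (4 * k)" using \<delta>0 by (simp add: pos_divide_le_eq)
        qed (use N in auto)
        finally show ?thesis .
      qed
      hence "(\<Sum>i<k. real (card (Z i))) \<le> (\<Sum>i<k. \<zeta> / (4 * k) * N)" by (intro sum_mono) auto
      also have "\<dots> = \<zeta> / 4 * N" using k by simp
      finally have "real (card (\<Union>i<k. Z i)) \<le> \<zeta> / 4 * N"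
        using card_UN_le[of "{..<k}" Z] by (simp flip: of_nat_sum)
      moreover have "card V \<le> card W + card (\<Union>i<k. Z i)"
      proof -
        have "card V \<le> card (W \<union> (\<Union>i<k. Z i))"
          using fin by (intro card_mono) (auto simp: W_def Z_def)
        thus ?thesis using card_Un_le[of W "\<Union>i<k. Z i"] by linarith
      qed
      ultimately show ?thesis unfolding N_def by (simp add: algebra_simps)
    qed
    \<comment> \<open>The cliques across the weights and the mean over those inside a weight each
      contribute about \<open>n\<close> at most, so \<open>h\<close> sums to about
      \<open>2 * n\<close> at most. On \<open>W\<close> the product inequality keeps
      \<open>h\<close> above nearly \<open>2 * A\<close>.\<close>
    define h where "h = (\<lambda>u. (\<Prod>i<k. deg (\<not> \<kappa>) (m i) u) + (\<Sum>i<k. deg \<kappa> (m i) u ^ k) / k)"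
    have deg0: "0 \<le> deg a (m i) u" if "i < k" for a i u using deg_nonneg[OF pw[OF that]] .
    have h0: "0 \<le> h u" for u
      unfolding h_def
      by (auto intro!: add_nonneg_nonneg prod_nonneg divide_nonneg_nonneg sum_nonneg zero_le_power deg0)
    have pp: "p > 0" using p p0 by linarith
    have q: "p * (1 - \<zeta> / (4 * k)) \<le> p - \<delta>"
      using p(1) \<zeta> k by (simp add: \<delta>_def field_simps)
    have z: "\<zeta> / (4 * k) \<le> 1" using \<zeta> k by (simp add: field_simps)
    have q0: "0 \<le> p * (1 - \<zeta> / (4 * k))" using z pp by simp
    have "1 + real k * (- (\<zeta> / (4 * k))) \<le> (1 + - (\<zeta> / (4 * k))) ^ k"
      using z by (intro Bernoulli_inequality) linarith
    hence bern: "1 - \<zeta> / 4 \<le> (1 - \<zeta> / (4 * k)) ^ k" using k by simp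
    define A where "A = (p / 2) ^ k"
    have A: "A > 0" using pp by (simp add: A_def)
    have hW: "2 * (A * (1 - \<zeta> / 4)) \<le> h u" if u: "u \<in> W" for u
    proof -
      have "A * (1 - \<zeta> / 4) \<le> A * (1 - \<zeta> / (4 * k)) ^ k"
        using bern A by (intro mult_left_mono) auto
      also have "\<dots> = (p * (1 - \<zeta> / (4 * k)) / 2) ^ k"
        by (simp add: A_def power_mult_distrib power_divide)
      also have "\<dots> \<le> ((p - \<delta>) / 2) ^ k" using q q0 by (intro power_mono divide_right_mono) auto
      finally have "2 * (A * (1 - \<zeta> / 4)) \<le> 2 * ((p - \<delta>) / 2) ^ k" by simp
      also have "\<dots> \<le> h u"
        unfolding h_def
      proof (intro mixed_product_bound k deg_nonneg pw)
        fix i assume i: "i < k"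
        have "u \<notin> Z i" "u \<in> V" using u i by (auto simp: W_def)
        thus "p - \<delta> \<le> deg \<kappa> (m i) u + deg (\<not> \<kappa>) (m i) u" by (cases \<kappa>) (auto simp: Z_def)
      qed (use q q0 in linarith)
      finally show ?thesis .
    qed
    have "card W * (2 * (A * (1 - \<zeta> / 4))) \<le> sum h W"
      using sum_mono[of W "\<lambda>_. 2 * (A * (1 - \<zeta> / 4))" h] hW by simp
    also have "\<dots> \<le> sum h V" using fin WV h0 by (intro sum_mono2) auto
    also have "\<dots> = (\<Sum>u\<in>V. \<Prod>i<k. deg (\<not> \<kappa>) (m i) u) + (\<Sum>i<k. \<Sum>u\<in>V. deg \<kappa> (m i) u ^ k) / k"
      unfolding h_def sum.distrib sum_divide_distrib[symmetric] by (subst (2) sum.swap) simp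
    also have "\<dots> \<le> (n + \<xi> * N) + (\<Sum>i<k. n + \<xi> * N) / k"
      using inner by (intro add_mono outer divide_right_mono sum_mono) auto
    also have "\<dots> = 2 * (n + \<xi> * N)" using k by simp
    also have "\<dots> \<le> 2 * ((1 - \<zeta>) * A * N + \<zeta> / 4 * A * N)"
    proof (intro mult_left_mono add_mono mult_right_mono)
      show "\<xi> \<le> \<zeta> / 4 * A"
        unfolding \<xi> A_def using p p0 \<zeta> by (intro mult_left_mono power_mono) auto
    qed (use n N in \<open>auto simp: A_def N_def\<close>)
    also have "\<dots> = 2 * (A * N) * (1 - 3 * \<zeta> / 4)" by (simp add: algebra_simps)
    finally have up: "card W * (2 * (A * (1 - \<zeta> / 4))) \<le> 2 * (A * N) * (1 - 3 * \<zeta> / 4)" .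
    have "(1 - \<zeta> / 4) * N * (2 * (A * (1 - \<zeta> / 4))) \<le> card W * (2 * (A * (1 - \<zeta> / 4)))"
      using cardW A \<zeta> by (intro mult_right_mono) auto
    moreover have "(1 - \<zeta> / 4) * N * (2 * (A * (1 - \<zeta> / 4))) = 2 * (A * N) * (1 - \<zeta> / 4)\<^sup>2"
      by (simp only: power2_eq_square mult_ac)
    ultimately have "2 * (A * N) * (1 - \<zeta> / 4)\<^sup>2 \<le> 2 * (A * N) * (1 - 3 * \<zeta> / 4)"
      using up by linarith
    moreover have "2 * (A * N) > 0" using A N by simp
    \<comment> \<open>On the left one factor is lost by discarding the vertices outside
      \<open>W\<close> and one by replacing \<open>p\<close> with \<open>p - \<delta>\<close>. On
      the right stands the gap \<open>\<zeta>\<close> reduced by the counting error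
      \<open>\<zeta> / 4\<close>.\<close>
    ultimately have "(1 - \<zeta> / 4)\<^sup>2 \<le> 1 - 3 * \<zeta> / 4"
      by (rule mult_left_le_imp_le)
    hence "\<zeta> / 4 + \<zeta>\<^sup>2 / 16 \<le> 0" by (simp add: power2_eq_square algebra_simps)
    moreover have "\<zeta>\<^sup>2 \<ge> 0" by simp
    ultimately show False using \<zeta> by linarith
  qed
  thus ?thesis using \<eta>(1) by blast
qed

section \<open>Random graphs\<close>

text \<open>Edges are two-element sets, so adjacency alone makes the spine vertices distinct from
  each other and from the pages.\<close>

lemma contains_book_if_many_common_neighbours:
  assumes A: "A \<subseteq> nsets V 2" and v: "\<And>i. i < k \<Longrightarrow> v i \<in> V"
    and clique: "\<And>i j. i < j \<Longrightarrow> j < k \<Longrightarrow> {v i, v j} \<in> A"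
    and many: "n \<le> card {u \<in> V. \<forall>i<k. {v i, u} \<in> A}"
  shows "contains_copy (V, A) (book k n)"
proof -
  obtain W where W: "W \<subseteq> {u \<in> V. \<forall>i<k. {v i, u} \<in> A}" "card W = n" "finite W"
    using many by (meson obtain_subset_with_card_n)
  obtain h where h: "bij_betw h {..<n} W"
    using W finite_same_card_bij[of "{..<n}" W] by auto
  have hW: "h j \<in> V" "i < k \<Longrightarrow> {v i, h j} \<in> A" if "j < n" for i j
    using bij_betwE[OF h] W(1) that by auto
  have neq: "x \<noteq> y" if "{x, y} \<in> A" for x y
    using subsetD[OF A that] by simp
  define f where "f = (\<lambda>i. if i < k then v i else h (i - k))"
  have edge: "{f a, f b} \<in> A" if "a < b" "b < k + n" "a < k" for a b
    using that clique[of a b] hW(2)[of "b - k" a] by (auto simp: f_def)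
  have f_neq: "f a \<noteq> f b" if "a < b" "b < k + n" for a b
  proof (cases "a < k")
    case True
    thus ?thesis using neq[OF edge[OF that]] by blast
  next
    case False
    hence "a - k \<noteq> b - k" "a - k < n" "b - k < n" using that by auto
    hence "h (a - k) \<noteq> h (b - k)" using h by (auto simp: bij_betw_def inj_on_def)
    thus ?thesis using False that by (simp add: f_def)
  qed
  have "inj_on f {..<k + n}"
    by (rule inj_onI) (metis f_neq lessThan_iff linorder_neqE_nat)
  moreover have "f ` {..<k + n} \<subseteq> V" using v hW(1) by (auto simp: f_def)
  moreover have "f ` e \<in> A" if e: "i < n" "e \<in> nsets (insert (k + i) {..<k}) 2" for i e
  proof -
    obtain a b where ab: "e = {a, b}" "a \<in> insert (k + i) {..<k}" "b \<in> insert (k + i) {..<k}" "a < b"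
    proof -
      obtain a b where ab: "e = {a, b}" "a \<in> insert (k + i) {..<k}" "b \<in> insert (k + i) {..<k}" "a \<noteq> b"
        using e(2) by (rule nsets2_E)
      show ?thesis
      proof (cases "a < b")
        case True
        thus ?thesis using that[OF ab(1-3)] by simp
      next
        case False
        thus ?thesis using that[of b a] ab by (simp add: insert_commute)
      qed
    qed
    hence "{f a, f b} \<in> A" using \<open>i < n\<close> by (intro edge) auto
    thus ?thesis using ab by simp
  qed
  ultimately show ?thesis unfolding contains_copy_def book_def by (intro exI[of _ f]) auto
qed

text \<open>Of the book only the edges between spine and pages are kept. Those of different pages
  are disjoint, which gives independence in the random graph.\<close>

lemma many_common_neighbours_if_contains_book:
  assumes "contains_copy (V, A) (book k n)" "finite V"
  shows "\<exists>v. inj_on v {..<k} \<and> v ` {..<k} \<subseteq> V \<and> n \<le> card {u \<in> V. \<forall>i<k. {v i, u} \<in> A}"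
proof -
  from assms(1) obtain f where f: "inj_on f {..<k + n}" "f ` {..<k + n} \<subseteq> V"
     "\<And>e i. i < n \<Longrightarrow> e \<in> nsets (insert (k + i) {..<k}) 2 \<Longrightarrow> f ` e \<in> A"
    unfolding contains_copy_def book_def by auto
  have "f ` {k..<k + n} \<subseteq> {u \<in> V. \<forall>i<k. {f i, u} \<in> A}"
  proof
    fix u assume "u \<in> f ` {k..<k + n}"
    then obtain j where j: "u = f (k + j)" "j < n" by (auto simp: nat_le_iff_add)
    have "f ` {i, k + j} \<in> A" if "i < k" for i
      using f(3)[OF j(2), of "{i, k + j}"] that by auto
    thus "u \<in> {u \<in> V. \<forall>i<k. {f i, u} \<in> A}" using j f(2) by auto
  qed
  hence "card (f ` {k..<k + n}) \<le> card {u \<in> V. \<forall>i<k. {f i, u} \<in> A}"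
    using assms(2) by (intro card_mono) auto
  moreover have "card (f ` {k..<k + n}) = n"
    by (subst card_image) (auto intro: inj_on_subset[OF f(1)])
  ultimately show ?thesis using f(1,2)
    by (intro exI[of _ f]) (auto intro: inj_on_subset)
qed

section \<open>Discrepancy of \<open>G(N, p)\<close>\<close>

abbreviation random_edges :: "nat \<Rightarrow> real \<Rightarrow> (nat set \<Rightarrow> bool) pmf" where
  "random_edges N p \<equiv> Pi_pmf (nsets {..<N} 2) False (\<lambda>_. bernoulli_pmf p)"

lemma finite_pairs: "finite (nsets {..<N::nat} 2)"
  by (rule finite_imp_finite_nsets) simp

lemma card_pairs_le: "card (nsets {..<N::nat} 2) \<le> N\<^sup>2"
  using binomial_le_pow[of 2 N] by (cases "2 \<le> N") (auto simp: binomial_eq_0)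

text \<open>Sums over ordered pairs from \<open>X\<close> and \<open>Y\<close> meet an edge twice if
  both orientations occur. With this coefficient the discrepancy is a weighted sum of independent
  edge indicators.\<close>

definition multiplicity_pair :: "nat set \<Rightarrow> nat set \<Rightarrow> nat set \<Rightarrow> real" where
  "multiplicity_pair X Y e = (\<Sum>x\<in>X. \<Sum>y\<in>Y. of_bool ({x, y} = e))"

lemma multiplicity_pair_bounds:
  assumes "finite X" "finite Y" "e \<in> nsets S 2"
  shows "0 \<le> multiplicity_pair X Y e" "multiplicity_pair X Y e \<le> 2"
proof -
  show "0 \<le> multiplicity_pair X Y e" by (auto simp: multiplicity_pair_def intro!: sum_nonneg)
  obtain a b where e: "e = {a, b}" using assms(3) by (auto elim: nsets2_E)
  have "multiplicity_pair X Y e = (\<Sum>z\<in>X \<times> Y. of_bool ({fst z, snd z} = e))"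
    by (simp add: multiplicity_pair_def sum.cartesian_product case_prod_unfold)
  also have "\<dots> = card {z \<in> X \<times> Y. {fst z, snd z} = e}"
    using assms by (simp add: of_bool_def sum.If_cases Int_def)
  finally have "multiplicity_pair X Y e = card {z \<in> X \<times> Y. {fst z, snd z} = e}" .
  moreover have "card {z \<in> X \<times> Y. {fst z, snd z} = e} \<le> card {(a, b), (b, a)}"
    by (intro card_mono) (auto simp: e doubleton_eq_iff)
  moreover have "card {(a, b), (b, a)} \<le> 2" by (cases "a = b") auto
  ultimately show "multiplicity_pair X Y e \<le> 2" by linarith
qed

lemma sum_over_pairs:
  fixes g :: "nat set \<Rightarrow> real"
  assumes "X \<subseteq> {..<N}" "Y \<subseteq> {..<N}"
  shows "(\<Sum>x\<in>X. \<Sum>y\<in>Y. of_bool (x \<noteq> y) * g {x, y}) =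
     (\<Sum>e\<in>nsets {..<N} 2. multiplicity_pair X Y e * g e)"
proof -
  have "(\<Sum>e\<in>nsets {..<N} 2. multiplicity_pair X Y e * g e) =
      (\<Sum>x\<in>X. \<Sum>y\<in>Y. \<Sum>e\<in>nsets {..<N} 2. of_bool ({x, y} = e) * g e)"
    unfolding multiplicity_pair_def sum_distrib_right
    by (subst sum.swap) (intro sum.cong refl, subst sum.swap, simp)
  also have "\<dots> = (\<Sum>x\<in>X. \<Sum>y\<in>Y. of_bool (x \<noteq> y) * g {x, y})"
  proof (intro sum.cong refl)
    fix x y assume "x \<in> X" "y \<in> Y"
    hence "x < N" "y < N" using assms by auto
    have "(\<Sum>e\<in>nsets {..<N} 2. of_bool ({x, y} = e) * g e) =
        (\<Sum>e\<in>nsets {..<N} 2. if {x, y} = e then g e else 0)"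
      by (intro sum.cong) auto
    also have "\<dots> = (if {x, y} \<in> nsets {..<N} 2 then g {x, y} else 0)"
      using finite_pairs by (rule sum.delta')
    also have "\<dots> = of_bool (x \<noteq> y) * g {x, y}" using \<open>x < N\<close> \<open>y < N\<close> by auto
    finally show "(\<Sum>e\<in>nsets {..<N} 2. of_bool ({x, y} = e) * g e) = of_bool (x \<noteq> y) * g {x, y}" .
  qed
  finally show ?thesis by simp
qed

lemma prob_discrepancy_le:
  assumes p: "0 \<le> p" "p \<le> 1" and N: "N \<ge> 2" and \<epsilon>: "\<epsilon> \<ge> 0"
    and XY: "X \<subseteq> {..<N}" "Y \<subseteq> {..<N}"
  shows "measure_pmf.prob (random_edges N p)
     {f. \<bar>\<Sum>x\<in>X. \<Sum>y\<in>Y. of_bool (x \<noteq> y) * (of_bool (f {x, y}) - p)\<bar> \<ge> \<epsilon> * (real N)\<^sup>2}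
     \<le> 2 * exp (- (\<epsilon>\<^sup>2 / 2) * (real N)\<^sup>2)"
proof -
  define S where "S = nsets {..<N} 2"
  have finS: "finite S" unfolding S_def by (rule finite_pairs)
  have "{0, 1} \<in> S" using N by (simp add: S_def)
  hence cS: "card S > 0" using finS by (auto simp: card_gt_0_iff)
  define m where "m = multiplicity_pair X Y"
  have finXY: "finite X" "finite Y" using XY finite_subset by auto
  have m: "0 \<le> m e" "m e \<le> 2" if "e \<in> S" for e
    using multiplicity_pair_bounds[OF finXY, of e] that by (auto simp: m_def S_def)
  interpret H: Hoeffding_ineq "measure_pmf (random_edges N p)" S "\<lambda>e f. m e * of_bool (f e)"
    "\<lambda>_. 0" "\<lambda>_. 2" "\<Sum>e\<in>S. measure_pmf.expectation (random_edges N p) (\<lambda>f. m e * of_bool (f e))"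
  proof unfold_locales
    show "finite S" by (rule finS)
    show "prob_space.indep_vars (measure_pmf (random_edges N p)) (\<lambda>_. borel) (\<lambda>e f. m e * of_bool (f e)) S"
      by (rule prob_space.indep_vars_compose2[OF measure_pmf.prob_space_axioms,
            where X = "\<lambda>e f. f e" and Y = "\<lambda>e b. m e * of_bool b" and M' = "\<lambda>_. count_space UNIV"])
         (auto simp: S_def intro: indep_vars_Pi_pmf finite_pairs)
    show "AE f in measure_pmf (random_edges N p). m e * of_bool (f e) \<in> {0..2}" if "e \<in> S" for e
      using m[OF that] by (intro AE_pmfI) auto
  qed simp
  have E: "measure_pmf.expectation (random_edges N p) (\<lambda>f. m e * of_bool (f e)) = m e * p" if "e \<in> S" for e
  proof -
    have "map_pmf (\<lambda>f. f e) (random_edges N p) = bernoulli_pmf p"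
      using that finS by (simp add: Pi_pmf_component S_def)
    hence "measure_pmf.expectation (random_edges N p) (\<lambda>f. of_bool (f e)) =
        measure_pmf.expectation (bernoulli_pmf p) (\<lambda>b. of_bool b :: real)"
      by (metis (mono_tags) integral_map_pmf)
    also have "\<dots> = p" using p by simp
    finally show ?thesis by simp
  qed
  have Esum: "(\<Sum>e\<in>S. measure_pmf.expectation (random_edges N p) (\<lambda>f. m e * of_bool (f e))) =
      (\<Sum>e\<in>S. m e * p)"
    by (intro sum.cong refl E)
  have eq: "(\<Sum>x\<in>X. \<Sum>y\<in>Y. of_bool (x \<noteq> y) * (of_bool (f {x, y}) - p)) =
      (\<Sum>e\<in>S. m e * of_bool (f e)) - (\<Sum>e\<in>S. m e * p)" for f
    using sum_over_pairs[OF XY, of "\<lambda>e. of_bool (f e) - p"]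
    by (simp add: S_def m_def right_diff_distrib sum_subtractf)
  have pos: "0 < (\<Sum>e\<in>S. (2 - 0 :: real)\<^sup>2)" using cS by simp
  have "measure_pmf.prob (random_edges N p) {f. \<bar>(\<Sum>e\<in>S. m e * of_bool (f e)) -
      (\<Sum>e\<in>S. m e * p)\<bar> \<ge> \<epsilon> * (real N)\<^sup>2} \<le> 2 * exp (- 2 * (\<epsilon> * (real N)\<^sup>2)\<^sup>2 / (\<Sum>e\<in>S. (2 - 0)\<^sup>2))"
    using H.Hoeffding_ineq_abs_ge[OF _ pos, of "\<epsilon> * (real N)\<^sup>2", unfolded Esum] \<epsilon> by simp
  also have "\<dots> \<le> 2 * exp (- (\<epsilon>\<^sup>2 / 2) * (real N)\<^sup>2)"
  proof -
    \<comment> \<open>All ranges have length 2, so Hoeffding's denominator is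
      \<open>4 * card S\<close>, and a crude count of the pairs suffices.\<close>
    have "card S \<le> N\<^sup>2" unfolding S_def by (rule card_pairs_le)
    hence "real (card S) \<le> real (N\<^sup>2)" by (rule of_nat_mono)
    hence cS': "real (card S) \<le> (real N)\<^sup>2" by simp
    have "\<epsilon>\<^sup>2 / 2 * (real N)\<^sup>2 * card S \<le> \<epsilon>\<^sup>2 / 2 * (real N)\<^sup>2 * (real N)\<^sup>2"
      using cS' by (intro mult_left_mono) auto
    hence "\<epsilon>\<^sup>2 / 2 * (real N)\<^sup>2 \<le> 2 * (\<epsilon> * (real N)\<^sup>2)\<^sup>2 / (4 * card S)"
      using cS by (simp add: field_simps power2_eq_square)
    thus ?thesis by (simp add: mult.commute)
  qed
  finally show ?thesis unfolding eq .
qed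


definition edge_kernel :: "nat \<Rightarrow> (nat set \<Rightarrow> bool) \<Rightarrow> (nat set \<Rightarrow> bool) \<Rightarrow> bool \<Rightarrow> nat \<Rightarrow> nat \<Rightarrow> real" where
  "edge_kernel N f col c x y = of_bool ({x, y} \<in> nsets {..<N} 2 \<and> f {x, y} \<and> col {x, y} = c)"

text \<open>The discrepancy assumed here omits the diagonal, which the locale includes. The diagonal
  contributes at most \<open>N\<close>, and \<open>N \<ge> 2 / \<eta>\<close> makes this at most
  \<open>\<eta> / 2 * (real N)\<^sup>2\<close>.\<close>

lemma arrows_book_if_small_discrepancy:
  assumes k: "k \<ge> 1" and p0: "0 < p0" and \<zeta>: "0 < \<zeta>" "\<zeta> \<le> (1::real)" and p: "p0 \<le> p" "p \<le> 1"
    and n: "real n \<le> (1 - \<zeta>) * (p / 2) ^ k * N"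
    and none: "\<And>(V :: nat set) E p n. \<not> bookless k p0 \<zeta> \<eta> V E p n"
    and N: "N \<ge> 2" "real N \<ge> 2 / \<eta>" and \<eta>: "\<eta> > 0"
    and disc: "\<And>X Y. X \<subseteq> {..<N} \<Longrightarrow> Y \<subseteq> {..<N} \<Longrightarrow>
       \<bar>\<Sum>x\<in>X. \<Sum>y\<in>Y. of_bool (x \<noteq> y) * (of_bool (f {x, y}) - p)\<bar> < \<eta> / 2 * (real N)\<^sup>2"
  shows "arrows ({..<N}, {e \<in> nsets {..<N} 2. f e}) (book k n)"
proof (rule ccontr)
  assume "\<not> ?thesis"
  then obtain col :: "nat set \<Rightarrow> bool" where col:
    "\<And>c. \<not> contains_copy ({..<N}, {e \<in> nsets {..<N} 2. f e \<and> col e = c}) (book k n)"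
    unfolding arrows_def by auto
  define E where "E = edge_kernel N f col"
  have E1: "E c x y = 1 \<longleftrightarrow> {x, y} \<in> {e \<in> nsets {..<N} 2. f e \<and> col e = c}" for c x y
    by (simp add: E_def edge_kernel_def)
  have "bookless k p0 \<zeta> \<eta> {..<N} E p n"
  proof
    show "finite {..<N}" "{..<N} \<noteq> {}" using N by (auto simp: lessThan_empty_iff)
    show "k \<ge> 1" "0 < p0" "0 < \<zeta>" "\<zeta> \<le> 1" "p0 \<le> p" "p \<le> 1" by fact+
    show "real n \<le> (1 - \<zeta>) * (p / 2) ^ k * real (card {..<N})" using n by simp
    show "E c x y = 0 \<or> E c x y = 1" for c x y by (auto simp: E_def edge_kernel_def of_bool_def)
    show "E c x y = E c y x" for c x y
    proof -
      have "{x, y} = {y, x}" by auto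
      thus ?thesis by (simp only: E_def edge_kernel_def)
    qed
    show "\<bar>\<Sum>x\<in>X. \<Sum>y\<in>Y. E True x y + E False x y - p\<bar> \<le> \<eta> * (card {..<N})\<^sup>2"
      if XY: "X \<subseteq> {..<N}" "Y \<subseteq> {..<N}" for X Y
    proof -
      have fXY: "finite X" "finite Y" using XY finite_subset by auto
      have "(\<Sum>x\<in>X. \<Sum>y\<in>Y. E True x y + E False x y - p) =
          (\<Sum>x\<in>X. \<Sum>y\<in>Y. of_bool (x \<noteq> y) * (of_bool (f {x, y}) - p) - (if x = y then p else 0))"
        using XY by (intro sum.cong refl) (auto simp: E_def edge_kernel_def)
      also have "\<dots> = (\<Sum>x\<in>X. \<Sum>y\<in>Y. of_bool (x \<noteq> y) * (of_bool (f {x, y}) - p)) -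
          (\<Sum>x\<in>X. \<Sum>y\<in>Y. if x = y then p else 0)"
        by (simp only: sum_subtractf)
      finally have eq: "(\<Sum>x\<in>X. \<Sum>y\<in>Y. E True x y + E False x y - p) =
          (\<Sum>x\<in>X. \<Sum>y\<in>Y. of_bool (x \<noteq> y) * (of_bool (f {x, y}) - p)) -
          (\<Sum>x\<in>X. \<Sum>y\<in>Y. if x = y then p else 0)" .
      have pp: "0 \<le> p" using p p0 by linarith
      have diag: "0 \<le> (\<Sum>x\<in>X. \<Sum>y\<in>Y. if x = y then p else 0)"
        using pp by (intro sum_nonneg) auto
      have "(\<Sum>x\<in>X. \<Sum>y\<in>Y. if x = y then p else 0) \<le> (\<Sum>x\<in>X. 1)"
        using p pp fXY by (intro sum_mono) (simp add: sum.delta)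
      also have "\<dots> \<le> real N"
        using card_mono[OF _ XY(1)] by simp
      also have "\<dots> \<le> \<eta> / 2 * (real N)\<^sup>2"
        using N \<eta> by (simp add: field_simps power2_eq_square)
      finally show ?thesis using disc[OF XY] diag unfolding eq by simp
    qed
    show "card {u \<in> {..<N}. \<forall>i<k. E c (v i) u = 1} \<le> n"
      if v: "\<And>i. i < k \<Longrightarrow> v i \<in> {..<N}" and cl: "\<And>i j. i < j \<Longrightarrow> j < k \<Longrightarrow> E c (v i) (v j) = 1" for c v
    proof (rule ccontr)
      let ?A = "{e \<in> nsets {..<N} 2. f e \<and> col e = c}"
      assume "\<not> ?thesis"
      hence many: "n \<le> card {u \<in> {..<N}. \<forall>i<k. {v i, u} \<in> ?A}" unfolding E1 by simp
      have "contains_copy ({..<N}, ?A) (book k n)"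
      proof (rule contains_book_if_many_common_neighbours[OF _ v _ many])
        show "{v i, v j} \<in> ?A" if "i < j" "j < k" for i j using cl[OF that] unfolding E1 .
      qed auto
      thus False using col by blast
    qed
  qed
  thus False using none by blast
qed

text \<open>The bad events concern the graph alone, so one estimate serves all colourings at once;
  the union runs over the \<open>4 ^ N\<close> pairs \<open>(X, Y)\<close>.\<close>

lemma prob_not_arrows_book_le:
  assumes k: "k \<ge> 1" and p0: "0 < p0" and \<zeta>: "0 < \<zeta>" "\<zeta> \<le> (1::real)" and p: "p0 \<le> p" "p \<le> 1"
    and n: "real n \<le> (1 - \<zeta>) * (p / 2) ^ k * N"
    and none: "\<And>(V :: nat set) E p n. \<not> bookless k p0 \<zeta> \<eta> V E p n"
    and N: "N \<ge> 2" "real N \<ge> 2 / \<eta>" and \<eta>: "\<eta> > 0"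
  shows "1 - measure_pmf.prob (random_graph N p) {G. arrows G (book k n)}
      \<le> 4 ^ N * (2 * exp (- (\<eta>\<^sup>2 / 8) * (real N)\<^sup>2))"
proof -
  let ?M = "random_edges N p"
  define bad where "bad = (\<lambda>(X, Y). {f :: nat set \<Rightarrow> bool.
     \<bar>\<Sum>x\<in>X. \<Sum>y\<in>Y. of_bool (x \<noteq> y) * (of_bool (f {x, y}) - p)\<bar> \<ge> \<eta> / 2 * (real N)\<^sup>2})"
  define A where "A = {f. arrows ({..<N}, {e \<in> nsets {..<N} 2. f e}) (book k n)}"
  let ?P = "Pow {..<N} \<times> Pow {..<N}"
  have "- A \<subseteq> (\<Union>z\<in>?P. bad z)"
  proof
    fix f assume "f \<in> - A"
    hence "\<not> arrows ({..<N}, {e \<in> nsets {..<N} 2. f e}) (book k n)" by (simp add: A_def)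
    then obtain X Y where "X \<subseteq> {..<N}" "Y \<subseteq> {..<N}"
      "\<not> \<bar>\<Sum>x\<in>X. \<Sum>y\<in>Y. of_bool (x \<noteq> y) * (of_bool (f {x, y}) - p)\<bar> < \<eta> / 2 * (real N)\<^sup>2"
      using arrows_book_if_small_discrepancy[OF k p0 \<zeta> p n none N \<eta>] by blast
    thus "f \<in> (\<Union>z\<in>?P. bad z)" by (intro UN_I[of "(X, Y)"]) (auto simp: bad_def)
  qed
  hence "measure_pmf.prob ?M (- A) \<le> measure_pmf.prob ?M (\<Union>z\<in>?P. bad z)"
    by (intro measure_pmf.finite_measure_mono) auto
  also have "\<dots> \<le> (\<Sum>z\<in>?P. measure_pmf.prob ?M (bad z))"
    by (intro measure_pmf.finite_measure_subadditive_finite) auto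
  also have "\<dots> \<le> (\<Sum>z\<in>?P. 2 * exp (- (\<eta>\<^sup>2 / 8) * (real N)\<^sup>2))"
  proof (intro sum_mono)
    fix z assume "z \<in> ?P"
    then obtain X Y where z: "z = (X, Y)" "X \<subseteq> {..<N}" "Y \<subseteq> {..<N}" by auto
    have "measure_pmf.prob ?M (bad z) \<le> 2 * exp (- ((\<eta> / 2)\<^sup>2 / 2) * (real N)\<^sup>2)"
      unfolding z(1) bad_def prod.case using p p0 N \<eta> z by (intro prob_discrepancy_le) auto
    thus "measure_pmf.prob ?M (bad z) \<le> 2 * exp (- (\<eta>\<^sup>2 / 8) * (real N)\<^sup>2)"
      by (simp add: power_divide)
  qed
  also have "\<dots> = real (card ?P) * (2 * exp (- (\<eta>\<^sup>2 / 8) * (real N)\<^sup>2))" by simp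
  also have "real (card ?P) = 4 ^ N"
    by (simp add: card_cartesian_product card_Pow flip: power_mult_distrib)
  finally have "measure_pmf.prob ?M (- A) \<le> 4 ^ N * (2 * exp (- (\<eta>\<^sup>2 / 8) * (real N)\<^sup>2))" .
  moreover have "measure_pmf.prob ?M (- A) = 1 - measure_pmf.prob ?M A"
    using measure_pmf.prob_compl[of A ?M] by (simp add: Compl_eq_Diff_UNIV)
  moreover have "measure_pmf.prob (random_graph N p) {G. arrows G (book k n)} = measure_pmf.prob ?M A"
    by (simp add: random_graph_def A_def vimage_def)
  ultimately show ?thesis by simp
qed

lemma four_power_gaussian_le:
  assumes "a > 0" "real N \<ge> 3 / a"
  shows "4 ^ N * (2 * exp (- a * (real N)\<^sup>2)) \<le> 2 * exp (- real N)"
proof -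
  have "(4::real) ^ N \<le> exp 2 ^ N"
  proof (intro power_mono)
    have "(2::real) \<le> exp 1" using exp_ge_add_one_self[of 1] by simp
    hence "2 * 2 \<le> exp 1 * (exp 1 :: real)" by (intro mult_mono) auto
    thus "(4::real) \<le> exp 2" by (simp flip: exp_add)
  qed simp
  also have "\<dots> = exp (2 * real N)" by (simp add: exp_of_nat_mult[symmetric] mult.commute)
  finally have "4 ^ N * (2 * exp (- a * (real N)\<^sup>2)) \<le> exp (2 * real N) * (2 * exp (- a * (real N)\<^sup>2))"
    by (intro mult_right_mono) auto
  also have "\<dots> = 2 * exp (2 * real N - a * (real N)\<^sup>2)"
    by (simp add: exp_diff exp_minus field_simps)
  also have "\<dots> \<le> 2 * exp (- real N)"
  proof -
    have "3 * real N \<le> a * real N * real N"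
      using assms by (intro mult_right_mono) (auto simp: field_simps)
    thus ?thesis by (simp add: power2_eq_square mult.assoc)
  qed
  finally show ?thesis .
qed

section \<open>Books in the sparser random graph\<close>

lemma prob_many_common_neighbours_le:
  fixes n :: nat
  assumes q: "0 \<le> q" "q \<le> 1" and v: "inj_on v {..<k}" "v ` {..<k} \<subseteq> {..<N}"
    and n: "real N * q ^ k \<le> n" "n \<ge> 1"
  shows "measure_pmf.prob (random_edges N q)
      {f. n \<le> card {u \<in> {..<N}. \<forall>i<k. {v i, u} \<in> {e \<in> nsets {..<N} 2. f e}}}
     \<le> exp (- 2 * (n - real N * q ^ k)\<^sup>2 / N)"
proof -
  let ?M = "random_edges N q"
  define S where "S = nsets {..<N} 2"
  have finS: "finite S" unfolding S_def by (rule finite_pairs)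
  \<comment> \<open>A spine vertex is not adjacent to itself, so all common neighbours lie in
    \<open>U\<close>.\<close>
  define U where "U = {..<N} - v ` {..<k}"
  define K where "K = (\<lambda>u. (\<lambda>i. {v i, u}) ` {..<k})"
  define X where "X = (\<lambda>u (f :: nat set \<Rightarrow> bool). \<Prod>e\<in>K u. of_bool (f e) :: real)"
  have finU: "finite U" by (simp add: U_def)
  have vN: "v i < N" if "i < k" for i using v(2) that by auto
  have KS: "K u \<subseteq> S" if "u \<in> U" for u using that vN by (auto simp: K_def S_def U_def)
  have finK: "finite (K u)" for u by (simp add: K_def)
  \<comment> \<open>Pages outside the spine use disjoint sets of \<open>k\<close> edges, so the
    events that they are joined to the whole spine are independent, each of probability
    \<open>q ^ k\<close>.\<close>
  have disj: "disjoint_family_on K U"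
    unfolding disjoint_family_on_def by (auto simp: K_def U_def doubleton_eq_iff)
  have cardK: "card (K u) = k" if "u \<in> U" for u
  proof -
    have "inj_on (\<lambda>i. {v i, u}) {..<k}"
      using v(1) that by (auto simp: inj_on_def U_def doubleton_eq_iff)
    thus ?thesis by (simp add: K_def card_image)
  qed
  have X_eq: "X u f = of_bool (\<forall>e\<in>K u. f e)" for u f
    using finK[of u] unfolding X_def by (cases "\<forall>e\<in>K u. f e") (auto intro!: prod_zero)
  have indep: "prob_space.indep_vars (measure_pmf ?M) (\<lambda>_. borel) X U"
  proof -
    have 1: "prob_space.indep_vars (measure_pmf ?M) (\<lambda>_. count_space UNIV) (\<lambda>x f. f x) S"
      unfolding S_def by (rule indep_vars_Pi_pmf[OF finite_pairs])
    have 2: "prob_space.indep_vars (measure_pmf ?M) (\<lambda>u. PiM (K u) (\<lambda>_. count_space UNIV))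
        (\<lambda>u f. restrict (\<lambda>i. f i) (K u)) U"
      by (rule prob_space.indep_vars_restrict[OF measure_pmf.prob_space_axioms 1 KS disj])
    have "prob_space.indep_vars (measure_pmf ?M) (\<lambda>_. borel)
        (\<lambda>u f. (\<lambda>g. \<Prod>e\<in>K u. of_bool (g e) :: real) (restrict (\<lambda>i. f i) (K u))) U"
    proof (rule prob_space.indep_vars_compose2[OF measure_pmf.prob_space_axioms 2])
      fix u assume "u \<in> U"
      show "(\<lambda>g. \<Prod>e\<in>K u. of_bool (g e) :: real) \<in> borel_measurable (PiM (K u) (\<lambda>_. count_space UNIV))"
      proof (rule borel_measurable_prod)
        fix e assume e: "e \<in> K u"
        show "(\<lambda>g. of_bool (g e) :: real) \<in> borel_measurable (PiM (K u) (\<lambda>_. count_space UNIV))"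
          by (rule measurable_compose[OF measurable_component_singleton[OF e]]) simp
      qed
    qed
    thus ?thesis by (simp add: X_def cong: prod.cong)
  qed
  have E: "measure_pmf.expectation ?M (X u) = q ^ k" if u: "u \<in> U" for u
  proof -
    have "measure_pmf.expectation ?M (X u) = measure_pmf.expectation ?M
        (\<lambda>f. \<Prod>e\<in>S. (if e \<in> K u then of_bool (f e) else 1))"
    proof (rule arg_cong[where f = "measure_pmf.expectation ?M"], rule ext)
      fix f
      show "X u f = (\<Prod>e\<in>S. (if e \<in> K u then of_bool (f e) else 1))"
        unfolding X_def using finS KS[OF u] by (simp add: prod.If_cases Int_absorb1)
    qed
    also have "\<dots> = (\<Prod>e\<in>S. measure_pmf.expectation (bernoulli_pmf q)
        (\<lambda>b. if e \<in> K u then of_bool b else 1))"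
      unfolding S_def
      by (rule expectation_prod_Pi_pmf[OF finite_pairs]) (auto intro: integrable_measure_pmf_finite)
    also have "\<dots> = (\<Prod>e\<in>S. if e \<in> K u then q else 1)"
      using q by (intro prod.cong refl) auto
    also have "\<dots> = q ^ k" using finS KS[OF u] cardK[OF u] by (simp add: prod.If_cases Int_absorb1)
    finally show ?thesis .
  qed
  interpret H: Hoeffding_ineq "measure_pmf ?M" U X "\<lambda>_. 0" "\<lambda>_. 1"
    "\<Sum>u\<in>U. measure_pmf.expectation ?M (X u)"
    by unfold_locales (use finU indep in \<open>auto simp: X_eq intro!: AE_pmfI\<close>)
  have Esum: "(\<Sum>u\<in>U. measure_pmf.expectation ?M (X u)) = card U * q ^ k"
    using E by simp
  have card_eq: "real (card {u \<in> {..<N}. \<forall>i<k. {v i, u} \<in> {e \<in> nsets {..<N} 2. f e}}) \<le> (\<Sum>u\<in>U. X u f)" for f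
  proof -
    have "{u \<in> {..<N}. \<forall>i<k. {v i, u} \<in> {e \<in> nsets {..<N} 2. f e}} \<subseteq> {u \<in> U. \<forall>e\<in>K u. f e}"
      by (auto simp: U_def K_def)
    hence "card {u \<in> {..<N}. \<forall>i<k. {v i, u} \<in> {e \<in> nsets {..<N} 2. f e}} \<le> card {u \<in> U. \<forall>e\<in>K u. f e}"
      using finU by (intro card_mono) auto
    moreover have "(\<Sum>u\<in>U. X u f) = card {u \<in> U. \<forall>e\<in>K u. f e}"
      using finU by (simp add: X_eq of_bool_def sum.If_cases Int_def)
    ultimately show ?thesis by simp
  qed
  have UN: "card U \<le> N" using card_mono[of "{..<N}" U] by (auto simp: U_def)
  hence UN': "card U * q ^ k \<le> real N * q ^ k" using q by (intro mult_right_mono) auto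
  show ?thesis
  \<comment> \<open>Hoeffding's inequality requires a positive sum of squared ranges. Without
    candidate pages the event is empty, because \<open>n \<ge> 1\<close>.\<close>
  proof (cases "card U = 0")
    case True
    hence U0: "U = {}" using finU by simp
    have "\<not> n \<le> card {u \<in> {..<N}. \<forall>i<k. {v i, u} \<in> {e \<in> nsets {..<N} 2. f e}}" for f
      using card_eq[of f] n(2) unfolding U0 sum.empty by linarith
    hence "{f. n \<le> card {u \<in> {..<N}. \<forall>i<k. {v i, u} \<in> {e \<in> nsets {..<N} 2. f e}}} = {}"
      by blast
    thus ?thesis by (simp only: measure_empty exp_ge_zero)
  next
    case False
    define t where "t = real n - card U * q ^ k"
    have t: "t \<ge> 0" "real n - real N * q ^ k \<le> t" using UN' n by (auto simp: t_def)
    have pos: "0 < (\<Sum>u\<in>U. (1 - 0 :: real)\<^sup>2)" using False by simp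
    have "measure_pmf.prob ?M {f. n \<le> card {u \<in> {..<N}. \<forall>i<k. {v i, u} \<in> {e \<in> nsets {..<N} 2. f e}}}
        \<le> measure_pmf.prob ?M {f. (\<Sum>u\<in>U. X u f) \<ge> card U * q ^ k + t}"
    proof (intro measure_pmf.finite_measure_mono Collect_mono impI)
      fix f assume "n \<le> card {u \<in> {..<N}. \<forall>i<k. {v i, u} \<in> {e \<in> nsets {..<N} 2. f e}}"
      thus "card U * q ^ k + t \<le> (\<Sum>u\<in>U. X u f)" using card_eq[of f] by (simp add: t_def)
    qed simp
    also have "\<dots> \<le> exp (- 2 * t\<^sup>2 / (\<Sum>u\<in>U. (1 - 0)\<^sup>2))"
      using H.Hoeffding_ineq_ge[OF t(1) pos, unfolded Esum] by simp
    also have "\<dots> \<le> exp (- 2 * (n - real N * q ^ k)\<^sup>2 / N)"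
    proof -
      have "(n - real N * q ^ k)\<^sup>2 / N \<le> t\<^sup>2 / card U"
        using t n UN False by (intro frac_le power_mono) auto
      thus ?thesis by simp
    qed
    finally show ?thesis .
  qed
qed

lemma prob_contains_book_le:
  fixes n :: nat
  assumes q: "0 \<le> q" "q \<le> 1" and n: "real N * q ^ k \<le> n" "n \<ge> 1"
  shows "measure_pmf.prob (random_edges N q)
      {f. contains_copy ({..<N}, {e \<in> nsets {..<N} 2. f e}) (book k n)}
     \<le> real N ^ k * exp (- 2 * (n - real N * q ^ k)\<^sup>2 / N)"
proof -
  let ?M = "random_edges N q"
  define B where "B = (\<lambda>v. {f. n \<le> card {u \<in> {..<N}. \<forall>i<k. {v i, u} \<in> {e \<in> nsets {..<N} 2. f e}}})"
  define I where "I = {v \<in> PiE {..<k} (\<lambda>_. {..<N}). inj_on v {..<k}}"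
  have finI: "finite I" unfolding I_def by (rule finite_subset[OF _ finite_PiE[of "{..<k}" "\<lambda>_. {..<N}"]]) auto
  have "card I \<le> card (PiE {..<k} (\<lambda>_. {..<N}))"
    by (intro card_mono finite_PiE) (auto simp: I_def)
  hence cI: "real (card I) \<le> real N ^ k" by (simp add: card_PiE flip: of_nat_power)
  have "{f. contains_copy ({..<N}, {e \<in> nsets {..<N} 2. f e}) (book k n)} \<subseteq> (\<Union>v\<in>I. B v)"
  proof
    fix f assume "f \<in> {f. contains_copy ({..<N}, {e \<in> nsets {..<N} 2. f e}) (book k n)}"
    then obtain v where v: "inj_on v {..<k}" "v ` {..<k} \<subseteq> {..<N}"
      "n \<le> card {u \<in> {..<N}. \<forall>i<k. {v i, u} \<in> {e \<in> nsets {..<N} 2. f e}}"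
      using many_common_neighbours_if_contains_book[of "{..<N}" "{e \<in> nsets {..<N} 2. f e}" k n] by auto
    have "restrict v {..<k} \<in> I" using v by (auto simp: I_def inj_on_def)
    moreover have "f \<in> B (restrict v {..<k})" using v(3) by (simp add: B_def)
    ultimately show "f \<in> (\<Union>v\<in>I. B v)" by blast
  qed
  hence "measure_pmf.prob ?M {f. contains_copy ({..<N}, {e \<in> nsets {..<N} 2. f e}) (book k n)}
      \<le> measure_pmf.prob ?M (\<Union>v\<in>I. B v)"
    by (intro measure_pmf.finite_measure_mono) auto
  also have "\<dots> \<le> (\<Sum>v\<in>I. measure_pmf.prob ?M (B v))"
    using finI by (intro measure_pmf.finite_measure_subadditive_finite) auto
  also have "\<dots> \<le> (\<Sum>v\<in>I. exp (- 2 * (n - real N * q ^ k)\<^sup>2 / N))"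
    unfolding B_def using q n by (intro sum_mono prob_many_common_neighbours_le) (auto simp: I_def)
  also have "\<dots> = real (card I) * exp (- 2 * (n - real N * q ^ k)\<^sup>2 / N)" by simp
  also have "\<dots> \<le> real N ^ k * exp (- 2 * (n - real N * q ^ k)\<^sup>2 / N)"
    using cI by (intro mult_right_mono) auto
  finally show ?thesis .
qed

lemma map_pmf_eq_bernoulli: "map_pmf (\<lambda>z. z = a) M = bernoulli_pmf (pmf M a)"
proof (rule pmf_eqI)
  have True_eq: "pmf (map_pmf (\<lambda>z. z = a) M) True = pmf M a"
    by (simp add: pmf_map vimage_def measure_pmf_single)
  fix b show "pmf (map_pmf (\<lambda>z. z = a) M) b = pmf (bernoulli_pmf (pmf M a)) b"
    using True_eq by (cases b) (simp_all add: pmf_le_1 pmf_False_conv_True)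
qed

text \<open>
  Colouring the edges of \<open>G(N, p)\<close> by independent fair coins makes each colour class a \<open>G(N, p/2)\<close>.
\<close>
lemma prob_arrows_book_le:
  assumes p: "0 \<le> p" "p \<le> 1"
  shows "measure_pmf.prob (random_graph N p) {G. arrows G (book k n)} \<le>
     2 * measure_pmf.prob (random_edges N (p / 2))
           {f. contains_copy ({..<N}, {e \<in> nsets {..<N} 2. f e}) (book k n)}"
proof -
  define S where "S = nsets {..<N} 2"
  have finS: "finite S" unfolding S_def by (rule finite_pairs)
  define \<Omega> where "\<Omega> = Pi_pmf S (False, False) (\<lambda>_. pair_pmf (bernoulli_pmf p) (bernoulli_pmf (1 / 2)))"
  define T where "T = {f. contains_copy ({..<N}, {e \<in> S. f e}) (book k n)}"
  have 1: "random_edges N p = map_pmf (\<lambda>\<omega>. fst \<circ> \<omega>) \<Omega>"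
    using Pi_pmf_map[OF finS, of fst "(False, False)" False
        "\<lambda>_. pair_pmf (bernoulli_pmf p) (bernoulli_pmf (1 / 2))"]
    by (simp add: \<Omega>_def S_def map_fst_pair_pmf)
  have 2: "random_edges N (p / 2) = map_pmf (\<lambda>\<omega>. (\<lambda>z. z = (True, c)) \<circ> \<omega>) \<Omega>" for c
    using Pi_pmf_map[OF finS, of "\<lambda>z. z = (True, c)" "(False, False)" False
        "\<lambda>_. pair_pmf (bernoulli_pmf p) (bernoulli_pmf (1 / 2))"] p
    by (simp add: \<Omega>_def S_def map_pmf_eq_bernoulli pmf_pair)
  define Q where "Q = (\<lambda>c :: bool. {\<omega>. (\<lambda>z. z = (True, c)) \<circ> \<omega> \<in> T})"
  have Q: "measure_pmf.prob \<Omega> (Q c) = measure_pmf.prob (random_edges N (p / 2)) T" for c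
    unfolding 2[of c] Q_def by (simp add: vimage_def)
  have "measure_pmf.prob (random_graph N p) {G. arrows G (book k n)} =
      measure_pmf.prob \<Omega> {\<omega>. arrows ({..<N}, {e \<in> S. fst (\<omega> e)}) (book k n)}"
    unfolding random_graph_def 1 by (simp add: vimage_def S_def)
  also have "\<dots> \<le> measure_pmf.prob \<Omega> (Q True \<union> Q False)"
  proof (intro measure_pmf.finite_measure_mono subsetI)
    fix \<omega> :: "nat set \<Rightarrow> bool \<times> bool"
    assume "\<omega> \<in> {\<omega>. arrows ({..<N}, {e \<in> S. fst (\<omega> e)}) (book k n)}"
    hence "arrows ({..<N}, {e \<in> S. fst (\<omega> e)}) (book k n)" by simp
    \<comment> \<open>\<open>arrows\<close> speaks of every colouring, in particular of the one read
      off the coins of the same sample.\<close>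
    from this[unfolded arrows_def, THEN spec[of _ "\<lambda>e. snd (\<omega> e)"]]
    obtain c where "contains_copy ({..<N}, {e \<in> {e \<in> S. fst (\<omega> e)}. snd (\<omega> e) = c}) (book k n)"
      by auto
    moreover have "{e \<in> {e \<in> S. fst (\<omega> e)}. snd (\<omega> e) = c} = {e \<in> S. ((\<lambda>z. z = (True, c)) \<circ> \<omega>) e}"
      by (auto simp: prod_eq_iff)
    ultimately have "\<omega> \<in> Q c" by (simp add: Q_def T_def)
    thus "\<omega> \<in> Q True \<union> Q False" by (cases c) auto
  qed simp
  also have "\<dots> \<le> measure_pmf.prob \<Omega> (Q True) + measure_pmf.prob \<Omega> (Q False)"
    by (intro measure_Un_le) auto
  also have "\<dots> = 2 * measure_pmf.prob (random_edges N (p / 2)) T" by (simp add: Q)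
  finally show ?thesis by (simp add: T_def S_def)
qed


section \<open>The two limits\<close>

lemma powr_inverse_power:
  assumes "(c::real) > 0" "k \<ge> 1"
  shows "(1 / c powr (1 / real k) * t) ^ k = t ^ k / c"
proof -
  have "(c powr (1 / real k)) ^ k = c"
    using assms by (simp add: powr_realpow[symmetric] powr_powr)
  thus ?thesis by (simp add: power_mult_distrib power_divide)
qed

lemma prob_arrows_book_tendsto_0:
  fixes N :: "nat \<Rightarrow> nat" and p :: "nat \<Rightarrow> real"
  assumes k: "k \<ge> 1" and c: "c > 1" and \<gamma>: "\<gamma> > 0"
    and N: "\<And>n. n \<ge> 1 \<Longrightarrow> \<bar>real (N n) - c * 2 ^ k * real n\<bar> < 1"
    and p: "\<And>n. n \<ge> 1 \<Longrightarrow> 0 \<le> p n \<and> p n \<le> 1"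
    and le: "\<And>n. n \<ge> 1 \<Longrightarrow> p n \<le> 1 / c powr (1 / real k) * (1 - \<gamma>)"
  shows "(\<lambda>n. measure_pmf.prob (random_graph (N n) (p n)) {G. arrows G (book k n)}) \<longlonglongrightarrow> 0"
proof -
  define K where "K = c * 2 ^ k + 1"
  have c2: "c * 2 ^ k \<ge> 1"
  proof -
    have "1 * 1 \<le> c * 2 ^ k" using c by (intro mult_mono one_le_power) auto
    thus ?thesis by simp
  qed
  have K: "K \<ge> 1" using c2 by (simp add: K_def)
  have cr: "c powr (1 / real k) > 0" using c by simp
  \<comment> \<open>For \<open>\<gamma> > 1\<close> the assumed upper bound would be negative,
    against \<open>p 1 \<ge> 0\<close>.\<close>
  have \<gamma>1: "\<gamma> \<le> 1"
  proof (rule ccontr)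
    assume "\<not> ?thesis"
    hence "1 / c powr (1 / real k) * (1 - \<gamma>) < 0" using cr by (intro mult_pos_neg) auto
    thus False using le[of 1] p[of 1] by simp
  qed
  \<comment> \<open>The exponent from Hoeffding's inequality with deviation
    \<open>\<gamma> / 2 * n\<close> and at most \<open>K * n\<close> vertices is
    \<open>b * n\<close>.\<close>
  define b where "b = \<gamma>\<^sup>2 / (2 * K)"
  have b: "b > 0" using \<gamma> K by (simp add: b_def)
  have bound: "measure_pmf.prob (random_graph (N n) (p n)) {G. arrows G (book k n)}
      \<le> 2 * (K / b) ^ k * ((b * real n) ^ k / exp (b * real n))"
    if n: "n \<ge> 1" "real n \<ge> 2 / \<gamma>" for n
  proof -
    define q where "q = p n / 2"
    have q: "0 \<le> q" "q \<le> 1" using p[OF n(1)] by (auto simp: q_def)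
    have n1: "real n \<ge> 1" using n by simp
    have N1: "real (N n) \<le> c * 2 ^ k * n + 1" using N[OF n(1)] by linarith
    have NK: "real (N n) \<le> K * n" using N1 n1 by (simp add: K_def algebra_simps)
    have "c * 2 ^ k * n \<ge> 1 * 1" using c2 n1 by (intro mult_mono) auto
    hence Npos: "real (N n) > 0" using N[OF n(1)] by linarith
    have "p n ^ k \<le> (1 / c powr (1 / real k) * (1 - \<gamma>)) ^ k"
      using p[OF n(1)] le[OF n(1)] by (intro power_mono) auto
    also have "\<dots> = (1 - \<gamma>) ^ k / c" using c k by (intro powr_inverse_power) auto
    also have "\<dots> \<le> (1 - \<gamma>) / c"
      using power_decreasing[of 1 k "1 - \<gamma>"] k \<gamma> \<gamma>1 c by (intro divide_right_mono) auto
    finally have pk: "p n ^ k \<le> (1 - \<gamma>) / c" .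
    have "real (N n) * q ^ k = real (N n) * p n ^ k / 2 ^ k" by (simp add: q_def power_divide)
    also have "\<dots> \<le> (c * 2 ^ k * n + 1) * ((1 - \<gamma>) / c) / 2 ^ k"
      using N1 pk p[OF n(1)] by (intro divide_right_mono mult_mono) auto
    also have "\<dots> = (1 - \<gamma>) * n + (1 - \<gamma>) / (c * 2 ^ k)" using c by (simp add: field_simps)
    also have "\<dots> \<le> (1 - \<gamma>) * n + 1"
    proof -
      have "(1 - \<gamma>) / (c * 2 ^ k) \<le> 1 / 1" using \<gamma> \<gamma>1 c2 by (intro frac_le) auto
      thus ?thesis by simp
    qed
    \<comment> \<open>From \<open>n \<ge> 2 / \<gamma>\<close> on, the rounding error 1 fits into
      half of the gap \<open>\<gamma> * n\<close>.\<close>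
    also have "\<dots> \<le> (1 - \<gamma> / 2) * n" using n(2) \<gamma> by (simp add: field_simps)
    finally have Nq: "real (N n) * q ^ k \<le> (1 - \<gamma> / 2) * n" .
    have "(1 - \<gamma> / 2) * real n \<le> 1 * real n" using \<gamma> by (intro mult_right_mono) auto
    hence Nq': "real (N n) * q ^ k \<le> n" using Nq by linarith
    have "measure_pmf.prob (random_graph (N n) (p n)) {G. arrows G (book k n)}
        \<le> 2 * (real (N n) ^ k * exp (- 2 * (n - real (N n) * q ^ k)\<^sup>2 / N n))"
      using prob_arrows_book_le[of "p n" "N n" k n] p[OF n(1)]
        prob_contains_book_le[OF q Nq' n(1)] unfolding q_def by linarith
    also have "\<dots> \<le> 2 * ((K * n) ^ k * exp (- (b * n)))"
    proof (intro mult_left_mono mult_mono power_mono NK)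
      have "\<gamma> / 2 * n \<le> n - real (N n) * q ^ k" using Nq by (simp add: algebra_simps)
      hence "(\<gamma> / 2 * n)\<^sup>2 \<le> (n - real (N n) * q ^ k)\<^sup>2" using \<gamma> by (intro power_mono) auto
      hence "(\<gamma> / 2 * n)\<^sup>2 / (K * n) \<le> (n - real (N n) * q ^ k)\<^sup>2 / N n"
        using NK Npos by (intro frac_le) auto
      moreover have "2 * ((\<gamma> / 2 * n)\<^sup>2 / (K * n)) = b * n"
        using n1 K by (simp add: b_def power2_eq_square field_simps)
      ultimately have "b * n \<le> 2 * ((n - real (N n) * q ^ k)\<^sup>2 / N n)" by linarith
      thus "exp (- 2 * (n - real (N n) * q ^ k)\<^sup>2 / N n) \<le> exp (- (b * n))" by simp
    qed (use K in auto)
    also have "\<dots> = 2 * (K / b) ^ k * ((b * real n) ^ k / exp (b * real n))"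
      using b by (simp add: exp_minus power_mult_distrib power_divide field_simps)
    finally show ?thesis .
  qed
  have "filterlim (\<lambda>n. b * real n) at_top sequentially"
    using b by (intro filterlim_tendsto_pos_mult_at_top[OF tendsto_const] filterlim_real_sequentially)
  hence "(\<lambda>n. (b * real n) ^ k / exp (b * real n)) \<longlonglongrightarrow> 0"
    by (rule filterlim_compose[OF tendsto_power_div_exp_0])
  hence lim: "(\<lambda>n. 2 * (K / b) ^ k * ((b * real n) ^ k / exp (b * real n))) \<longlonglongrightarrow> 0"
    by (rule tendsto_mult_right_zero)
  show ?thesis
  proof (rule tendsto_sandwich[OF _ _ tendsto_const lim])
    obtain n0 :: nat where "real n0 \<ge> 2 / \<gamma>" using real_arch_simple by blast
    hence "real n \<ge> 2 / \<gamma>" if "n \<ge> n0" for n using that by linarith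
    thus "\<forall>\<^sub>F n in sequentially. measure_pmf.prob (random_graph (N n) (p n)) {G. arrows G (book k n)}
        \<le> 2 * (K / b) ^ k * ((b * real n) ^ k / exp (b * real n))"
      using bound by (intro eventually_sequentiallyI[of "max n0 1"]) auto
  qed simp
qed

lemma prob_arrows_book_tendsto_1:
  fixes N :: "nat \<Rightarrow> nat" and p :: "nat \<Rightarrow> real"
  assumes k: "k \<ge> 1" and c: "c > 1" and \<gamma>: "\<gamma> > 0"
    and N: "\<And>n. n \<ge> 1 \<Longrightarrow> \<bar>real (N n) - c * 2 ^ k * real n\<bar> < 1"
    and p: "\<And>n. n \<ge> 1 \<Longrightarrow> 0 \<le> p n \<and> p n \<le> 1"
    and ge: "\<And>n. n \<ge> 1 \<Longrightarrow> p n \<ge> 1 / c powr (1 / real k) * (1 + \<gamma>)"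
  shows "(\<lambda>n. measure_pmf.prob (random_graph (N n) (p n)) {G. arrows G (book k n)}) \<longlonglongrightarrow> 1"
proof -
  define p0 where "p0 = 1 / c powr (1 / real k) * (1 + \<gamma>)"
  have p0: "p0 > 0" using c \<gamma> by (simp add: p0_def)
  \<comment> \<open>Then \<open>(1 - \<zeta>) * (1 + \<gamma>) = 1 + \<gamma> / 2\<close>: half of
    the gain goes to \<open>\<zeta>\<close>, and the rest absorbs the rounding of
    \<open>N n\<close>.\<close>
  define \<zeta> where "\<zeta> = \<gamma> / (2 * (1 + \<gamma>))"
  have \<zeta>: "0 < \<zeta>" "\<zeta> \<le> 1" using \<gamma> by (auto simp: \<zeta>_def field_simps)
  from quasirandom_not_bookless[OF k p0 \<zeta>, where 'a = nat]
  obtain \<eta> where \<eta>: "\<eta> > 0" and none: "\<And>(V :: nat set) E p n. \<not> bookless k p0 \<zeta> \<eta> V E p n"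
    by auto
  have c2: "c * 2 ^ k \<ge> 2"
  proof -
    have "(2::real) \<le> 2 ^ k" using power_increasing[of 1 k "2::real"] k by simp
    hence "1 * 2 \<le> c * 2 ^ k" using c by (intro mult_mono) auto
    thus ?thesis by simp
  qed
  have a: "\<eta>\<^sup>2 / 8 > 0" using \<eta> by simp
  \<comment> \<open>The summands stand for four separate lower bounds on \<open>n\<close>; the last
    one is equivalent to \<open>(1 + \<gamma> / 2) * (n - 1) \<ge> n\<close>.\<close>
  obtain n0 :: nat where n0: "real n0 \<ge> 2 + 2 / \<eta> + 3 / (\<eta>\<^sup>2 / 8) + (1 + \<gamma> / 2) / (\<gamma> / 2)"
    using real_arch_simple by blast
  have bound: "1 - 2 * exp (- real n) \<le>
      measure_pmf.prob (random_graph (N n) (p n)) {G. arrows G (book k n)}" if n: "n \<ge> n0" for n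
  proof -
    have pos: "2 / \<eta> \<ge> 0" "3 / (\<eta>\<^sup>2 / 8) \<ge> 0" "(1 + \<gamma> / 2) / (\<gamma> / 2) \<ge> 0" using \<eta> \<gamma> by auto
    have "real n0 \<le> real n" using n by simp
    hence nn: "real n \<ge> 2" "real n \<ge> 2 / \<eta>" "real n \<ge> 3 / (\<eta>\<^sup>2 / 8)" "real n \<ge> (1 + \<gamma> / 2) / (\<gamma> / 2)"
      using n0 pos by linarith+
    have n1: "n \<ge> 1" using nn(1) by linarith
    have N1: "c * 2 ^ k * n - 1 \<le> N n" using N[OF n1] by linarith
    have "2 * real n \<le> c * 2 ^ k * n" using c2 by (intro mult_right_mono) auto
    hence Nn: "real n \<le> N n" using N1 nn(1) by linarith
    have pk: "(1 + \<gamma>) / c \<le> p n ^ k"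
    proof -
      have "(1 + \<gamma>) / c \<le> (1 + \<gamma>) ^ k / c"
        using power_increasing[of 1 k "1 + \<gamma>"] k \<gamma> c by (intro divide_right_mono) auto
      also have "\<dots> = p0 ^ k" unfolding p0_def using c k by (intro powr_inverse_power[symmetric]) auto
      also have "\<dots> \<le> p n ^ k" using ge[OF n1] p0 by (intro power_mono) (auto simp: p0_def)
      finally show ?thesis .
    qed
    have "real n \<le> (1 - \<zeta>) * ((1 + \<gamma>) * (n - 1))"
    proof -
      have "(1 - \<zeta>) * (1 + \<gamma>) = 1 + \<gamma> / 2" using \<gamma> by (simp add: \<zeta>_def field_simps)
      hence "(1 - \<zeta>) * ((1 + \<gamma>) * (n - 1)) = (1 + \<gamma> / 2) * (real n - 1)"
        using n1 by (simp add: of_nat_diff flip: mult.assoc)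
      also have "\<dots> \<ge> n" using nn(4) \<gamma> by (simp add: field_simps)
      finally show ?thesis .
    qed
    also have "\<dots> \<le> (1 - \<zeta>) * ((p n / 2) ^ k * N n)"
    proof (intro mult_left_mono)
      have "(1 + \<gamma>) * (real n - 1) \<le> (1 + \<gamma>) * (real n - 1 / (c * 2 ^ k))"
        using \<gamma> c2 by (intro mult_left_mono) (auto simp: field_simps)
      also have "\<dots> = (1 + \<gamma>) / c / 2 ^ k * (c * 2 ^ k * n - 1)" using c by (simp add: field_simps)
      also have "\<dots> \<le> p n ^ k / 2 ^ k * N n"
      proof (intro mult_mono divide_right_mono pk N1)
        show "0 \<le> c * 2 ^ k * n - 1"
          using \<open>2 * real n \<le> c * 2 ^ k * n\<close> nn(1) by linarith
      qed (use p[OF n1] in auto)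
      finally show "(1 + \<gamma>) * real (n - 1) \<le> (p n / 2) ^ k * N n"
        using n1 by (simp add: power_divide of_nat_diff)
    qed (use \<zeta> in auto)
    finally have n_le: "real n \<le> (1 - \<zeta>) * (p n / 2) ^ k * N n" by (simp add: mult.assoc)
    have "1 - measure_pmf.prob (random_graph (N n) (p n)) {G. arrows G (book k n)}
      \<le> 4 ^ N n * (2 * exp (- (\<eta>\<^sup>2 / 8) * (real (N n))\<^sup>2))"
    proof (rule prob_not_arrows_book_le[OF k p0 \<zeta> _ _ n_le none])
      show "p0 \<le> p n" using ge[OF n1] by (simp add: p0_def)
      show "p n \<le> 1" using p[OF n1] by simp
    qed (use nn Nn \<eta> in auto)
    also have "\<dots> \<le> 2 * exp (- real (N n))"
      using nn Nn by (intro four_power_gaussian_le a) linarith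
    also have "\<dots> \<le> 2 * exp (- real n)" using Nn by simp
    finally show ?thesis by linarith
  qed
  have "(\<lambda>n. exp (- real n)) \<longlonglongrightarrow> 0"
    by (rule filterlim_compose[OF exp_at_bot])
       (simp add: filterlim_uminus_at_bot filterlim_real_sequentially)
  hence "(\<lambda>n. 1 - 2 * exp (- real n)) \<longlonglongrightarrow> 1 - 2 * 0" by (intro tendsto_intros)
  hence lim: "(\<lambda>n. 1 - 2 * exp (- real n)) \<longlonglongrightarrow> 1" by simp
  show ?thesis
  proof (rule tendsto_sandwich[OF _ _ lim tendsto_const])
    show "\<forall>\<^sub>F n in sequentially. 1 - 2 * exp (- real n) \<le>
        measure_pmf.prob (random_graph (N n) (p n)) {G. arrows G (book k n)}"
      using bound by (rule eventually_sequentiallyI)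
  qed simp
qed

theorem theorem1p1:
  fixes k :: nat and c \<gamma> :: real and N :: "nat \<Rightarrow> nat" and p :: "nat \<Rightarrow> real"
  assumes "k \<ge> 1" and "c > 1" and "\<gamma> > 0"
    and "\<And>n. n \<ge> 1 \<Longrightarrow> \<bar>real (N n) - c * 2 ^ k * real n\<bar> < 1"
    and "\<And>n. n \<ge> 1 \<Longrightarrow> 0 \<le> p n \<and> p n \<le> 1"
  shows
    "((\<forall>n\<ge>1. p n \<le> 1 / c powr (1 / real k) * (1 - \<gamma>)) \<longrightarrow>
        (\<lambda>n. measure_pmf.prob (random_graph (N n) (p n)) {G. arrows G (book k n)})
          \<longlonglongrightarrow> 0) \<and>
     ((\<forall>n\<ge>1. p n \<ge> 1 / c powr (1 / real k) * (1 + \<gamma>)) \<longrightarrow>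
        (\<lambda>n. measure_pmf.prob (random_graph (N n) (p n)) {G. arrows G (book k n)})
          \<longlonglongrightarrow> 1)"
proof (intro conjI impI)
  assume "\<forall>n\<ge>1. p n \<le> 1 / c powr (1 / real k) * (1 - \<gamma>)"
  hence "p n \<le> 1 / c powr (1 / real k) * (1 - \<gamma>)" if "n \<ge> 1" for n using that by blast
  from prob_arrows_book_tendsto_0[OF assms this]
  show "(\<lambda>n. measure_pmf.prob (random_graph (N n) (p n)) {G. arrows G (book k n)}) \<longlonglongrightarrow> 0" .
next
  assume "\<forall>n\<ge>1. p n \<ge> 1 / c powr (1 / real k) * (1 + \<gamma>)"
  hence "p n \<ge> 1 / c powr (1 / real k) * (1 + \<gamma>)" if "n \<ge> 1" for n using that by blast
  from prob_arrows_book_tendsto_1[OF assms this]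
  show "(\<lambda>n. measure_pmf.prob (random_graph (N n) (p n)) {G. arrows G (book k n)}) \<longlonglongrightarrow> 1" .
qed

end
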